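(* Let $\pi$ be a permutation of $[n]$ covered by $\sigma$ shuffled upsequences of lengths $\mathcal{S}$. There is an encoding scheme representing $\pi$ in at most $2n(1+H(\mathcal{S}))+o(n\log\sigma)+O(\sigma\log n)$ bits which supports $\pi(i)$ and $\pi^{-1}(i)$ in time $O(1+\log\sigma)$ for any $i\in[n]$. If $i$ is chosen uniformly at random in $[n]$, the average time is $O\!\left(1+H(\mathcal{S})+\frac{\log\sigma}{\log\log n}\right)$.
   Context: Notation: $[x]=\{1,\ldots,x\}$, $\lg x=\log_2 x$. The model is the word RAM with words of $\Theta(\log n)$ bits; $o(\cdot)$ terms are asymptotic in $n$. For a sequence of positive integers $X=\langle n_1,\ldots,n_r\rangle$ summing to $n$, $H(X)=\sum_{i=1}^r \frac{n_i}{n}\lg\frac{n}{n_i}$. A decomposition of a permutation $\pi$ of $[n]$ into shuffled upsequences is a partition of the positions $[n]$ into (not necessarily contiguous) subsequences each having increasing values. $\sigma$ is the minimum number of subsequences in such a decomposition and $\mathcal{S}$ the sequence of their lengths (in arbitrary order). *)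

theory Defs
  imports
    "HOL-Probability.Probability"
    "HOL-Library.Disjoint_Sets"
    "HOL-Library.Landau_Symbols"
    "HOL-Library.Multiset"
    "HOL-Combinatorics.Permutations"
begin

section \<open>Shuffled upsequences and entropy\<close>

definition shuffled_upsequences :: "nat \<Rightarrow> (nat \<Rightarrow> nat) \<Rightarrow> nat set set \<Rightarrow> bool" where
  "shuffled_upsequences n \<pi> P \<longleftrightarrow>
     partition_on {1..n} P \<and> (\<forall>B\<in>P. strict_mono_on B \<pi>)"

definition min_upsequences :: "nat \<Rightarrow> (nat \<Rightarrow> nat) \<Rightarrow> nat" where
  "min_upsequences n \<pi> = (LEAST k. \<exists>P. shuffled_upsequences n \<pi> P \<and> card P = k)"

definition seq_entropy :: "nat list \<Rightarrow> real" where
  "seq_entropy X =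
     (\<Sum>x\<leftarrow>X. real x / real (sum_list X) * log 2 (real (sum_list X) / real x))"

section \<open>The word RAM\<close>

text \<open>
  A machine with word length \<open>w\<close> computes on natural numbers below \<open>2 ^ w\<close>.
  A program is a finite command that accesses registers by fixed names, so that only finitely
  many registers occur in it.  The memory is addressed by the contents of a word.  Each elementary instruction and each
  evaluation of a test takes one time unit.
\<close>

datatype operand = Reg nat | Imm nat

datatype binop = Add | Sub | Mul | Div | Mod | And | Or | Xor | Shl | Shr

datatype test = Equal operand operand | Less operand operand

datatype com =
    Skip
  | Op nat binop operand operand
  | Load nat operand
  | Store operand operand
  | Seq com com
  | If test com com
  | While test com

text \<open>The components of a state are the registers and the memory.\<close>

type_synonym state = "(nat \<Rightarrow> nat) \<times> (nat \<Rightarrow> nat)"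

definition word_state :: "nat \<Rightarrow> state \<Rightarrow> bool" where
  "word_state w s \<longleftrightarrow> (\<forall>k. fst s k < 2 ^ w) \<and> (\<forall>a. snd s a < 2 ^ w)"

fun val :: "nat \<Rightarrow> (nat \<Rightarrow> nat) \<Rightarrow> operand \<Rightarrow> nat" where
  "val w r (Reg k) = r k"
| "val w r (Imm c) = c mod 2 ^ w"

text \<open>All results are reduced modulo \<open>2 ^ w\<close>; division by zero yields \<open>0\<close>.\<close>

fun apply_op :: "nat \<Rightarrow> binop \<Rightarrow> nat \<Rightarrow> nat \<Rightarrow> nat" where
  "apply_op w Add a b = (a + b) mod 2 ^ w"
| "apply_op w Sub a b = (a + 2 ^ w - b) mod 2 ^ w"
| "apply_op w Mul a b = (a * b) mod 2 ^ w"
| "apply_op w Div a b = (a div b) mod 2 ^ w"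
| "apply_op w Mod a b = (a mod b) mod 2 ^ w"
| "apply_op w And a b = (Bit_Operations.and a b) mod 2 ^ w"
| "apply_op w Or a b = (Bit_Operations.or a b) mod 2 ^ w"
| "apply_op w Xor a b = (Bit_Operations.xor a b) mod 2 ^ w"
| "apply_op w Shl a b = (push_bit b a) mod 2 ^ w"
| "apply_op w Shr a b = (drop_bit b a) mod 2 ^ w"

fun holds :: "nat \<Rightarrow> (nat \<Rightarrow> nat) \<Rightarrow> test \<Rightarrow> bool" where
  "holds w r (Equal x y) \<longleftrightarrow> val w r x = val w r y"
| "holds w r (Less x y) \<longleftrightarrow> val w r x < val w r y"

text \<open>\<open>exec w c s t s'\<close>: started in \<open>s\<close>, the command \<open>c\<close> halts in \<open>s'\<close> after \<open>t\<close> steps.\<close>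

inductive exec :: "nat \<Rightarrow> com \<Rightarrow> state \<Rightarrow> nat \<Rightarrow> state \<Rightarrow> bool" for w :: nat where
  exec_Skip: "exec w Skip s 1 s"
| exec_Op: "exec w (Op d f x y) (r, m) 1 (r(d := apply_op w f (val w r x) (val w r y)), m)"
| exec_Load: "exec w (Load d a) (r, m) 1 (r(d := m (val w r a)), m)"
| exec_Store: "exec w (Store a x) (r, m) 1 (r, m(val w r a := val w r x))"
| exec_Seq: "exec w c1 s t1 s1 \<Longrightarrow> exec w c2 s1 t2 s2 \<Longrightarrow> exec w (Seq c1 c2) s (t1 + t2) s2"
| exec_If_True: "holds w (fst s) b \<Longrightarrow> exec w c1 s t s1 \<Longrightarrow> exec w (If b c1 c2) s (1 + t) s1"
| exec_If_False: "\<not> holds w (fst s) b \<Longrightarrow> exec w c2 s t s1 \<Longrightarrow> exec w (If b c1 c2) s (1 + t) s1"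
| exec_While_False: "\<not> holds w (fst s) b \<Longrightarrow> exec w (While b c) s 1 s"
| exec_While_True: "holds w (fst s) b \<Longrightarrow> exec w c s t1 s1 \<Longrightarrow> exec w (While b c) s1 t2 s2 \<Longrightarrow>
    exec w (While b c) s (1 + t1 + t2) s2"

section \<open>Static data structures\<close>

text \<open>A data structure is a list of words, stored from address \<open>0\<close> on; it takes
  \<open>length D * w\<close> bits.\<close>

definition words :: "nat \<Rightarrow> nat list \<Rightarrow> bool" where
  "words w D \<longleftrightarrow> (\<forall>x\<in>set D. x < 2 ^ w) \<and> length D \<le> 2 ^ w"

definition stored :: "nat list \<Rightarrow> state \<Rightarrow> bool" where
  "stored D s \<longleftrightarrow> (\<forall>a<length D. snd s a = D ! a)"

text \<open>
  The argument is passed and the result is returned in register \<open>0\<close>.  The remaining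
  registers and the memory outside the data structure initially have arbitrary contents, and
  the data structure must be intact after the query, so queries can be issued in any sequence.
\<close>

definition answers :: "nat \<Rightarrow> com \<Rightarrow> nat list \<Rightarrow> nat \<Rightarrow> nat \<Rightarrow> nat \<Rightarrow> bool" where
  "answers w c D i v T \<longleftrightarrow>
     (\<forall>s. word_state w s \<and> stored D s \<and> fst s 0 = i \<longrightarrow>
        (\<exists>t s'. t \<le> T \<and> exec w c s t s' \<and> fst s' 0 = v \<and> stored D s'))"

text \<open>\<open>c\<close> computes \<open>f\<close> on \<open>{1..n}\<close> in worst-case time \<open>W\<close>, and in time \<open>A\<close> on average over
  a uniformly random argument.\<close>

definition supports :: "nat \<Rightarrow> com \<Rightarrow> nat list \<Rightarrow> nat \<Rightarrow> (nat \<Rightarrow> nat) \<Rightarrow> real \<Rightarrow> real \<Rightarrow> bool" where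
  "supports w c D n f W A \<longleftrightarrow>
     (\<exists>T. (\<forall>i\<in>{1..n}. answers w c D i (f i) (T i) \<and> real (T i) \<le> W) \<and>
          measure_pmf.expectation (pmf_of_set {1..n}) (\<lambda>i. real (T i)) \<le> A)"

end

theory Submission
  imports Defs "HOL-Real_Asymp.Real_Asymp"
begin

text \<open>
  A position and its value lie in the same upsequence and have the same rank within it.  So
  \<open>\<pi>\<close> is determined by the sequence of the upsequences of the positions and that of the values,
  and \<open>\<pi>(i)\<close> results from a rank query on the first and a select query on the second.
  Both sequences are stored as wavelet trees over one binary code of expected length at most
  \<open>1 + H(S)\<close> and depth \<open>O(1 + lg \<sigma>)\<close>: one walks down the first tree with binary
  rank queries, and back up from the same leaf of the second one with binary select queries.
  Each of these takes constant time with the help of a directory that is smaller by a factor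
  \<open>o(1)\<close> than the bit vector.
\<close>

section \<open>Expressions on the word RAM\<close>

text \<open>The commands may not depend on \<open>n\<close>, whereas block sizes and addresses do.
  So all parameters are kept in a header of 28 words, and a tag in word 0 tells the format of the
  data. The two sequences are rearrangements of each other, so at every node of the code both trees
  hold equally many bits. One set of node records, of \<open>O(\<sigma>)\<close> words, therefore
  serves both trees, and their bit strings form one vector of \<open>2 * N\<close> bits with one
  directory. The total codeword length \<open>N\<close> is bounded twice: by
  \<open>n * (1 + H)\<close>, which gives the leading term, and through the depth by
  \<open>O(n lg \<sigma>)\<close> for \<sigma> at least 2, which turns a directory of
  \<open>o(N)\<close> bits into \<open>o(n lg \<sigma>)\<close>. The tension lies in the code:
  Shannon codewords can be far longer than lg \<sigma>, and cutting them off may violate Kraft's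
  inequality. The slack of 1 in the expected length pays for the repair.\<close>

datatype exp = V nat | N nat | Bin binop exp exp | Mem exp | IfLess exp exp exp exp

fun eval :: "nat \<Rightarrow> (nat \<Rightarrow> nat) \<Rightarrow> (nat \<Rightarrow> nat) \<Rightarrow> exp \<Rightarrow> nat" where
  "eval w r m (V k) = r k"
| "eval w r m (N c) = c mod 2 ^ w"
| "eval w r m (Bin f a b) = apply_op w f (eval w r m a) (eval w r m b)"
| "eval w r m (Mem a) = m (eval w r m a)"
| "eval w r m (IfLess a b x y) =
    (if eval w r m a < eval w r m b then eval w r m x else eval w r m y)"

fun compile :: "nat \<Rightarrow> exp \<Rightarrow> com" where
  "compile d (V k) = Op d Add (Reg k) (Imm 0)"
| "compile d (N c) = Op d Add (Imm c) (Imm 0)"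
| "compile d (Bin f a b) = Seq (compile d a) (Seq (compile (Suc d) b) (Op d f (Reg d) (Reg (Suc d))))"
| "compile d (Mem a) = Seq (compile d a) (Load d (Reg d))"
| "compile d (IfLess a b x y) = Seq (compile d a) (Seq (compile (Suc d) b)
    (If (Less (Reg d) (Reg (Suc d))) (compile d x) (compile d y)))"

text \<open>A function of the syntax alone: a fixed expression thus takes time bounded independently
  of \<open>n\<close> and \<open>w\<close>, which is what constant time means below. Both branches
  of a conditional are counted, a safe overestimate.\<close>

fun cost :: "exp \<Rightarrow> nat" where
  "cost (V k) = 1"
| "cost (N c) = 1"
| "cost (Bin f a b) = cost a + cost b + 1"
| "cost (Mem a) = cost a + 1"
| "cost (IfLess a b x y) = cost a + cost b + 1 + cost x + cost y"

fun regs :: "exp \<Rightarrow> nat set" where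
  "regs (V k) = {k}"
| "regs (N c) = {}"
| "regs (Bin f a b) = regs a \<union> regs b"
| "regs (Mem a) = regs a"
| "regs (IfLess a b x y) = regs a \<union> regs b \<union> regs x \<union> regs y"

lemma eval_cong: "(\<And>k. k \<in> regs e \<Longrightarrow> r k = r' k) \<Longrightarrow> eval w r m e = eval w r' m e"
  by (induction e) auto

lemma apply_op_less: "apply_op w f a b < 2 ^ w"
  by (cases f) auto

lemma word_state_upd: "word_state w (r, m) \<Longrightarrow> v < 2 ^ w \<Longrightarrow> word_state w (r(d := v), m)"
  by (auto simp: word_state_def)

text \<open>Registers from \<open>d\<close> on act as an evaluation stack: the left operand stays in
  \<open>d\<close> while the right one is computed in \<open>Suc d\<close>. Memory is only read, so
  the data structure survives every query. The word-size invariant is carried along because a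
  register is copied by adding 0 modulo \<open>2 ^ w\<close>.\<close>

lemma exec_compile:
  assumes "word_state w (r, m)" "\<And>k. k \<in> regs e \<Longrightarrow> k < d"
  shows "\<exists>t r'. exec w (compile d e) (r, m) t (r', m) \<and> r' d = eval w r m e \<and>
    (\<forall>k<d. r' k = r k) \<and> word_state w (r', m) \<and> t \<le> cost e"
  using assms
proof (induction e arbitrary: d r)
  case (V k)
  have "exec w (compile d (V k)) (r, m) 1 (r(d := apply_op w Add (val w r (Reg k)) (val w r (Imm 0))), m)"
    unfolding compile.simps by (rule exec_Op)
  moreover have "r k < 2 ^ w" using V by (auto simp: word_state_def)
  ultimately have "exec w (compile d (V k)) (r, m) 1 (r(d := r k), m)"
    and "word_state w (r(d := r k), m)"
    using word_state_upd[OF V(1)] by simp_all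
  then show ?case by (intro exI[of _ 1] exI[of _ "r(d := r k)"]) (simp add: fun_upd_def)
next
  case (N c)
  have "exec w (compile d (N c)) (r, m) 1 (r(d := apply_op w Add (val w r (Imm c)) (val w r (Imm 0))), m)"
    unfolding compile.simps by (rule exec_Op)
  then have "exec w (compile d (N c)) (r, m) 1 (r(d := c mod 2 ^ w), m)"
    and "word_state w (r(d := c mod 2 ^ w), m)"
    using word_state_upd[OF N(1)] by simp_all
  then show ?case by (intro exI[of _ 1] exI[of _ "r(d := c mod 2 ^ w)"]) (simp add: fun_upd_def)
next
  case (Bin f a b)
  obtain t1 r1 where 1: "exec w (compile d a) (r, m) t1 (r1, m)" "r1 d = eval w r m a"
    "\<forall>k<d. r1 k = r k" "word_state w (r1, m)" "t1 \<le> cost a"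
    using Bin.IH(1)[of r d] Bin.prems by auto
  obtain t2 r2 where 2: "exec w (compile (Suc d) b) (r1, m) t2 (r2, m)" "r2 (Suc d) = eval w r1 m b"
    "\<forall>k<Suc d. r2 k = r1 k" "word_state w (r2, m)" "t2 \<le> cost b"
    using Bin.IH(2)[of r1 "Suc d"] Bin.prems 1(4) by (auto simp: less_Suc_eq)
  have eb: "eval w r1 m b = eval w r m b"
    using 1(3) Bin.prems(2) by (intro eval_cong) auto
  define r3 where "r3 = r2(d := apply_op w f (val w r2 (Reg d)) (val w r2 (Reg (Suc d))))"
  have 3: "exec w (Op d f (Reg d) (Reg (Suc d))) (r2, m) 1 (r3, m)"
    unfolding r3_def by (rule exec_Op)
  have "exec w (compile d (Bin f a b)) (r, m) (t1 + (t2 + 1)) (r3, m)"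
    unfolding compile.simps by (rule exec_Seq[OF 1(1) exec_Seq[OF 2(1) 3]])
  moreover have "r3 d = eval w r m (Bin f a b)" using 1 2 eb by (simp add: r3_def)
  moreover have "\<forall>k<d. r3 k = r k" using 1 2 by (simp add: r3_def)
  moreover have "word_state w (r3, m)"
    unfolding r3_def by (rule word_state_upd[OF 2(4) apply_op_less])
  ultimately show ?case using 1(5) 2(5)
    by (intro exI[of _ "t1 + (t2 + 1)"] exI[of _ r3]) auto
next
  case (Mem a)
  obtain t1 r1 where 1: "exec w (compile d a) (r, m) t1 (r1, m)" "r1 d = eval w r m a"
    "\<forall>k<d. r1 k = r k" "word_state w (r1, m)" "t1 \<le> cost a"
    using Mem.IH(1)[of r d] Mem.prems by auto
  define r3 where "r3 = r1(d := m (val w r1 (Reg d)))"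
  have 3: "exec w (Load d (Reg d)) (r1, m) 1 (r3, m)"
    unfolding r3_def by (rule exec_Load)
  have "exec w (compile d (Mem a)) (r, m) (t1 + 1) (r3, m)"
    unfolding compile.simps by (rule exec_Seq[OF 1(1) 3])
  moreover have "word_state w (r3, m)"
    unfolding r3_def by (rule word_state_upd[OF 1(4)]) (use 1(4) in \<open>auto simp: word_state_def\<close>)
  moreover have "r3 d = eval w r m (Mem a)" "\<forall>k<d. r3 k = r k" using 1 by (simp_all add: r3_def)
  ultimately show ?case using 1(5) by (intro exI[of _ "t1 + 1"] exI[of _ r3]) auto
next
  case (IfLess a b x y)
  obtain t1 r1 where 1: "exec w (compile d a) (r, m) t1 (r1, m)" "r1 d = eval w r m a"
    "\<forall>k<d. r1 k = r k" "word_state w (r1, m)" "t1 \<le> cost a"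
    using IfLess.IH(1)[of r d] IfLess.prems by auto
  obtain t2 r2 where 2: "exec w (compile (Suc d) b) (r1, m) t2 (r2, m)" "r2 (Suc d) = eval w r1 m b"
    "\<forall>k<Suc d. r2 k = r1 k" "word_state w (r2, m)" "t2 \<le> cost b"
    using IfLess.IH(2)[of r1 "Suc d"] IfLess.prems 1(4) by (auto simp: less_Suc_eq)
  have eb: "eval w r1 m b = eval w r m b" 
    using 1(3) IfLess.prems(2) by (intro eval_cong) auto
  have ex: "eval w r2 m x = eval w r m x" 
    using 1(3) 2(3) IfLess.prems(2) by (intro eval_cong) (simp add: less_SucI)
  have ey: "eval w r2 m y = eval w r m y" 
    using 1(3) 2(3) IfLess.prems(2) by (intro eval_cong) (simp add: less_SucI)
  obtain t3 r3 where 3: "exec w (compile d x) (r2, m) t3 (r3, m)" "r3 d = eval w r2 m x"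
    "\<forall>k<d. r3 k = r2 k" "word_state w (r3, m)" "t3 \<le> cost x"
    using IfLess.IH(3)[of r2 d] IfLess.prems 2 by auto
  obtain t4 r4 where 4: "exec w (compile d y) (r2, m) t4 (r4, m)" "r4 d = eval w r2 m y"
    "\<forall>k<d. r4 k = r2 k" "word_state w (r4, m)" "t4 \<le> cost y"
    using IfLess.IH(4)[of r2 d] IfLess.prems 2 by auto
  let ?b = "Less (Reg d) (Reg (Suc d))"
  have h: "holds w (fst (r2, m)) ?b \<longleftrightarrow> eval w r m a < eval w r m b"
    using 1 2 eb by simp
  show ?case
  proof (cases "eval w r m a < eval w r m b")
    case True
    have "exec w (compile d (IfLess a b x y)) (r, m) (t1 + (t2 + (1 + t3))) (r3, m)"
      unfolding compile.simps
      by (rule exec_Seq[OF 1(1) exec_Seq[OF 2(1) exec_If_True[OF _ 3(1)]]]) (use h True in auto)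
    then show ?thesis using 1 2 3 ex True
      by (intro exI[of _ "t1 + (t2 + (1 + t3))"] exI[of _ r3]) auto
  next
    case False
    have "exec w (compile d (IfLess a b x y)) (r, m) (t1 + (t2 + (1 + t4))) (r4, m)"
      unfolding compile.simps
      by (rule exec_Seq[OF 1(1) exec_Seq[OF 2(1) exec_If_False[OF _ 4(1)]]]) (use h False in auto)
    then show ?thesis using 1 2 4 ey False
      by (intro exI[of _ "t1 + (t2 + (1 + t4))"] exI[of _ r4]) auto
  qed
qed

text \<open>Program variables are the registers below \<open>8\<close>; the others hold intermediate values.\<close>

definition assign :: "nat \<Rightarrow> exp \<Rightarrow> com" where
  "assign d e = Seq (compile 8 e) (Op d Add (Reg 8) (Imm 0))"

text \<open>The value is computed in register 8 and copied last, so \<open>e\<close> may mention the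
  target \<open>d\<close> itself.\<close>

lemma exec_assign:
  assumes "word_state w (r, m)" "regs e \<subseteq> {..<8}"
  obtains t r' where "exec w (assign d e) (r, m) t (r', m)" "r' d = eval w r m e"
    "\<And>k. k < 8 \<Longrightarrow> k \<noteq> d \<Longrightarrow> r' k = r k" "word_state w (r', m)" "t \<le> cost e + 1"
proof -
  obtain t r1 where 1: "exec w (compile 8 e) (r, m) t (r1, m)" "r1 8 = eval w r m e"
    "\<forall>k<8. r1 k = r k" "word_state w (r1, m)" "t \<le> cost e"
    using exec_compile[OF assms(1), of e 8] assms(2) by auto
  have lt: "r1 8 < 2 ^ w" using 1(4) by (auto simp: word_state_def)
  have "exec w (Op d Add (Reg 8) (Imm 0)) (r1, m) 1
      (r1(d := apply_op w Add (val w r1 (Reg 8)) (val w r1 (Imm 0))), m)"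
    by (rule exec_Op)
  then have "exec w (Op d Add (Reg 8) (Imm 0)) (r1, m) 1 (r1(d := r1 8), m)"
    using lt by simp
  from exec_Seq[OF 1(1) this] show ?thesis
    using 1 lt word_state_upd[OF 1(4) lt, of d]
    by (intro that[of "t + 1" "r1(d := r1 8)"]) (auto simp: assign_def)
qed

abbreviation "add_e \<equiv> Bin Add"
abbreviation "sub_e \<equiv> Bin Sub"
abbreviation "mul_e \<equiv> Bin Mul"
abbreviation "div_e \<equiv> Bin Div"
abbreviation "mod_e \<equiv> Bin Mod"
definition "pow2_e = Bin Shl (N 1)"

text \<open>With this and the following rules an expression can be read over the naturals, as long
  as no intermediate value reaches \<open>2 ^ w\<close>.\<close>

lemma eval_N: "c < 2 ^ w \<Longrightarrow> eval w r m (N c) = c"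
  by simp

lemma eval_add:
  "eval w r m a = x \<Longrightarrow> eval w r m b = y \<Longrightarrow> x + y < 2 ^ w \<Longrightarrow> eval w r m (add_e a b) = x + y"
  by simp

lemma eval_sub:
  assumes "eval w r m a = x" "eval w r m b = y" "y \<le> x" "x < 2 ^ w"
  shows "eval w r m (sub_e a b) = x - y"
proof -
  have "x + 2 ^ w - y = (x - y) + 2 ^ w" using assms by auto
  then have "(x + 2 ^ w - y) mod 2 ^ w = x - y" using assms by (simp only: mod_add_self2) simp
  then show ?thesis using assms(1,2) by simp
qed

lemma eval_mul:
  "eval w r m a = x \<Longrightarrow> eval w r m b = y \<Longrightarrow> x * y < 2 ^ w \<Longrightarrow> eval w r m (mul_e a b) = x * y"
  by simp

lemma eval_div:
  "eval w r m a = x \<Longrightarrow> eval w r m b = y \<Longrightarrow> x < 2 ^ w \<Longrightarrow> eval w r m (div_e a b) = x div y"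
  by (simp add: le_less_trans[OF div_le_dividend])

lemma eval_mod:
  "eval w r m a = x \<Longrightarrow> eval w r m b = y \<Longrightarrow> x < 2 ^ w \<Longrightarrow> eval w r m (mod_e a b) = x mod y"
  by (simp add: le_less_trans[OF mod_less_eq_dividend])

lemma eval_pow2:
  assumes "eval w r m a = x" "x < w"
  shows "eval w r m (pow2_e a) = 2 ^ x"
proof -
  have "(1::nat) < 2 ^ w" using assms(2) by (intro one_less_power) auto
  then show ?thesis using assms by (simp add: pow2_e_def push_bit_eq_mult)
qed

section \<open>Packed fields, rank and select\<close>

lemma sum_digits_less:
  fixes g :: "nat \<Rightarrow> nat"
  assumes "\<And>j. j < p \<Longrightarrow> g j < B"
  shows "(\<Sum>j<p. g j * B ^ j) < B ^ p"
  using assms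
proof (induction p)
  case (Suc p)
  then have "(\<Sum>j<p. g j * B ^ j) < B ^ p" "g p + 1 \<le> B" by (auto simp: Suc_le_eq)
  then have "(\<Sum>j<Suc p. g j * B ^ j) < (g p + 1) * B ^ p" by simp
  also have "\<dots> \<le> B * B ^ p" by (rule mult_right_mono) (use \<open>g p + 1 \<le> B\<close> in auto)
  also have "\<dots> = B ^ Suc p" by simp
  finally show ?case .
qed simp

lemma sum_digits_nth:
  fixes g :: "nat \<Rightarrow> nat"
  assumes "\<And>j. j < p \<Longrightarrow> g j < B" "i < p"
  shows "(\<Sum>j<p. g j * B ^ j) div B ^ i mod B = g i"
  using assms
proof (induction p arbitrary: g i)
  case (Suc p)
  have "(\<Sum>j<Suc p. g j * B ^ j) = g 0 + B * (\<Sum>j<p. g (Suc j) * B ^ j)"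
    unfolding sum.lessThan_Suc_shift by (simp add: sum_distrib_left ac_simps)
  moreover have "g 0 < B" using Suc.prems by simp
  moreover from this have "(g 0 + B * t) div B = t" for t by simp
  ultimately show ?case
    using Suc.IH[of "\<lambda>j. g (Suc j)" "i - 1"] Suc.prems
    by (cases i) (simp_all add: div_mult2_eq)
qed simp

text \<open>No field straddles a word boundary, so one access reads it, and a full word wastes fewer
  than \<open>d\<close> bits. Reduction modulo \<open>2 ^ d\<close> protects the neighbours of an
  entry that is too large; such entries occur only where no query relies on them.\<close>

definition packed :: "nat \<Rightarrow> nat \<Rightarrow> nat \<Rightarrow> (nat \<Rightarrow> nat) \<Rightarrow> nat list" where
  "packed w d len g =
     map (\<lambda>i. \<Sum>j<w div d. (g (i * (w div d) + j) mod 2 ^ d) * (2 ^ d) ^ j)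
       [0..<len div (w div d) + 1]"

lemma length_packed: "length (packed w d len g) = len div (w div d) + 1"
  by (simp add: packed_def)

lemma packed_nth:
  assumes "0 < d" "d \<le> w" "i < len"
  shows "packed w d len g ! (i div (w div d)) div 2 ^ (i mod (w div d) * d) mod 2 ^ d = g i mod 2 ^ d"
proof -
  let ?p = "w div d"
  have p: "0 < ?p" using assms by (simp add: div_greater_zero_iff)
  have "i div ?p < len div ?p + 1" using assms(3) by (simp add: div_le_mono le_imp_less_Suc)
  then have "packed w d len g ! (i div ?p) =
      (\<Sum>j<?p. (g (i div ?p * ?p + j) mod 2 ^ d) * (2 ^ d) ^ j)"
    by (simp add: packed_def del: upt_Suc)
  moreover have "\<dots> div (2 ^ d) ^ (i mod ?p) mod 2 ^ d = g (i div ?p * ?p + i mod ?p) mod 2 ^ d"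
    using p by (intro sum_digits_nth) auto
  ultimately show ?thesis by (simp add: power_mult[symmetric] mult.commute)
qed

section \<open>Windows, rank and select in an infinite bit sequence\<close>

definition window :: "(nat \<Rightarrow> bool) \<Rightarrow> nat \<Rightarrow> nat \<Rightarrow> nat" where
  "window X s len = horner_sum of_bool 2 (map X [s..<s + len])"

lemma bit_window: "bit (window X s len) i \<longleftrightarrow> i < len \<and> X (s + i)"
  by (auto simp: window_def bit_horner_sum_bit_iff)

lemma window_less: "window X s len < 2 ^ len"
proof -
  have "take_bit len (window X s len) = window X s len"
    by (rule bit_eqI) (auto simp: bit_take_bit_iff bit_window)
  then show ?thesis by (metis take_bit_nat_less_exp)
qed

lemma window_append: "window X s (a + c) = window X s a + 2 ^ a * window X (s + a) c"
  by (simp add: window_def add.assoc[symmetric] upt_add_eq_append[of s "s + a" c] horner_sum_append)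

lemma window_shift:
  assumes "k + c \<le> len"
  shows "window X s len div 2 ^ k mod 2 ^ c = window X (s + k) c"
proof -
  have "take_bit c (drop_bit k (window X s len)) = window X (s + k) c"
    using assms
    by (intro bit_eqI) (auto simp: bit_take_bit_iff bit_drop_bit_eq bit_window add.assoc)
  then show ?thesis by (simp add: take_bit_eq_mod drop_bit_eq_div)
qed

definition rk :: "(nat \<Rightarrow> bool) \<Rightarrow> nat \<Rightarrow> nat" where
  "rk Y p = card {i. i < p \<and> Y i}"

lemma rk_mono: "p \<le> p' \<Longrightarrow> rk Y p \<le> rk Y p'"
  unfolding rk_def by (rule card_mono) auto

lemma rk_le: "rk Y p \<le> p"
proof -
  have "rk Y p \<le> card {..<p}" unfolding rk_def by (rule card_mono) auto
  then show ?thesis by simp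
qed

lemma rk_add: "rk Y (p + d) = rk Y p + rk (\<lambda>i. Y (p + i)) d"
proof -
  have "{i. i < p + d \<and> Y i} = {i. i < p \<and> Y i} \<union> (+) p ` {i. i < d \<and> Y (p + i)}"
    (is "_ = ?A \<union> ?B")
  proof (intro set_eqI iffI)
    fix i assume "i \<in> {i. i < p + d \<and> Y i}"
    then show "i \<in> ?A \<union> ?B"
      by (cases "i < p") (auto intro!: image_eqI[of _ _ "i - p"])
  qed auto
  moreover have "card (?A \<union> ?B) = card ?A + card ?B" by (rule card_Un_disjoint) auto
  moreover have "card ?B = card {i. i < d \<and> Y (p + i)}" by (rule card_image) auto
  ultimately show ?thesis by (simp add: rk_def)
qed

lemma rk_cong: "(\<And>i. i < p \<Longrightarrow> Y i = Z i) \<Longrightarrow> rk Y p = rk Z p"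
  unfolding rk_def by (rule arg_cong[of _ _ card]) auto

text \<open>Past the end \<open>M\<close> every position counts as an occurrence, so that selection is total.\<close>

definition sel :: "nat \<Rightarrow> (nat \<Rightarrow> bool) \<Rightarrow> nat \<Rightarrow> nat" where
  "sel M Y = enumerate {i. M \<le> i \<or> Y i}"

lemma infinite_sel_set: "infinite {i::nat. M \<le> i \<or> Y i}"
proof -
  have "{M..} \<subseteq> {i::nat. M \<le> i \<or> Y i}" by auto
  then show ?thesis using infinite_Ici[of M] finite_subset by blast
qed

lemma sel_less_iff: "sel M Y j < sel M Y j' \<longleftrightarrow> j < j'"
  using strict_mono_enumerate[OF infinite_sel_set[of M Y]]
  by (simp add: sel_def strict_mono_less)

lemma sel_le_iff: "sel M Y j \<le> sel M Y j' \<longleftrightarrow> j \<le> j'"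
  using sel_less_iff[of M Y j' j] by linarith

lemma le_sel: "j \<le> sel M Y j"
  unfolding sel_def by (rule le_enumerate[OF infinite_sel_set])

lemma sel_mem: "M \<le> sel M Y j \<or> Y (sel M Y j)"
  using enumerate_in_set[OF infinite_sel_set[of M Y], of j] by (simp add: sel_def)

lemma card_less_sel: "card {i. (M \<le> i \<or> Y i) \<and> i < sel M Y j} = j"
proof -
  let ?S = "{i. M \<le> i \<or> Y i}"
  have "{i. (M \<le> i \<or> Y i) \<and> i < sel M Y j} = sel M Y ` {..<j}"
  proof (intro set_eqI iffI)
    fix i assume i: "i \<in> {i. (M \<le> i \<or> Y i) \<and> i < sel M Y j}"
    then obtain k where "i = sel M Y k"
      using enumerate_Ex[OF , of ?S i] infinite_sel_set by (auto simp: sel_def)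
    then show "i \<in> sel M Y ` {..<j}" using i by (auto simp: sel_less_iff)
  next
    fix i assume "i \<in> sel M Y ` {..<j}"
    then show "i \<in> {i. (M \<le> i \<or> Y i) \<and> i < sel M Y j}"
      using sel_mem[of M Y] by (auto simp: sel_less_iff)
  qed
  moreover have "inj_on (sel M Y) {..<j}"
    by (rule linorder_inj_onI) (auto simp: less_imp_neq sel_less_iff)
  ultimately show ?thesis by (simp add: card_image)
qed

lemma rk_sel:
  assumes "sel M Y j \<le> M"
  shows "rk Y (sel M Y j) = j"
proof -
  have "{i. (M \<le> i \<or> Y i) \<and> i < sel M Y j} = {i. i < sel M Y j \<and> Y i}" using assms by auto
  then show ?thesis using card_less_sel[of M Y j] by (simp add: rk_def)
qed

lemma sel_rk:
  assumes "p < M" "Y p"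
  shows "sel M Y (rk Y p) = p"
proof -
  obtain j where "sel M Y j = p"
    using enumerate_Ex[of "{i. M \<le> i \<or> Y i}" p] infinite_sel_set assms by (auto simp: sel_def)
  then show ?thesis using rk_sel[of M Y j] assms by simp
qed

text \<open>All of \<open>M, ..., M + j - 1\<close> count as occurrences, so \<open>M + j\<close>
  has index at least \<open>j\<close>. The bound makes the start of a supergroup past the last
  occurrence fit into a word.\<close>

lemma sel_le: "sel M Y j \<le> M + j"
proof -
  obtain k where k: "sel M Y k = M + j"
    using enumerate_Ex[of "{i. M \<le> i \<or> Y i}" "M + j"] infinite_sel_set by (auto simp: sel_def)
  have "card {M..<M + j} \<le> card {i. (M \<le> i \<or> Y i) \<and> i < sel M Y k}"
    by (rule card_mono) (auto simp: k)
  then have "j \<le> k" by (simp add: card_less_sel)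
  then show ?thesis using k sel_le_iff[of M Y j k] by simp
qed

text \<open>The default \<open>b\<close> stands for an occurrence that is not among the first
  \<open>b\<close> bits, so one comparison with \<open>b\<close> tells whether the lookup table
  knows the answer.\<close>

definition nth_offset :: "nat \<Rightarrow> (nat \<Rightarrow> bool) \<Rightarrow> nat \<Rightarrow> nat" where
  "nth_offset b Z r = (LEAST d. d = b \<or> d < b \<and> Z d \<and> rk Z d = r)"

lemma nth_offset_found:
  assumes "d < b" "Z d"
  shows "nth_offset b Z (rk Z d) = d"
  unfolding nth_offset_def
proof (rule Least_equality)
  fix e assume e: "e = b \<or> e < b \<and> Z e \<and> rk Z e = rk Z d"
  show "d \<le> e"
  proof (rule ccontr)
    assume "\<not> d \<le> e"
    then have "e < d" by simp
    then have "Z e" "rk Z e = rk Z d" using e assms by auto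
    moreover have "rk Z (e + 1) \<le> rk Z d" by (rule rk_mono) (use \<open>e < d\<close> in simp)
    moreover have "rk (\<lambda>i. Z (e + i)) 1 = card {0::nat}"
      unfolding rk_def by (rule arg_cong[of _ _ card]) (use \<open>Z e\<close> in auto)
    ultimately show False using rk_add[of Z e 1] by simp
  qed
qed (use assms in auto)

lemma nth_offset_cases:
  "nth_offset b Z r = b \<or> nth_offset b Z r < b \<and> Z (nth_offset b Z r) \<and> rk Z (nth_offset b Z r) = r"
  unfolding nth_offset_def by (rule LeastI[of _ b]) simp

lemma nth_offset_cong: "(\<And>i. i < b \<Longrightarrow> Y i = Z i) \<Longrightarrow> nth_offset b Y r = nth_offset b Z r"
proof -
  assume "\<And>i. i < b \<Longrightarrow> Y i = Z i"
  then have "(d = b \<or> d < b \<and> Y d \<and> rk Y d = r) \<longleftrightarrow> (d = b \<or> d < b \<and> Z d \<and> rk Z d = r)" for d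
    using rk_cong[of d Y Z] by auto
  then show ?thesis by (simp add: nth_offset_def)
qed

text \<open>The window begins at occurrence number \<open>j\<close> itself, so exactly
  \<open>j\<close> occurrences precede it, and occurrence \<open>j + r\<close> has local index
  \<open>r\<close>.\<close>

lemma nth_offset_sel:
  assumes "sel M Y (j + r) < M"
  defines "p \<equiv> sel M Y j"
  shows "nth_offset b (\<lambda>i. Y (p + i)) r = (if sel M Y (j + r) < p + b then sel M Y (j + r) - p else b)"
proof -
  let ?Z = "\<lambda>i. Y (p + i)" and ?s = "sel M Y (j + r)"
  have ps: "p \<le> ?s" by (simp add: p_def sel_le_iff)
  have rp: "rk Y p = j" unfolding p_def by (rule rk_sel) (use ps assms in auto)
  have rs: "rk Y ?s = j + r" by (rule rk_sel) (use assms in auto)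
  show ?thesis
  proof (cases "?s < p + b")
    case True
    have "rk Y (p + (?s - p)) = rk Y p + rk ?Z (?s - p)" by (rule rk_add)
    then have "rk ?Z (?s - p) = r" using ps rp rs by simp
    moreover have "Y ?s" using sel_mem[of M Y "j + r"] assms by auto
    ultimately show ?thesis
      using nth_offset_found[of "?s - p" b ?Z] True ps by simp
  next
    case False
    have "nth_offset b ?Z r = b"
    proof (rule ccontr)
      assume "nth_offset b ?Z r \<noteq> b"
      then obtain d where d: "d < b" "Y (p + d)" "rk ?Z d = r"
        using nth_offset_cases[of b ?Z r] by blast
      then have "rk Y (p + d) = j + r" by (simp add: rk_add rp)
      moreover have "sel M Y (rk Y (p + d)) = p + d"
        by (rule sel_rk) (use d False assms in auto)
      ultimately show False using False d by simp
    qed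
    then show ?thesis using False by simp
  qed
qed

section \<open>Constant-time rank and select\<close>

text \<open>The expression reads entry \<open>idx\<close> of an array of \<open>d\<close>-bit fields, \<open>per\<close> to a word.\<close>

definition field_e :: "exp \<Rightarrow> exp \<Rightarrow> exp \<Rightarrow> exp \<Rightarrow> exp" where
  "field_e base d per idx =
     mod_e (div_e (Mem (add_e base (div_e idx per))) (pow2_e (mul_e (mod_e idx per) d))) (pow2_e d)"

lemma eval_field:
  assumes "eval w r m be = base" "eval w r m de = d" "eval w r m pe = w div d" "eval w r m ie = i"
    and d: "0 < d" "d < w"
    and arr: "\<And>k. k < length (packed w d len g) \<Longrightarrow> m (base + k) = packed w d len g ! k"
    and i: "i < len" "i < 2 ^ w" "base + length (packed w d len g) \<le> 2 ^ w"
    and ws: "word_state w (r, m)"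
  shows "eval w r m (field_e be de pe ie) = g i mod 2 ^ d"
proof -
  let ?p = "w div d"
  have p: "0 < ?p" using d by (simp add: div_greater_zero_iff)
  have k: "i div ?p < length (packed w d len g)"
    using i(1) by (simp add: length_packed div_le_mono le_imp_less_Suc)
  have addr: "eval w r m (add_e be (div_e ie pe)) = base + i div ?p"
    by (intro eval_add eval_div assms) (use k i in auto)
  then have rd: "eval w r m (Mem (add_e be (div_e ie pe))) = packed w d len g ! (i div ?p)"
    using arr[OF k] by simp
  have lt: "packed w d len g ! (i div ?p) < 2 ^ w"
    using arr[OF k] ws by (metis word_state_def snd_conv)
  have "(i mod ?p + 1) * d \<le> ?p * d" using p by (intro mult_right_mono) (auto simp: Suc_le_eq)
  also have "\<dots> \<le> w" by simp
  finally have sh: "i mod ?p * d < w" using d by simp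
  have ww: "w < 2 ^ w" by (rule less_exp)
  have e1: "eval w r m (mod_e ie pe) = i mod ?p" by (intro eval_mod assms i)
  have e2: "eval w r m (pow2_e (mul_e (mod_e ie pe) de)) = 2 ^ (i mod ?p * d)"
    by (intro eval_pow2 eval_mul e1 assms) (use sh ww less_trans[OF sh ww] in auto)
  have e3: "eval w r m (pow2_e de) = 2 ^ d" by (intro eval_pow2 assms)
  have e4: "eval w r m (div_e (Mem (add_e be (div_e ie pe))) (pow2_e (mul_e (mod_e ie pe) de))) =
    packed w d len g ! (i div ?p) div 2 ^ (i mod ?p * d)"
    by (rule eval_div[OF rd e2 lt])
  show ?thesis unfolding field_e_def
    by (subst eval_mod[OF e4 e3])
       (use packed_nth[of d w i len g] d i lt in \<open>auto intro: le_less_trans[OF div_le_dividend]\<close>)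
qed

text \<open>For rank, \<open>M\<close> bits are cut into blocks of \<open>b\<close> bits, with
  \<open>q\<close> blocks to a superblock. For select, the occurrences are cut into groups of
  \<open>K\<close>, with \<open>k\<close> groups to a supergroup. \<open>f\<close> is the width of
  the small directory fields.\<close>

locale bitvector_index =
  fixes w M b f K k q :: nat and X :: "nat \<Rightarrow> bool"
begin

definition occ :: "nat \<Rightarrow> nat \<Rightarrow> bool" where
  "occ \<beta> i \<longleftrightarrow> X i = (\<beta> = 1)"

abbreviation "s \<beta> \<equiv> sel M (occ \<beta>)"

definition block_array :: "nat \<Rightarrow> nat" where
  "block_array u = window X (u * b) b"

text \<open>In a supergroup that is not long, every distance from the start fits into
  \<open>f\<close> bits. Long ones are so rare that all their answers can be stored as full
  words.\<close>

definition "long \<beta> v \<longleftrightarrow> 2 ^ f \<le> s \<beta> (Suc v * (k * K)) - s \<beta> (v * (k * K))"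

definition rank_super :: "nat \<Rightarrow> nat \<Rightarrow> nat" where
  "rank_super \<beta> v = rk (occ \<beta>) (v * q * b)"

definition rank_block :: "nat \<Rightarrow> nat \<Rightarrow> nat" where
  "rank_block \<beta> u = rk (occ \<beta>) (u * b) - rk (occ \<beta>) (u div q * q * b)"

definition rank_table :: "nat \<Rightarrow> nat \<Rightarrow> nat" where
  "rank_table \<beta> i = rk (\<lambda>j. bit (i div b) j = (\<beta> = 1)) (i mod b)"

definition sel_super :: "nat \<Rightarrow> nat \<Rightarrow> nat" where
  "sel_super \<beta> v = s \<beta> (v * (k * K))"

definition sel_group :: "nat \<Rightarrow> nat \<Rightarrow> nat" where
  "sel_group \<beta> g = s \<beta> (g * K) - s \<beta> (g div k * (k * K))"

text \<open>
  Two long supergroups never start in the same block of \<open>2 ^ f\<close> bits, and two groups with an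
  occurrence at distance \<open>b\<close> from their start never start in the same block of \<open>b\<close> bits.  So the
  explicit answers can be stored by the block in which the (super)group starts.
\<close>

definition sel_long :: "nat \<Rightarrow> nat \<Rightarrow> nat" where
  "sel_long \<beta> i = s \<beta> ((SOME v. s \<beta> (v * (k * K)) div 2 ^ f = i div (k * K) \<and> long \<beta> v) * (k * K)
     + i mod (k * K))"

definition sel_sparse :: "nat \<Rightarrow> nat \<Rightarrow> nat" where
  "sel_sparse \<beta> i = (let g = SOME g. s \<beta> (g * K) div b = i div K
        \<and> s \<beta> (g * K) + b \<le> s \<beta> (g * K + i mod K)
     in s \<beta> (g * K + i mod K) - s \<beta> (g * K))"

definition sel_table :: "nat \<Rightarrow> nat \<Rightarrow> nat" where
  "sel_table \<beta> i = nth_offset b (\<lambda>j. bit (i div K) j = (\<beta> = 1)) (i mod K)"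

text \<open>Slots of \<open>sel_long\<close> that belong to no long supergroup hold an arbitrary
  choice, hence the reduction modulo \<open>2 ^ w\<close>. The additional entry of
  \<open>sel_super\<close> is there because a query compares the starts of two consecutive
  supergroups.\<close>

definition arrays :: "nat \<Rightarrow> nat list list" where
  "arrays \<beta> =
    [map (rank_super \<beta>) [0..<M div b div q + 1],
     packed w f (M div b + 1) (rank_block \<beta>),
     map (rank_table \<beta>) [0..<2 ^ b * b],
     map (sel_super \<beta>) [0..<M div (k * K) + 2],
     packed w f (M div K + 1) (sel_group \<beta>),
     map (\<lambda>i. sel_long \<beta> i mod 2 ^ w) [0..<(M div 2 ^ f + 1) * (k * K)],
     packed w f ((M div b + 1) * K) (sel_sparse \<beta>),
     map (sel_table \<beta>) [0..<2 ^ b * K]]"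

text \<open>A spare block follows the last one, since a window that starts in the last block spills
  over.\<close>

definition blocks :: "nat list" where
  "blocks = packed w b (M div b + 2) block_array"

lemma length_arrays: "length (arrays \<beta>) = 8"
  by (simp add: arrays_def)

lemma sel_long_correct:
  assumes "long \<beta> v" "j div (k * K) = v" "0 < k" "0 < K"
  shows "sel_long \<beta> (s \<beta> (v * (k * K)) div 2 ^ f * (k * K) + j mod (k * K)) = s \<beta> j"
proof -
  let ?K = "k * K"
  have K: "0 < ?K" using assms by simp
  have unique: "v2 = v1" if "s \<beta> (v1 * ?K) div 2 ^ f = s \<beta> (v2 * ?K) div 2 ^ f" "long \<beta> v1" "v1 \<le> v2" for v1 v2
  proof (rule ccontr)
    assume "v2 \<noteq> v1"
    then have "Suc v1 \<le> v2" using that by simp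
    then have "s \<beta> (Suc v1 * ?K) \<le> s \<beta> (v2 * ?K)" by (simp only: sel_le_iff mult_le_mono1)
    moreover have "s \<beta> (v1 * ?K) + 2 ^ f \<le> s \<beta> (Suc v1 * ?K)"
      using that(2) sel_le_iff[of M "occ \<beta>" "v1 * ?K" "Suc v1 * ?K"] unfolding long_def by simp
    ultimately have "(s \<beta> (v1 * ?K) + 2 ^ f) div 2 ^ f \<le> s \<beta> (v2 * ?K) div 2 ^ f"
      by (intro div_le_mono) simp
    then show False using that(1) by simp
  qed
  have "(SOME v'. s \<beta> (v' * ?K) div 2 ^ f = s \<beta> (v * ?K) div 2 ^ f \<and> long \<beta> v') = v"
  proof (rule some_equality)
    fix v' assume "s \<beta> (v' * ?K) div 2 ^ f = s \<beta> (v * ?K) div 2 ^ f \<and> long \<beta> v'"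
    then show "v' = v" using unique[of v v'] unique[of v' v] assms(1) by (cases "v \<le> v'") auto
  qed (use assms in auto)
  moreover have "(s \<beta> (v * ?K) div 2 ^ f * ?K + j mod ?K) div ?K = s \<beta> (v * ?K) div 2 ^ f"
    "(s \<beta> (v * ?K) div 2 ^ f * ?K + j mod ?K) mod ?K = j mod ?K"
    using K by simp_all
  moreover have "v * ?K + j mod ?K = j" using assms(2) by (metis div_mult_mod_eq)
  ultimately show ?thesis by (simp add: sel_long_def)
qed

lemma sel_sparse_correct:
  assumes "j div K = g" "s \<beta> (g * K) + b \<le> s \<beta> j" "0 < b" "0 < K"
  shows "sel_sparse \<beta> (s \<beta> (g * K) div b * K + j mod K) = s \<beta> j - s \<beta> (g * K)"
proof -
  let ?P = "\<lambda>g'. s \<beta> (g' * K) div b = s \<beta> (g * K) div b \<and> s \<beta> (g' * K) + b \<le> s \<beta> (g' * K + j mod K)"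
  have j: "g * K + j mod K = j" using assms(1) by (metis div_mult_mod_eq)
  have unique: "g2 = g1" if "?P g1" "?P g2" "g1 \<le> g2" for g1 g2
  proof (rule ccontr)
    assume "g2 \<noteq> g1"
    then have "Suc g1 \<le> g2" using that by simp
    then have "Suc g1 * K \<le> g2 * K" by (rule mult_le_mono1)
    moreover have "g1 * K + j mod K < Suc g1 * K" using assms(4) by simp
    ultimately have "s \<beta> (g1 * K + j mod K) \<le> s \<beta> (g2 * K)" by (simp add: sel_le_iff)
    then have "(s \<beta> (g1 * K) + b) div b \<le> s \<beta> (g2 * K) div b"
      using that(1) by (intro div_le_mono) simp
    then show False using that assms(3) by simp
  qed
  have "(SOME g'. ?P g') = g"
  proof (rule some_equality)
    fix g' assume "?P g'"
    then show "g' = g" using unique[of g g'] unique[of g' g] assms(2) j by (cases "g \<le> g'") auto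
  qed (use assms j in auto)
  moreover have "(s \<beta> (g * K) div b * K + j mod K) div K = s \<beta> (g * K) div b"
    "(s \<beta> (g * K) div b * K + j mod K) mod K = j mod K"
    using assms(4) by simp_all
  ultimately show ?thesis by (simp add: sel_sparse_def Let_def j)
qed

end

text \<open>
  Words 4 to 10 of the memory hold the parameters, word 11 the address of the blocks, and word
  \<open>12 + 8 * \<beta> + i\<close> the address of the \<open>i\<close>-th array for \<open>\<beta>\<close>.
\<close>

definition base_e :: "nat \<Rightarrow> exp \<Rightarrow> exp" where
  "base_e i \<beta> = Mem (add_e (N (12 + i)) (mul_e (N 8) \<beta>))"

definition word_e :: "nat \<Rightarrow> exp \<Rightarrow> exp \<Rightarrow> exp" where
  "word_e i \<beta> a = Mem (add_e (base_e i \<beta>) a)"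

definition small_e :: "nat \<Rightarrow> exp \<Rightarrow> exp \<Rightarrow> exp" where
  "small_e i \<beta> a = field_e (base_e i \<beta>) (Mem (N 5)) (Mem (N 10)) a"

definition block_e :: "exp \<Rightarrow> exp" where
  "block_e u = field_e (Mem (N 11)) (Mem (N 4)) (Mem (N 9)) u"

definition bit_e :: "exp \<Rightarrow> exp" where
  "bit_e p = mod_e (div_e (block_e (div_e p (Mem (N 4)))) (pow2_e (mod_e p (Mem (N 4))))) (N 2)"

definition rank_e :: "exp \<Rightarrow> exp \<Rightarrow> exp" where
  "rank_e \<beta> p =
    (let b = Mem (N 4); u = div_e p b in
     add_e (add_e (word_e 0 \<beta> (div_e u (Mem (N 8)))) (small_e 1 \<beta> u))
       (word_e 2 \<beta> (add_e (mul_e (block_e u) b) (mod_e p b))))"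

definition super_e :: "exp \<Rightarrow> exp" where
  "super_e j = div_e (div_e j (Mem (N 6))) (Mem (N 7))"

definition super_size_e :: exp where
  "super_size_e = mul_e (Mem (N 7)) (Mem (N 6))"

definition start_e :: "exp \<Rightarrow> exp \<Rightarrow> exp" where
  "start_e \<beta> j = add_e (word_e 3 \<beta> (super_e j)) (small_e 4 \<beta> (div_e j (Mem (N 6))))"

definition window_e :: "exp \<Rightarrow> exp" where
  "window_e p =
    (let b = Mem (N 4); u = div_e p b in
     mod_e (div_e (add_e (block_e u) (mul_e (pow2_e b) (block_e (add_e u (N 1))))) (pow2_e (mod_e p b)))
       (pow2_e b))"

definition offset_e :: "exp \<Rightarrow> exp \<Rightarrow> exp" where
  "offset_e \<beta> j = word_e 7 \<beta>
     (add_e (mul_e (window_e (start_e \<beta> j)) (Mem (N 6))) (mod_e j (Mem (N 6))))"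

definition sparse_e :: "exp \<Rightarrow> exp \<Rightarrow> exp" where
  "sparse_e \<beta> j = small_e 6 \<beta>
     (add_e (mul_e (div_e (start_e \<beta> j) (Mem (N 4))) (Mem (N 6))) (mod_e j (Mem (N 6))))"

definition long_e :: "exp \<Rightarrow> exp \<Rightarrow> exp" where
  "long_e \<beta> j = word_e 5 \<beta>
     (add_e (mul_e (div_e (word_e 3 \<beta> (super_e j)) (pow2_e (Mem (N 5)))) super_size_e)
       (mod_e j super_size_e))"

definition sel_e :: "exp \<Rightarrow> exp \<Rightarrow> exp" where
  "sel_e \<beta> j =
    IfLess (sub_e (word_e 3 \<beta> (add_e (super_e j) (N 1))) (word_e 3 \<beta> (super_e j)))
        (pow2_e (Mem (N 5)))
      (IfLess (offset_e \<beta> j) (Mem (N 4))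
        (add_e (start_e \<beta> j) (offset_e \<beta> j))
        (add_e (start_e \<beta> j) (sparse_e \<beta> j)))
      (long_e \<beta> j)"

lemmas index_e_defs = base_e_def word_e_def small_e_def block_e_def bit_e_def rank_e_def
  super_e_def super_size_e_def start_e_def window_e_def offset_e_def sparse_e_def long_e_def
  sel_e_def field_e_def pow2_e_def Let_def

lemma regs_bit_e: "regs (bit_e p) = regs p"
  by (auto simp: index_e_defs)

lemma regs_rank_e: "regs (rank_e \<beta> p) = regs \<beta> \<union> regs p"
  by (auto simp: index_e_defs)

lemma regs_sel_e: "regs (sel_e \<beta> j) = regs \<beta> \<union> regs j"
  by (auto simp: index_e_defs)

text \<open>\<open>2 * b \<le> w\<close> lets two adjacent blocks share a word,
  \<open>q * b \<le> 2 ^ f\<close> keeps relative ranks within a field, \<open>K \<le> b\<close>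
  bounds the indices into the sparse array, and the last inequality of \<open>small\<close> keeps
  positions and supergroup starts below \<open>2 ^ w\<close>. The constant 28 is the length of the
  header, whose addresses occur as literals in the code.\<close>

locale bitvector_memory = bitvector_index +
  fixes m :: "nat \<Rightarrow> nat"
  assumes pos: "0 < b" "0 < f" "0 < K" "0 < k" "0 < q"
    and small: "2 * b \<le> w" "K \<le> b" "f < w" "q * b \<le> 2 ^ f" "(28::nat) < 2 ^ w" "3 * M + 2 * (k * K) + 2 ^ f < 2 ^ w"
    and params: "m 4 = b" "m 5 = f" "m 6 = K" "m 7 = k" "m 8 = q" "m 9 = w div b" "m 10 = w div f"
    and blocks_stored: "\<And>a. a < length blocks \<Longrightarrow> m (m 11 + a) = blocks ! a"
      "m 11 + length blocks \<le> 2 ^ w"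
    and arrays_stored: "\<And>\<beta> i a. \<beta> < 2 \<Longrightarrow> i < 8 \<Longrightarrow> a < length (arrays \<beta> ! i) \<Longrightarrow>
        m (m (12 + 8 * \<beta> + i) + a) = arrays \<beta> ! i ! a"
      "\<And>\<beta> i. \<beta> < 2 \<Longrightarrow> i < 8 \<Longrightarrow> m (12 + 8 * \<beta> + i) + length (arrays \<beta> ! i) \<le> 2 ^ w"
begin

lemma eval_param: "c < 29 \<Longrightarrow> m c = v \<Longrightarrow> eval w r m (Mem (N c)) = v"
  using small(5) by simp

lemma eval_base:
  assumes "eval w r m be = \<beta>" "\<beta> < 2" "i < 8"
  shows "eval w r m (base_e i be) = m (12 + 8 * \<beta> + i)"
proof -
  have "eval w r m (add_e (N (12 + i)) (mul_e (N 8) be)) = (12 + i) + 8 * \<beta>"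
    by (intro eval_add eval_N eval_mul assms) (use assms small(5) in auto)
  then show ?thesis by (simp add: base_e_def ac_simps)
qed

lemma eval_word:
  assumes "eval w r m be = \<beta>" "\<beta> < 2" "i < 8" "eval w r m ae = a" "a < length (arrays \<beta> ! i)"
  shows "eval w r m (word_e i be ae) = arrays \<beta> ! i ! a"
proof -
  have "eval w r m (add_e (base_e i be) ae) = m (12 + 8 * \<beta> + i) + a"
    by (intro eval_add eval_base assms) (use arrays_stored(2)[of \<beta> i] assms in auto)
  then show ?thesis using arrays_stored(1)[of \<beta> i a] assms by (simp add: word_e_def)
qed

lemma eval_small:
  assumes "eval w r m be = \<beta>" "\<beta> < 2" "i < 8" "eval w r m ae = a"
    and "arrays \<beta> ! i = packed w f len g" "a < len" "a < 2 ^ w" "word_state w (r, m)"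
  shows "eval w r m (small_e i be ae) = g a mod 2 ^ f"
  unfolding small_e_def
  using assms small pos arrays_stored[of \<beta> i] params
  by (intro eval_field[where base = "m (12 + 8 * \<beta> + i)" and len = len] eval_base eval_param) auto

lemma eval_block:
  assumes "eval w r m ue = u" "u < M div b + 2" "word_state w (r, m)"
  shows "eval w r m (block_e ue) = window X (u * b) b"
proof -
  have "M div b \<le> M" by simp
  moreover have "1 \<le> k * K" "(1::nat) \<le> 2 ^ f" using pos by (simp_all add: Suc_le_eq)
  ultimately have "u < 2 ^ w" using assms(2) small(6) by linarith
  then have "eval w r m (block_e ue) = block_array u mod 2 ^ b"
    unfolding block_e_def using assms small pos blocks_stored params
    by (intro eval_field[where base = "m 11" and len = "M div b + 2"] eval_param)
      (auto simp: blocks_def)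
  then show ?thesis using window_less[of X "u * b" b] by (simp add: block_array_def)
qed

lemma less_word: "x \<le> 2 * M + k * K \<Longrightarrow> x < 2 ^ w"
  using small(6) by linarith

lemma eval_bit:
  assumes "eval w r m pe = p" "p < M" "word_state w (r, m)"
  shows "eval w r m (bit_e pe) = of_bool (X p)"
proof -
  have p: "p < 2 ^ w" by (rule less_word) (use assms in simp)
  have bw: "b < w" using small pos by linarith
  have u: "p div b < M div b + 2" using assms(2) by (simp add: div_le_mono le_imp_less_Suc less_imp_le less_SucI)
  have e: "eval w r m (Mem (N 4)) = b" by (rule eval_param) (use params in auto)
  have e1: "eval w r m (block_e (div_e pe (Mem (N 4)))) = window X (p div b * b) b"
    by (intro eval_block eval_div assms e p u)
  have lt: "window X (p div b * b) b < 2 ^ w"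
    using window_less[of X "p div b * b" b] power_strict_increasing[of b w "2::nat"] bw by linarith
  have e2: "eval w r m (pow2_e (mod_e pe (Mem (N 4)))) = 2 ^ (p mod b)"
    by (intro eval_pow2 eval_mod assms e p) (use bw pos(1) in \<open>simp add: less_trans[OF mod_less_divisor]\<close>)
  have e3: "eval w r m (bit_e pe) = window X (p div b * b) b div 2 ^ (p mod b) mod 2"
    unfolding bit_e_def
    by (intro eval_mod eval_div e1 e2 eval_N lt)
       (use lt small(5) in \<open>auto intro: le_less_trans[OF div_le_dividend]\<close>)
  have "window X (p div b * b) b div 2 ^ (p mod b) mod 2 ^ 1 = window X (p div b * b + p mod b) 1"
    by (rule window_shift) (use pos(1) in \<open>simp add: Suc_le_eq\<close>)
  then show ?thesis by (simp add: e3 window_def)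
qed

lemma eval_rank:
  assumes "eval w r m be = \<beta>" "\<beta> < 2" "eval w r m pe = p" "p \<le> M" "word_state w (r, m)"
  shows "eval w r m (rank_e be pe) = rk (occ \<beta>) p"
proof -
  let ?Y = "occ \<beta>"
  define u where "u = p div b"
  have p: "p < 2 ^ w" by (rule less_word) (use assms in simp)
  have bw: "b < w" using small pos by linarith
  have u: "u \<le> M div b" unfolding u_def using assms(4) by (rule div_le_mono)
  then have uq: "u div q \<le> M div b div q" by (rule div_le_mono)
  have "u \<le> p" by (simp add: u_def)
  then have uw: "u < 2 ^ w" using p by linarith
  have u1: "u * b + p mod b = p" by (simp add: u_def)
  have u2: "u div q * q * b + (u mod q) * b = u * b" by (simp add: add_mult_distrib[symmetric])
  have eb: "eval w r m (Mem (N 4)) = b" by (rule eval_param) (use params in auto)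
  have eu: "eval w r m (div_e pe (Mem (N 4))) = u" unfolding u_def by (intro eval_div assms eb p)
  have e1: "eval w r m (word_e 0 be (div_e (div_e pe (Mem (N 4))) (Mem (N 8)))) =
      arrays \<beta> ! 0 ! (u div q)"
    by (intro eval_word eval_div eval_param params eu assms uw)
      (use uq in \<open>auto simp: arrays_def\<close>)
  have a0: "arrays \<beta> ! 0 ! (u div q) = rk ?Y (u div q * q * b)"
    using uq by (simp add: arrays_def rank_super_def del: upt_Suc)
  have e2: "eval w r m (small_e 1 be (div_e pe (Mem (N 4)))) = rank_block \<beta> u mod 2 ^ f"
    by (rule eval_small[where len = "M div b + 1" and \<beta> = \<beta>])
       (use assms eu u uw in \<open>auto simp: arrays_def\<close>)
  have "rk ?Y (u * b) = rk ?Y (u div q * q * b) + rk (\<lambda>i. ?Y (u div q * q * b + i)) (u mod q * b)"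
    using rk_add[of ?Y "u div q * q * b" "u mod q * b"] u2 by simp
  then have rb: "rank_block \<beta> u \<le> u mod q * b" "rk ?Y (u div q * q * b) + rank_block \<beta> u = rk ?Y (u * b)"
    using rk_le[of _ "u mod q * b"] by (auto simp: rank_block_def)
  have "u mod q * b < q * b" using pos by simp
  then have "rank_block \<beta> u < 2 ^ f" using rb small by linarith
  then have e2': "eval w r m (small_e 1 be (div_e pe (Mem (N 4)))) = rank_block \<beta> u"
    using e2 by simp
  let ?y = "window X (u * b) b"
  have ey: "eval w r m (block_e (div_e pe (Mem (N 4)))) = ?y"
    by (rule eval_block[OF eu _ assms(5)]) (use u in simp)
  have y: "?y < 2 ^ b" by (rule window_less)
  have pb: "p mod b < b" using pos by simp
  have "(?y + 1) * b \<le> 2 ^ b * b" using y by (intro mult_right_mono) auto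
  then have idx: "?y * b + p mod b < 2 ^ b * b" using pb by (simp add: algebra_simps)
  have len2: "length (arrays \<beta> ! 2) = 2 ^ b * b" by (simp add: arrays_def)
  have idxw: "?y * b + p mod b < 2 ^ w"
    using idx len2 arrays_stored(2)[of \<beta> 2] assms(2) by linarith
  have e3: "eval w r m (word_e 2 be (add_e (mul_e (block_e (div_e pe (Mem (N 4)))) (Mem (N 4)))
        (mod_e pe (Mem (N 4))))) = arrays \<beta> ! 2 ! (?y * b + p mod b)"
    by (intro eval_word eval_add eval_mul eval_mod ey eb assms p)
      (use idx idxw len2 in auto)
  have "rank_table \<beta> (?y * b + p mod b) = rk (\<lambda>j. bit ?y j = (\<beta> = 1)) (p mod b)"
    using pb pos(1) by (simp add: rank_table_def)
  also have "\<dots> = rk (\<lambda>i. ?Y (u * b + i)) (p mod b)"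
    using pb by (intro rk_cong) (auto simp: bit_window occ_def)
  finally have a2: "arrays \<beta> ! 2 ! (?y * b + p mod b) = rk (\<lambda>i. ?Y (u * b + i)) (p mod b)"
    using idx by (simp add: arrays_def del: upt_Suc)
  have tot: "rk ?Y (u * b) + rk (\<lambda>i. ?Y (u * b + i)) (p mod b) = rk ?Y p"
    using rk_add[of ?Y "u * b" "p mod b"] u1 by simp
  have "rk ?Y p \<le> p" by (rule rk_le)
  then have lt: "rk ?Y p < 2 ^ w" using p by linarith
  have "eval w r m (rank_e be pe) = (rk ?Y (u div q * q * b) + rank_block \<beta> u)
     + rk (\<lambda>i. ?Y (u * b + i)) (p mod b)"
    unfolding rank_e_def Let_def
    by (intro eval_add e1[unfolded a0] e2' e3[unfolded a2]) (use tot rb(2) lt in auto)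
  then show ?thesis using rb(2) tot by simp
qed

text \<open>Two neighbouring blocks are joined in one word; the window, which need not be aligned,
  is cut out by a shift and a mask.\<close>

lemma eval_window:
  assumes "eval w r m pe = p" "p < M" "word_state w (r, m)"
  shows "eval w r m (window_e pe) = window X p b"
proof -
  define u where "u = p div b"
  have p: "p < 2 ^ w" by (rule less_word) (use assms in simp)
  have bw: "b < w" using small pos by linarith
  have u: "u \<le> M div b" unfolding u_def using assms(2) by (intro div_le_mono) simp
  have "u \<le> p" by (simp add: u_def)
  then have uw: "u + 1 < 2 ^ w" using assms(2) small(6) by linarith
  have eb: "eval w r m (Mem (N 4)) = b" by (rule eval_param) (use params in auto)
  have eu: "eval w r m (div_e pe (Mem (N 4))) = u" unfolding u_def by (intro eval_div assms eb p)
  have e0: "eval w r m (block_e (div_e pe (Mem (N 4)))) = window X (u * b) b"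
    by (rule eval_block[OF eu _ assms(3)]) (use u in simp)
  have "eval w r m (add_e (div_e pe (Mem (N 4))) (N 1)) = u + 1"
    by (intro eval_add eu eval_N uw) (use small(5) in linarith)
  then have e1: "eval w r m (block_e (add_e (div_e pe (Mem (N 4))) (N 1))) = window X ((u + 1) * b) b"
    by (rule eval_block[OF _ _ assms(3)]) (use u in simp)
  have app: "window X (u * b) b + 2 ^ b * window X ((u + 1) * b) b = window X (u * b) (b + b)"
    by (simp add: window_append algebra_simps)
  have "window X (u * b) (b + b) < 2 ^ (b + b)" by (rule window_less)
  also have "(2::nat) ^ (b + b) \<le> 2 ^ w" by (rule power_increasing) (use small in auto)
  finally have lt: "window X (u * b) (b + b) < 2 ^ w" .
  have pb: "p mod b < b" using pos by simp
  have e2: "eval w r m (window_e pe) = window X (u * b) (b + b) div 2 ^ (p mod b) mod 2 ^ b"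
    unfolding window_e_def Let_def
    by (intro eval_mod eval_div eval_add[OF _ _ , where x = "window X (u * b) b"
           and y = "2 ^ b * window X ((u + 1) * b) b", unfolded app] eval_mul eval_pow2 e0 e1 eb assms p bw)
      (use lt app pb bw in \<open>auto intro: le_less_trans[OF div_le_dividend]\<close>)
  have "\<dots> = window X (u * b + p mod b) b"
    by (rule window_shift) (use pb in simp)
  then show ?thesis using e2 by (simp add: u_def)
qed

text \<open>A long supergroup has its answers stored outright. Otherwise \<open>sel_super\<close>
  and \<open>sel_group\<close> add up to the start \<open>p\<close> of the group. If the occurrence
  lies within \<open>b\<close> bits of \<open>p\<close>, the table finds it from the window at
  \<open>p\<close>; if not, its distance from \<open>p\<close> is an entry of the sparse
  array.\<close>

lemma eval_sel:
  assumes be: "eval w r m be = \<beta>" "\<beta> < 2" and je: "eval w r m je = j" and jM: "s \<beta> j < M"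
    and ws: "word_state w (r, m)"
  shows "eval w r m (sel_e be je) = s \<beta> j"
proof -
  define g where "g = j div K"
  define v where "v = g div k"
  let ?KK = "k * K"
  have KK: "0 < ?KK" using pos by simp
  have jlt: "j < M" using le_sel[of j M "occ \<beta>"] jM by linarith
  have jw: "j < 2 ^ w" by (rule less_word) (use jlt in simp)
  have vj: "v = j div ?KK" by (simp add: v_def g_def div_mult2_eq[symmetric] mult.commute)
  have gK: "g * K \<le> j" by (simp add: g_def)
  have vK: "v * ?KK \<le> g * K"
  proof -
    have "g div k * k \<le> g" by simp
    then have "g div k * k * K \<le> g * K" by (rule mult_right_mono) simp
    then show ?thesis by (simp add: v_def mult.assoc)
  qed
  have jS: "j < Suc v * ?KK"
    unfolding vj using KK by (metis dividend_less_div_times add.commute mult_Suc)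
  have vM: "v \<le> M div ?KK" unfolding vj using jlt by (intro div_le_mono) simp
  have gM: "g \<le> M div K" unfolding g_def using jlt by (intro div_le_mono) simp
  have sg: "s \<beta> (v * ?KK) \<le> s \<beta> (g * K)" "s \<beta> (g * K) \<le> s \<beta> j" "s \<beta> j < s \<beta> (Suc v * ?KK)"
    using gK vK jS by (simp_all only: sel_le_iff sel_less_iff)
  have eK: "eval w r m (Mem (N 6)) = K" and ek: "eval w r m (Mem (N 7)) = k"
    and eb: "eval w r m (Mem (N 4)) = b" and ef: "eval w r m (Mem (N 5)) = f"
    by (rule eval_param[OF _ params(3)] eval_param[OF _ params(4)] eval_param[OF _ params(1)]
        eval_param[OF _ params(2)]; simp)+
  have gj: "g \<le> j" "v \<le> g" by (auto simp: g_def v_def)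
  have gw: "g < 2 ^ w" using gj jw by linarith
  have eg: "eval w r m (div_e je (Mem (N 6))) = g" unfolding g_def by (intro eval_div je eK jw)
  have ev: "eval w r m (super_e je) = v" unfolding super_e_def v_def by (intro eval_div eg ek gw)
  have "1 \<le> ?KK" using KK by linarith
  then have vw: "v + 1 < 2 ^ w" using gj jlt small(6) by linarith
  have ev1: "eval w r m (add_e (super_e je) (N 1)) = v + 1"
    by (intro eval_add ev eval_N vw) (use small(5) in linarith)
  have es: "eval w r m (word_e 3 be (super_e je)) = s \<beta> (v * ?KK)"
    by (subst eval_word[OF be _ ev]) (use vM in \<open>auto simp: arrays_def sel_super_def simp del: upt_Suc\<close>)
  have es1: "eval w r m (word_e 3 be (add_e (super_e je) (N 1))) = s \<beta> (Suc v * ?KK)"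
    by (subst eval_word[OF be _ ev1]) (use vM in \<open>auto simp: arrays_def sel_super_def simp del: upt_Suc mult_Suc\<close>)
  \<comment> \<open>The next supergroup may begin past \<open>M\<close>, where \<open>sel\<close>
    still has a bounded value.\<close>
  have "s \<beta> (Suc v * ?KK) \<le> M + Suc v * ?KK" by (rule sel_le)
  also have "\<dots> \<le> 2 * M + ?KK" using le_trans[OF vK gK] jlt unfolding mult_Suc by linarith
  finally have slt: "s \<beta> (Suc v * ?KK) < 2 ^ w" by (rule less_word)
  have ed: "eval w r m (sub_e (word_e 3 be (add_e (super_e je) (N 1))) (word_e 3 be (super_e je)))
      = s \<beta> (Suc v * ?KK) - s \<beta> (v * ?KK)"
    by (rule eval_sub[OF es1 es _ slt]) (use sg in linarith)
  have eQ: "eval w r m (pow2_e (Mem (N 5))) = 2 ^ f" by (intro eval_pow2 ef small)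
  show ?thesis
  proof (cases "long \<beta> v")
    case True
    have KKw: "?KK < 2 ^ w" using small(6) by linarith
    have eKK: "eval w r m super_size_e = ?KK"
      unfolding super_size_e_def by (intro eval_mul ek eK KKw)
    let ?i = "s \<beta> (v * ?KK) div 2 ^ f * ?KK + j mod ?KK"
    have svw: "s \<beta> (v * ?KK) < 2 ^ w" using sg slt by linarith
    have len: "length (arrays \<beta> ! 5) = (M div 2 ^ f + 1) * ?KK" by (simp add: arrays_def)
    have "s \<beta> (v * ?KK) div 2 ^ f \<le> M div 2 ^ f" using sg jM by (intro div_le_mono) simp
    then have "(s \<beta> (v * ?KK) div 2 ^ f + 1) * ?KK \<le> (M div 2 ^ f + 1) * ?KK"
      by (intro mult_right_mono) auto
    moreover have "j mod ?KK < ?KK" using KK by simp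
    ultimately have i: "?i < (M div 2 ^ f + 1) * ?KK" unfolding add_mult_distrib by linarith
    have iw: "?i < 2 ^ w" using i len arrays_stored(2)[of \<beta> 5] be(2) by linarith
    have "eval w r m (long_e be je) = arrays \<beta> ! 5 ! ?i"
      unfolding long_e_def
      by (intro eval_word be eval_add eval_mul eval_div eval_mod es eQ eKK je svw jw)
        (use i iw len in auto)
    also have "\<dots> = s \<beta> j"
      using sel_long_correct[OF True vj[symmetric]] pos i less_word[of "s \<beta> j"] jM
      by (simp add: arrays_def del: upt_Suc)
    finally show ?thesis using True ed eQ by (simp add: sel_e_def long_def)
  next
    case False
    then have short: "s \<beta> (Suc v * ?KK) < s \<beta> (v * ?KK) + 2 ^ f"
      using sg unfolding long_def by linarith
    have "eval w r m (small_e 4 be (div_e je (Mem (N 6)))) = sel_group \<beta> g mod 2 ^ f"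
      by (rule eval_small[where len = "M div K + 1" and \<beta> = \<beta>])
         (use be eg gM gw ws in \<open>auto simp: arrays_def\<close>)
    also have "sel_group \<beta> g = s \<beta> (g * K) - s \<beta> (v * ?KK)" by (simp add: sel_group_def v_def)
    also have "\<dots> mod 2 ^ f = \<dots>" using short sg by simp
    finally have egr: "eval w r m (small_e 4 be (div_e je (Mem (N 6)))) = s \<beta> (g * K) - s \<beta> (v * ?KK)" .
    define p where "p = s \<beta> (g * K)"
    have pM: "p < M" using sg jM by (simp add: p_def)
    have pw: "p < 2 ^ w" by (rule less_word) (use pM in simp)
    have sw: "s \<beta> j < 2 ^ w" by (rule less_word) (use jM in simp)
    have "s \<beta> (v * ?KK) + (p - s \<beta> (v * ?KK)) = p" using sg by (simp add: p_def)
    then have ep: "eval w r m (start_e be je) = p"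
      unfolding start_e_def using eval_add[OF es egr] pw by (simp add: p_def)
    have ey: "eval w r m (window_e (start_e be je)) = window X p b"
      by (rule eval_window[OF ep pM ws])
    let ?y = "window X p b"
    have r: "j mod K < K" using pos by simp
    have em: "eval w r m (mod_e je (Mem (N 6))) = j mod K" by (intro eval_mod je eK jw)
    have "?y + 1 \<le> 2 ^ b" using window_less[of X p b] by simp
    then have "(?y + 1) * K \<le> 2 ^ b * K" by (rule mult_right_mono) simp
    then have i: "?y * K + j mod K < 2 ^ b * K" using r unfolding add_mult_distrib by linarith
    have len: "length (arrays \<beta> ! 7) = 2 ^ b * K" by (simp add: arrays_def)
    have iw: "?y * K + j mod K < 2 ^ w" using i len arrays_stored(2)[of \<beta> 7] be(2) by linarith
    have "eval w r m (offset_e be je) = arrays \<beta> ! 7 ! (?y * K + j mod K)"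
      unfolding offset_e_def
      by (intro eval_word be eval_add eval_mul ey eK em) (use i iw len in auto)
    also have "\<dots> = nth_offset b (\<lambda>i. bit ?y i = (\<beta> = 1)) (j mod K)"
      using i r by (simp add: arrays_def sel_table_def del: upt_Suc)
    also have "\<dots> = nth_offset b (\<lambda>i. occ \<beta> (p + i)) (j mod K)"
      by (rule nth_offset_cong) (simp add: bit_window occ_def)
    also have "\<dots> = (if s \<beta> j < p + b then s \<beta> j - p else b)"
      using nth_offset_sel[of M "occ \<beta>" "g * K" "j mod K" b] jM by (simp add: g_def p_def)
    finally have eo: "eval w r m (offset_e be je) = (if s \<beta> j < p + b then s \<beta> j - p else b)" .
    have sj: "p \<le> s \<beta> j" using sg by (simp add: p_def)
    have es: "eval w r m (sel_e be je) = (if eval w r m (offset_e be je) < b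
        then eval w r m (add_e (start_e be je) (offset_e be je))
        else eval w r m (add_e (start_e be je) (sparse_e be je)))"
      using False ed eQ eb by (simp add: sel_e_def long_def)
    show ?thesis
    proof (cases "s \<beta> j < p + b")
      case True
      then have "eval w r m (add_e (start_e be je) (offset_e be je)) = p + (s \<beta> j - p)"
        by (intro eval_add ep) (use eo sj sw in auto)
      then show ?thesis using es True eo sj pos by simp
    next
      case False
      let ?i = "p div b * K + j mod K"
      have "p div b + 1 \<le> M div b + 1" using pM by (simp add: div_le_mono)
      then have "(p div b + 1) * K \<le> (M div b + 1) * K" by (rule mult_right_mono) simp
      then have i: "?i < (M div b + 1) * K" using r unfolding add_mult_distrib by linarith
      have gb: "g * K + j mod K = j" by (simp add: g_def)
      \<comment> \<open>This array is indexed by fields rather than words, so the address space does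
        not bound the index; \<open>K \<le> b\<close> bounds it through the position
        \<open>p\<close>.\<close>
      have iw: "?i < 2 ^ w"
      proof -
        have "p div b * K \<le> p div b * b" using small(2) by simp
        also have "\<dots> \<le> p" by simp
        finally have "?i < M + K" using r pM by linarith
        moreover have "K \<le> k * K" using pos by simp
        ultimately show ?thesis using small(6) by linarith
      qed
      have ei: "eval w r m (add_e (mul_e (div_e (start_e be je) (Mem (N 4))) (Mem (N 6)))
          (mod_e je (Mem (N 6)))) = ?i"
        by (intro eval_add eval_mul eval_div ep eb eK em pw) (use iw in auto)
      have "eval w r m (sparse_e be je) = sel_sparse \<beta> ?i mod 2 ^ f"
        unfolding sparse_e_def
        by (rule eval_small[where g = "sel_sparse \<beta>" and a = ?i, OF be _ ei _ i iw ws])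
           (simp_all add: arrays_def)
      also have "sel_sparse \<beta> ?i = s \<beta> j - p"
        unfolding p_def using sel_sparse_correct[of j g \<beta>] False pos by (simp add: g_def p_def)
      also have "(s \<beta> j - p) mod 2 ^ f = s \<beta> j - p" using short sg by (simp add: p_def)
      finally have "eval w r m (add_e (start_e be je) (sparse_e be je)) = p + (s \<beta> j - p)"
        by (intro eval_add ep) (use sj sw in auto)
      then show ?thesis using es False eo sj by simp
    qed
  qed
qed

end

section \<open>Wavelet trees\<close>

datatype 'a code = Sym 'a | Fork "'a code" "'a code"

fun symbols :: "'a code \<Rightarrow> 'a set" where
  "symbols (Sym c) = {c}"
| "symbols (Fork l r) = symbols l \<union> symbols r"

fun depth :: "'a code \<Rightarrow> 'a \<Rightarrow> nat" where
  "depth (Sym c) x = 0"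
| "depth (Fork l r) x = Suc (if x \<in> symbols r then depth r x else depth l x)"

fun nodes :: "'a code \<Rightarrow> nat" where
  "nodes (Sym c) = 1"
| "nodes (Fork l r) = Suc (nodes l + nodes r)"

fun tree_bits :: "'a code \<Rightarrow> 'a list \<Rightarrow> bool list" where
  "tree_bits (Sym c) L = []"
| "tree_bits (Fork l r) L = map (\<lambda>x. x \<in> symbols r) L @
     tree_bits l (filter (\<lambda>x. x \<notin> symbols r) L) @ tree_bits r (filter (\<lambda>x. x \<in> symbols r) L)"

text \<open>
  The record of a node consists of the offset of its bits, the address of its right child
  (\<open>0\<close> for a leaf), the address of its parent (\<open>0\<close> for the root), and its side.
  Nodes are listed in preorder, so the left child follows immediately.
\<close>

fun records :: "nat \<Rightarrow> nat \<Rightarrow> nat \<Rightarrow> nat \<Rightarrow> 'a code \<Rightarrow> 'a list \<Rightarrow> nat list" where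
  "records par side st a (Sym c) L = [st, 0, par, side]"
| "records par side st a (Fork l r) L = [st, a + 4 + 4 * nodes l, par, side]
     @ records a 0 (st + length L) (a + 4) l (filter (\<lambda>x. x \<notin> symbols r) L)
     @ records a 1 (st + length L + length (tree_bits l (filter (\<lambda>x. x \<notin> symbols r) L)))
         (a + 4 + 4 * nodes l) r (filter (\<lambda>x. x \<in> symbols r) L)"

lemma length_records: "length (records par side st a t L) = 4 * nodes t"
  by (induction par side st a t L rule: records.induct) auto

text \<open>An entry contributes one bit at every inner node on its path.\<close>

lemma length_tree_bits: "length (tree_bits t L) = (\<Sum>x\<leftarrow>L. depth t x)"
proof (induction t arbitrary: L)
  case (Fork l r)
  have "(\<Sum>x\<leftarrow>L. depth (Fork l r) x) = length L +
      (\<Sum>x\<leftarrow>filter (\<lambda>x. x \<notin> symbols r) L. depth l x) + (\<Sum>x\<leftarrow>filter (\<lambda>x. x \<in> symbols r) L. depth r x)"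
    by (induction L) auto
  then show ?case by (simp add: Fork)
qed simp

text \<open>Applied at each node, this makes the bit offsets recorded for one tree valid in the
  other.\<close>

lemma length_tree_bits_cong: "mset L = mset L' \<Longrightarrow> length (tree_bits t L) = length (tree_bits t L')"
  unfolding length_tree_bits by (metis mset_map sum_mset_sum_list)

definition segment :: "(nat \<Rightarrow> nat) \<Rightarrow> nat \<Rightarrow> nat list \<Rightarrow> bool" where
  "segment m a xs \<longleftrightarrow> (\<forall>i<length xs. m (a + i) = xs ! i)"

lemma segment_append: "segment m a (xs @ ys) \<longleftrightarrow> segment m a xs \<and> segment m (a + length xs) ys"
proof
  assume *: "segment m a (xs @ ys)"
  have "m (a + length xs + i) = ys ! i" if "i < length ys" for i
    using *[unfolded segment_def, rule_format, of "length xs + i"] that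
    by (simp add: nth_append add.assoc)
  moreover have "m (a + i) = xs ! i" if "i < length xs" for i
    using *[unfolded segment_def, rule_format, of i] that by (simp add: nth_append)
  ultimately show "segment m a xs \<and> segment m (a + length xs) ys" by (simp add: segment_def)
next
  assume *: "segment m a xs \<and> segment m (a + length xs) ys"
  show "segment m a (xs @ ys)"
    unfolding segment_def
  proof (intro allI impI)
    fix i assume i: "i < length (xs @ ys)"
    show "m (a + i) = (xs @ ys) ! i"
    proof (cases "i < length xs")
      case False
      have "\<forall>j<length ys. m (a + length xs + j) = ys ! j" using * by (simp add: segment_def)
      from this[rule_format, of "i - length xs"] show ?thesis
        using False i by (simp add: nth_append)
    qed (use * in \<open>simp add: segment_def nth_append\<close>)
  qed
qed

lemma segment_Cons: "segment m a (x # xs) \<longleftrightarrow> m a = x \<and> segment m (Suc a) xs"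
  using segment_append[of m a "[x]" xs] by (simp add: segment_def)

lemma segment_records:
  "segment m a (records par side st a t L) \<Longrightarrow> m a = st \<and> m (a + 2) = par \<and> m (a + 3) = side"
  by (cases t) (auto simp: segment_Cons numeral_eq_Suc)

lemma nodes_pos: "1 \<le> nodes t"
  by (cases t) auto

text \<open>\<open>off\<close> selects the tree: 0 for the first one, the length of the first bit
  string for the second. The record of the node holds the offset relative to that.\<close>

definition node_pos_e :: "exp \<Rightarrow> exp" where
  "node_pos_e off = add_e off (Mem (V 1))"

text \<open>
  Register \<open>0\<close> holds an index into the sequence of the current node, register \<open>1\<close> the address
  of the node, and register \<open>3\<close> is \<open>0\<close> once the walk has to stop.
\<close>

definition down_body :: "exp \<Rightarrow> com" where
  "down_body off =
    Seq (assign 2 (bit_e (add_e (node_pos_e off) (V 0))))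
   (Seq (assign 0 (sub_e (rank_e (V 2) (add_e (node_pos_e off) (V 0))) (rank_e (V 2) (node_pos_e off))))
   (Seq (assign 1 (IfLess (V 2) (N 1) (add_e (V 1) (N 4)) (Mem (add_e (V 1) (N 1)))))
     (assign 3 (Mem (add_e (V 1) (N 1))))))"

definition up_body :: "exp \<Rightarrow> com" where
  "up_body off =
    Seq (assign 2 (Mem (add_e (V 1) (N 3))))
   (Seq (assign 1 (V 3))
   (Seq (assign 0 (sub_e (sel_e (V 2) (add_e (V 0) (rank_e (V 2) (node_pos_e off)))) (node_pos_e off)))
     (assign 3 (Mem (add_e (V 1) (N 2))))))"

definition walk :: "com \<Rightarrow> com" where
  "walk c = While (Less (Imm 0) (Reg 3)) c"

text \<open>Arguments count from 1 and indices from 0, whence the correction at both ends. The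
  ascent starts at the leaf where the descent ended but reads the bits at \<open>off'\<close>, as
  both trees have the same records.\<close>

definition query :: "exp \<Rightarrow> exp \<Rightarrow> com" where
  "query off off' =
    Seq (assign 0 (sub_e (V 0) (N 1)))
   (Seq (assign 1 (Mem (N 2)))
   (Seq (assign 3 (Mem (add_e (V 1) (N 1))))
   (Seq (walk (down_body off))
   (Seq (assign 3 (Mem (add_e (V 1) (N 2))))
   (Seq (walk (up_body off'))
     (assign 0 (add_e (V 0) (N 1))))))))"

definition down_cost :: "exp \<Rightarrow> nat" where
  "down_cost off = cost (bit_e (add_e (node_pos_e off) (V 0)))
     + cost (sub_e (rank_e (V 2) (add_e (node_pos_e off) (V 0))) (rank_e (V 2) (node_pos_e off)))
     + cost (IfLess (V 2) (N 1) (add_e (V 1) (N 4)) (Mem (add_e (V 1) (N 1))))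
     + cost (Mem (add_e (V 1) (N 1))) + 5"

definition up_cost :: "exp \<Rightarrow> nat" where
  "up_cost off = cost (Mem (add_e (V 1) (N 3))) + cost (V 3)
     + cost (sub_e (sel_e (V 2) (add_e (V 0) (rank_e (V 2) (node_pos_e off)))) (node_pos_e off))
     + cost (Mem (add_e (V 1) (N 2))) + 5"

section \<open>Correctness of the walks down and up\<close>

lemma rk_eq_filter:
  assumes "k \<le> length L" "\<And>i. i < k \<Longrightarrow> Y i = P (L ! i)"
  shows "rk Y k = length (filter P (take k L))"
proof -
  have "length (filter P (take k L)) = card {i. i < k \<and> P (L ! i)}"
    unfolding length_filter_conv_card using assms(1) by (intro arg_cong[of _ _ card]) auto
  also have "{i. i < k \<and> P (L ! i)} = {i. i < k \<and> Y i}" using assms(2) by auto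
  finally show ?thesis by (simp add: rk_def)
qed

lemma take_filter:
  assumes "k < length L" "P (L ! k)"
  shows "take (length (filter P (take k L))) (filter P L) = filter P (take k L)"
    and "filter P L ! length (filter P (take k L)) = L ! k"
    and "length (filter P (take k L)) < length (filter P L)"
proof -
  have "L = take k L @ L ! k # drop (Suc k) L" using assms(1) by (simp add: id_take_nth_drop)
  then have *: "filter P L = filter P (take k L) @ L ! k # filter P (drop (Suc k) L)"
    using assms(2) by (metis filter.simps(2) filter_append)
  show "take (length (filter P (take k L))) (filter P L) = filter P (take k L)"
    "filter P L ! length (filter P (take k L)) = L ! k"
    "length (filter P (take k L)) < length (filter P L)"
    by (subst *; simp add: nth_append)+
qed

context bitvector_memory
begin

text \<open>The index in the child is the number of equal bits before the given one within the node,
  a difference of two ranks in the whole vector.\<close>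

lemma down_step:
  assumes ws: "word_state w (r, m)" and r: "r 0 = i" "r 1 = a"
    and off: "\<And>r. eval w r m off = c" "regs off = {}"
    and st: "m a = st" "c + st + i < M" and a: "a + 4 < 2 ^ w"
    and \<beta>: "\<beta> = of_bool (X (c + st + i))" and a': "a' = (if \<beta> = 0 then a + 4 else m (a + 1))"
    and a'w: "a' + 1 < 2 ^ w"
  obtains t r' where "exec w (down_body off) (r, m) t (r', m)"
    "r' 0 = rk (occ \<beta>) (c + st + i) - rk (occ \<beta>) (c + st)" "r' 1 = a'" "r' 3 = m (a' + 1)"
    "word_state w (r', m)" "t \<le> down_cost off"
proof -
  let ?e1 = "bit_e (add_e (node_pos_e off) (V 0))"
  let ?e2 = "sub_e (rank_e (V 2) (add_e (node_pos_e off) (V 0))) (rank_e (V 2) (node_pos_e off))"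
  let ?e3 = "IfLess (V 2) (N 1) (add_e (V 1) (N 4)) (Mem (add_e (V 1) (N 1)))"
  let ?e4 = "Mem (add_e (V 1) (N 1))"
  have \<beta>2: "\<beta> < 2" by (simp add: \<beta>)
  have pw: "c + st + i < 2 ^ w" by (rule less_word) (use st in simp)
  have np: "eval w r' m (node_pos_e off) = c + st" if "r' 1 = a" for r'
    unfolding node_pos_e_def by (intro eval_add off) (use that st pw in auto)
  have np0: "eval w r' m (add_e (node_pos_e off) (V 0)) = c + st + i" if "r' 1 = a" "r' 0 = i" for r'
    by (intro eval_add np) (use that pw in auto)
  obtain t1 r1 where 1: "exec w (assign 2 ?e1) (r, m) t1 (r1, m)" "r1 2 = eval w r m ?e1"
    "\<And>k. k < 8 \<Longrightarrow> k \<noteq> 2 \<Longrightarrow> r1 k = r k" "word_state w (r1, m)" "t1 \<le> cost ?e1 + 1"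
    by (rule exec_assign[OF ws, of ?e1 2]) (auto simp: regs_bit_e node_pos_e_def off)
  have r12: "r1 2 = \<beta>" using 1(2) eval_bit[OF np0[of r, OF r(2,1)] st(2) ws] \<beta> by simp
  have r11: "r1 1 = a" "r1 0 = i" using 1(3)[of 1] 1(3)[of 0] r by auto
  obtain t2 r2 where 2: "exec w (assign 0 ?e2) (r1, m) t2 (r2, m)" "r2 0 = eval w r1 m ?e2"
    "\<And>k. k < 8 \<Longrightarrow> k \<noteq> 0 \<Longrightarrow> r2 k = r1 k" "word_state w (r2, m)" "t2 \<le> cost ?e2 + 1"
    by (rule exec_assign[OF 1(4), of ?e2 0]) (auto simp: regs_rank_e node_pos_e_def off)
  have ra: "eval w r1 m (rank_e (V 2) (add_e (node_pos_e off) (V 0))) = rk (occ \<beta>) (c + st + i)"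
    by (rule eval_rank[OF _ \<beta>2 np0[of r1, OF r11]]) (use r12 1(4) st in auto)
  have rb: "eval w r1 m (rank_e (V 2) (node_pos_e off)) = rk (occ \<beta>) (c + st)"
    by (rule eval_rank[OF _ \<beta>2 np[of r1, OF r11(1)]]) (use r12 1(4) st in auto)
  have "rk (occ \<beta>) (c + st + i) < 2 ^ w" using rk_le[of "occ \<beta>" "c + st + i"] pw by linarith
  then have r20: "r2 0 = rk (occ \<beta>) (c + st + i) - rk (occ \<beta>) (c + st)"
    unfolding 2(2) by (intro eval_sub ra rb rk_mono) auto
  have r22: "r2 2 = \<beta>" "r2 1 = a" using 2(3)[of 2] 2(3)[of 1] r11 r12 by auto
  obtain t3 r3 where 3: "exec w (assign 1 ?e3) (r2, m) t3 (r3, m)" "r3 1 = eval w r2 m ?e3"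
    "\<And>k. k < 8 \<Longrightarrow> k \<noteq> 1 \<Longrightarrow> r3 k = r2 k" "word_state w (r3, m)" "t3 \<le> cost ?e3 + 1"
    by (rule exec_assign[OF 2(4), of ?e3 1]) auto
  have "w \<noteq> 0" using small(1) pos(1) by linarith
  then have r31: "r3 1 = a'"
    unfolding 3(2) using r22 a \<beta>2 small(5) by (auto simp: a')
  obtain t4 r4 where 4: "exec w (assign 3 ?e4) (r3, m) t4 (r4, m)" "r4 3 = eval w r3 m ?e4"
    "\<And>k. k < 8 \<Longrightarrow> k \<noteq> 3 \<Longrightarrow> r4 k = r3 k" "word_state w (r4, m)" "t4 \<le> cost ?e4 + 1"
    by (rule exec_assign[OF 3(4), of ?e4 3]) auto
  have r43: "r4 3 = m (a' + 1)" unfolding 4(2) using r31 a'w \<open>w \<noteq> 0\<close> by simp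
  show ?thesis
  proof (rule that)
    show "exec w (down_body off) (r, m) (t1 + (t2 + (t3 + t4))) (r4, m)"
      unfolding down_body_def by (rule exec_Seq[OF 1(1) exec_Seq[OF 2(1) exec_Seq[OF 3(1) 4(1)]]])
    show "r4 0 = rk (occ \<beta>) (c + st + i) - rk (occ \<beta>) (c + st)" "r4 1 = a'"
      using 4(3)[of 0] 4(3)[of 1] 3(3)[of 0] r20 r31 by auto
    show "t1 + (t2 + (t3 + t4)) \<le> down_cost off"
      using 1(5) 2(5) 3(5) 4(5) unfolding down_cost_def by linarith
  qed (rule r43 4(4))+
qed

text \<open>Select works on the whole vector, so the number of occurrences before the node, a rank
  at its first bit, is added to the local index beforehand.\<close>

lemma up_step:
  assumes ws: "word_state w (r, m)" and r: "r 0 = i" "r 1 = a'" "r 3 = a"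
    and off: "\<And>r. eval w r m off = c" "regs off = {}"
    and st: "m a = st" "c + st + i' < M" and a: "a + 2 < 2 ^ w" "a' + 3 < 2 ^ w"
    and \<beta>: "m (a' + 3) = \<beta>" "\<beta> < 2"
    and i: "occ \<beta> (c + st + i')" "i + rk (occ \<beta>) (c + st) = rk (occ \<beta>) (c + st + i')"
  obtains t r' where "exec w (up_body off) (r, m) t (r', m)"
    "r' 0 = i'" "r' 1 = a" "r' 3 = m (a + 2)"
    "word_state w (r', m)" "t \<le> up_cost off"
proof -
  let ?e1 = "Mem (add_e (V 1) (N 3))"
  let ?e3 = "sub_e (sel_e (V 2) (add_e (V 0) (rank_e (V 2) (node_pos_e off)))) (node_pos_e off)"
  let ?e4 = "Mem (add_e (V 1) (N 2))"
  have pw: "c + st + i' < 2 ^ w" by (rule less_word) (use st in simp)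
  have np: "eval w r' m (node_pos_e off) = c + st" if "r' 1 = a" for r'
    unfolding node_pos_e_def by (intro eval_add off) (use that st pw in auto)
  obtain t1 r1 where 1: "exec w (assign 2 ?e1) (r, m) t1 (r1, m)" "r1 2 = eval w r m ?e1"
    "\<And>k. k < 8 \<Longrightarrow> k \<noteq> 2 \<Longrightarrow> r1 k = r k" "word_state w (r1, m)" "t1 \<le> cost ?e1 + 1"
    by (rule exec_assign[OF ws, of ?e1 2]) auto
  have r12: "r1 2 = \<beta>" using 1(2) \<beta> r a small(5) by simp
  obtain t2 r2 where 2: "exec w (assign 1 (V 3)) (r1, m) t2 (r2, m)" "r2 1 = eval w r1 m (V 3)"
    "\<And>k. k < 8 \<Longrightarrow> k \<noteq> 1 \<Longrightarrow> r2 k = r1 k" "word_state w (r2, m)" "t2 \<le> cost (V 3) + 1"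
    by (rule exec_assign[OF 1(4), of "V 3" 1]) auto
  have r2: "r2 0 = i" "r2 1 = a" "r2 2 = \<beta>"
    using 2(2) 2(3)[of 0] 2(3)[of 2] 1(3)[of 0] 1(3)[of 3] r r12 by auto
  obtain t3 r3 where 3: "exec w (assign 0 ?e3) (r2, m) t3 (r3, m)" "r3 0 = eval w r2 m ?e3"
    "\<And>k. k < 8 \<Longrightarrow> k \<noteq> 0 \<Longrightarrow> r3 k = r2 k" "word_state w (r3, m)" "t3 \<le> cost ?e3 + 1"
    by (rule exec_assign[OF 2(4), of ?e3 0]) (auto simp: regs_rank_e regs_sel_e node_pos_e_def off)
  have sl: "s \<beta> (rk (occ \<beta>) (c + st + i')) = c + st + i'"
    by (rule sel_rk) (use st i in auto)
  have "rk (occ \<beta>) (c + st + i') < 2 ^ w" using rk_le[of "occ \<beta>" "c + st + i'"] pw by linarith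
  then have "eval w r2 m (add_e (V 0) (rank_e (V 2) (node_pos_e off))) = rk (occ \<beta>) (c + st + i')"
    unfolding i(2)[symmetric] using r2 st 2(4) \<beta> by (intro eval_add eval_rank np) auto
  then have "eval w r2 m (sel_e (V 2) (add_e (V 0) (rank_e (V 2) (node_pos_e off)))) = c + st + i'"
    by (subst eval_sel[OF _ \<beta>(2)]) (use r2 sl st 2(4) in auto)
  then have "eval w r2 m ?e3 = c + st + i' - (c + st)"
    by (intro eval_sub np) (use r2 pw in auto)
  then have r30: "r3 0 = i'" by (simp add: 3(2))
  have r31: "r3 1 = a" using 3(3)[of 1] r2 by simp
  obtain t4 r4 where 4: "exec w (assign 3 ?e4) (r3, m) t4 (r4, m)" "r4 3 = eval w r3 m ?e4"
    "\<And>k. k < 8 \<Longrightarrow> k \<noteq> 3 \<Longrightarrow> r4 k = r3 k" "word_state w (r4, m)" "t4 \<le> cost ?e4 + 1"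
    by (rule exec_assign[OF 3(4), of ?e4 3]) auto
  have r43: "r4 3 = m (a + 2)" unfolding 4(2) using r31 a small(5) by simp
  show ?thesis
  proof (rule that)
    show "exec w (up_body off) (r, m) (t1 + (t2 + (t3 + t4))) (r4, m)"
      unfolding up_body_def by (rule exec_Seq[OF 1(1) exec_Seq[OF 2(1) exec_Seq[OF 3(1) 4(1)]]])
    show "r4 0 = i'" "r4 1 = a"
      using 4(3)[of 0] 4(3)[of 1] r30 r31 by auto
    show "t1 + (t2 + (t3 + t4)) \<le> up_cost off"
      using 1(5) 2(5) 3(5) 4(5) unfolding up_cost_def by linarith
  qed (rule r43 4(4))+
qed

definition downto_at :: "exp \<Rightarrow> nat \<Rightarrow> nat \<Rightarrow> nat \<Rightarrow> nat \<Rightarrow> nat \<Rightarrow> bool" where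
  "downto_at off T i a i' a' \<longleftrightarrow> (\<forall>r. word_state w (r, m) \<and> r 0 = i \<and> r 1 = a \<and> r 3 = m (a + 1) \<longrightarrow>
     (\<exists>t r'. t \<le> T \<and> exec w (walk (down_body off)) (r, m) t (r', m) \<and> word_state w (r', m)
        \<and> r' 0 = i' \<and> r' 1 = a'))"

definition upto_root :: "exp \<Rightarrow> nat \<Rightarrow> nat \<Rightarrow> nat \<Rightarrow> nat \<Rightarrow> bool" where
  "upto_root off T i a v \<longleftrightarrow> (\<forall>r. word_state w (r, m) \<and> r 0 = i \<and> r 1 = a \<and> r 3 = m (a + 2) \<longrightarrow>
     (\<exists>t r'. t \<le> T \<and> exec w (walk (up_body off)) (r, m) t (r', m) \<and> word_state w (r', m)
        \<and> r' 0 = v))"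

text \<open>The ascent continues beyond the root of the subtree, so its part is phrased with a
  continuation: whatever result \<open>v\<close> an ascent from this node yields in time
  \<open>T\<close>, an ascent from the leaf yields it too, with the additional time for this
  subtree. The two walks meet in the leaf \<open>a'\<close> at the local index \<open>k\<close>,
  since the rank of an entry among its copies is preserved by all filtering.\<close>

lemma walk_through_tree:
  assumes off: "\<And>r. eval w r m off = c" "regs off = {}" "\<And>r. eval w r m off' = c'" "regs off' = {}"
  assumes "segment m a (records par side st a t L)" "0 < a" "a + 4 * nodes t \<le> 2 ^ w"
    and "mset L = mset L'" "set L \<subseteq> symbols t" "i < length L" "i' < length L'" "L ! i = L' ! i'"
    and "length (filter (\<lambda>y. y = L ! i) (take i L)) = length (filter (\<lambda>y. y = L ! i) (take i' L'))"
    and "\<And>j. j < length (tree_bits t L) \<Longrightarrow> X (c + st + j) = tree_bits t L ! j"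
    and "\<And>j. j < length (tree_bits t L') \<Longrightarrow> X (c' + st + j) = tree_bits t L' ! j"
    and "c + st + length (tree_bits t L) \<le> M" "c' + st + length (tree_bits t L) \<le> M"
  shows "\<exists>k a'. a' + 4 \<le> 2 ^ w \<and> downto_at off ((down_cost off + 1) * depth t (L ! i) + 1) i a k a' \<and>
    (\<forall>T v. upto_root off' T i' a v \<longrightarrow>
       upto_root off' (T + (up_cost off' + 1) * depth t (L ! i)) k a' v)"
  using assms(5-)
proof (induction t arbitrary: a par side st L L' i i')
  case (Sym x)
  have all: "\<And>y. y \<in> set L \<Longrightarrow> y = x" using Sym.prems by auto
  have "set L' = set L" using Sym.prems(4) by (metis set_mset_mset)
  then have all': "\<And>y. y \<in> set L' \<Longrightarrow> y = x" using all by auto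
  have Li: "L ! i = x" by (rule all[OF nth_mem[OF Sym.prems(6)]])
  \<comment> \<open>All entries at a leaf are equal, so the rank among equal entries is the index
    itself.\<close>
  have "filter (\<lambda>y. y = x) (take i L) = take i L" "filter (\<lambda>y. y = x) (take i' L') = take i' L'"
    using all all' by (auto simp: filter_id_conv dest: in_set_takeD)
  then have ii: "i = i'" using Sym.prems Li by simp
  have m1: "m (a + 1) = 0" using Sym.prems(1) by (simp add: segment_Cons)
  have "downto_at off 1 i a i a"
    unfolding downto_at_def walk_def
  proof (intro allI impI)
    fix r assume "word_state w (r, m) \<and> r 0 = i \<and> r 1 = a \<and> r 3 = m (a + 1)"
    then show "\<exists>t r'. t \<le> 1 \<and> exec w (While (Less (Imm 0) (Reg 3)) (down_body off)) (r, m) t (r', m) \<and>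
        word_state w (r', m) \<and> r' 0 = i \<and> r' 1 = a"
      using m1 by (intro exI[of _ 1] exI[of _ r] conjI exec_While_False) auto
  qed
  then show ?case using ii Sym.prems(3) by (intro exI[of _ i] exI[of _ a]) simp
next
  case (Fork l r)
  let ?x = "L ! i"
  define P where "P = (\<lambda>y. (y \<in> symbols r) = (?x \<in> symbols r))"
  define t where "t = (if ?x \<in> symbols r then r else l)"
  define \<beta> :: nat where "\<beta> = of_bool (?x \<in> symbols r)"
  define L1 where "L1 = filter P L"
  define L1' where "L1' = filter P L'"
  define L0 where "L0 = filter (\<lambda>y. y \<notin> symbols r) L"
  define L0' where "L0' = filter (\<lambda>y. y \<notin> symbols r) L'"
  define a1 where "a1 = (if ?x \<in> symbols r then a + 4 + 4 * nodes l else a + 4)"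
  define st1 where "st1 = (if ?x \<in> symbols r then st + length L + length (tree_bits l L0) else st + length L)"
  define k where "k = length (filter P (take i L))"
  define k' where "k' = length (filter P (take i' L'))"
  have len: "length L' = length L" using Fork.prems(4) by (metis size_mset)
  have ms0: "mset L0 = mset L0'" and ms1: "mset L1 = mset L1'"
    using Fork.prems(4) by (simp_all add: L0_def L0'_def L1_def L1'_def mset_filter)
  have lenb: "length (tree_bits t' L1) = length (tree_bits t' L1')" "length (tree_bits t' L0) = length (tree_bits t' L0')" for t'
    using ms0 ms1 by (auto intro: length_tree_bits_cong)
  have seg: "m a = st" "m (a + 1) = a + 4 + 4 * nodes l" "segment m a1 (records a \<beta> st1 a1 t L1)"
    using Fork.prems(1) unfolding P_def L1_def L0_def t_def a1_def st1_def \<beta>_def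
    by (auto simp: segment_Cons segment_append length_records numeral_eq_Suc)
  have bits: "X (c + st + j) = (L ! j \<in> symbols r)" "X (c' + st + j) = (L' ! j \<in> symbols r)"
    if "j < length L" for j
    using Fork.prems(10)[of j] Fork.prems(11)[of j] that len by (simp_all add: nth_append)
  have lenF: "length (tree_bits (Fork l r) L) = length L + length (tree_bits l L0)
      + length (tree_bits r (filter (\<lambda>y. y \<in> symbols r) L))"
    by (simp add: L0_def)
  have L1: "L1 = (if ?x \<in> symbols r then filter (\<lambda>y. y \<in> symbols r) L else L0)"
    "L1' = (if ?x \<in> symbols r then filter (\<lambda>y. y \<in> symbols r) L' else L0')"
    by (simp_all add: L1_def L1'_def P_def L0_def L0'_def)
  have F1: "0 < a1" by (simp add: a1_def)
  have F2: "a1 + 4 * nodes t \<le> 2 ^ w" using Fork.prems(3) by (simp add: a1_def t_def)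
  have F4: "set L1 \<subseteq> symbols t" using Fork.prems(5) by (auto simp: L1 L0_def t_def)
  have P: "P (L ! i)" "P (L' ! i')" using Fork.prems(8) by (simp_all add: P_def)
  have F5: "k < length L1" "k' < length L1'"
    unfolding k_def k'_def L1_def L1'_def
    using take_filter(3)[of i L P] take_filter(3)[of i' L' P] Fork.prems P by auto
  have x1: "L1 ! k = ?x" "L1' ! k' = ?x"
    unfolding k_def k'_def L1_def L1'_def
    using take_filter(2)[of i L P] take_filter(2)[of i' L' P] Fork.prems P by auto
  have tk: "take k L1 = filter P (take i L)" "take k' L1' = filter P (take i' L')"
    unfolding k_def k'_def L1_def L1'_def
    using take_filter(1)[of i L P] take_filter(1)[of i' L' P] Fork.prems P by auto
  \<comment> \<open>\<open>P\<close> keeps the entries on the side of \<open>?x\<close>, among them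
    all copies of \<open>?x\<close>; so ranks among copies survive the descent.\<close>
  have "filter (\<lambda>y. y = ?x) (filter P xs) = filter (\<lambda>y. y = ?x) xs" for xs
    using P by (induction xs) auto
  then have F7: "length (filter (\<lambda>y. y = L1 ! k) (take k L1)) = length (filter (\<lambda>y. y = L1 ! k) (take k' L1'))"
    using Fork.prems(9) by (simp add: tk x1)
  have F8: "X (c + st1 + j) = tree_bits t L1 ! j" if "j < length (tree_bits t L1)" for j
  proof (cases "?x \<in> symbols r")
    case True
    then show ?thesis
      using Fork.prems(10)[of "length L + length (tree_bits l L0) + j"] that
      by (simp add: nth_append L1 t_def st1_def L0_def add.assoc)
  next
    case False
    then show ?thesis
      using Fork.prems(10)[of "length L + j"] that
      by (simp add: nth_append L1 t_def st1_def L0_def add.assoc)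
  qed
  have F9: "X (c' + st1 + j) = tree_bits t L1' ! j" if "j < length (tree_bits t L1')" for j
  proof (cases "?x \<in> symbols r")
    case True
    then show ?thesis
      using Fork.prems(11)[of "length L + length (tree_bits l L0) + j"] that len lenb(2)[of l]
      by (simp add: nth_append L1 t_def st1_def L0'_def add.assoc)
  next
    case False
    then show ?thesis
      using Fork.prems(11)[of "length L + j"] that len
      by (simp add: nth_append L1 t_def st1_def L0'_def add.assoc)
  qed
  have st1: "st1 + length (tree_bits t L1) \<le> st + length (tree_bits (Fork l r) L)"
    unfolding lenF by (auto simp: st1_def t_def L1)
  have F10: "c + st1 + length (tree_bits t L1) \<le> M" "c' + st1 + length (tree_bits t L1) \<le> M"
    using st1 Fork.prems(12,13) by linarith+
  note F = seg(3) F1 F2 ms1 F4 F5 x1(1)[folded x1(2)] F7 F8 F9 F10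
  have "t = l \<or> t = r" by (simp add: t_def)
  then have "\<exists>kk aa. aa + 4 \<le> 2 ^ w \<and> downto_at off ((down_cost off + 1) * depth t (L1 ! k) + 1) k a1 kk aa \<and>
    (\<forall>T v. upto_root off' T k' a1 v \<longrightarrow>
       upto_root off' (T + (up_cost off' + 1) * depth t (L1 ! k)) kk aa v)"
  proof
    assume t: "t = l"
    show ?thesis unfolding t by (rule Fork.IH(1)[OF F[unfolded t]])
  next
    assume t: "t = r"
    show ?thesis unfolding t by (rule Fork.IH(2)[OF F[unfolded t]])
  qed
  then obtain kk aa where aa: "aa + 4 \<le> 2 ^ w" and down: "downto_at off ((down_cost off + 1) * depth t ?x + 1) k a1 kk aa"
    and up: "\<And>T v. upto_root off' T k' a1 v \<Longrightarrow> upto_root off' (T + (up_cost off' + 1) * depth t ?x) kk aa v"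
    unfolding x1 by blast
  have d: "depth (Fork l r) ?x = Suc (depth t ?x)" by (simp add: t_def)
  have stL: "c + st + i < M" "c' + st + i' < M"
    using Fork.prems(6,7,12,13) len by auto
  have occ: "occ \<beta> (c + st + j) = P (L ! j)" "occ \<beta> (c' + st + j) = P (L' ! j)" if "j < length L" for j
    using bits[OF that] by (simp_all add: occ_def \<beta>_def P_def)
  have rk: "rk (occ \<beta>) (c + st + i) = rk (occ \<beta>) (c + st) + k"
    unfolding rk_add k_def using Fork.prems(6) occ by (subst rk_eq_filter[of i L _ P]) auto
  have rk': "rk (occ \<beta>) (c' + st + i') = rk (occ \<beta>) (c' + st) + k'"
    unfolding rk_add k'_def using Fork.prems(7) occ len by (subst rk_eq_filter[of i' L' _ P]) auto
  have a1w: "a1 + 4 \<le> 2 ^ w" using F2 nodes_pos[of t] by linarith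
  have aw: "a + 8 \<le> 2 ^ w" using Fork.prems(3) nodes_pos[of l] by simp
  have rec1: "m (a1 + 2) = a" "m (a1 + 3) = \<beta>" using segment_records[OF seg(3)] by auto
  have "downto_at off ((down_cost off + 1) * Suc (depth t ?x) + 1) i a kk aa"
    unfolding downto_at_def
  proof (intro allI impI)
    fix r0 assume r0: "word_state w (r0, m) \<and> r0 0 = i \<and> r0 1 = a \<and> r0 3 = m (a + 1)"
    obtain t1 r1 where 1: "exec w (down_body off) (r0, m) t1 (r1, m)"
      "r1 0 = rk (occ \<beta>) (c + st + i) - rk (occ \<beta>) (c + st)" "r1 1 = a1" "r1 3 = m (a1 + 1)"
      "word_state w (r1, m)" "t1 \<le> down_cost off"
      by (rule down_step[of r0 i a off c st \<beta> a1])
        (use r0 off(1,2) seg stL aw a1w bits(1)[OF Fork.prems(6)] in \<open>auto simp: \<beta>_def a1_def\<close>)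
    have "r1 0 = k" using 1(2) rk by simp
    then obtain t2 r2 where 2: "t2 \<le> (down_cost off + 1) * depth t ?x + 1"
      "exec w (walk (down_body off)) (r1, m) t2 (r2, m)" "word_state w (r2, m)" "r2 0 = kk" "r2 1 = aa"
      using down 1 unfolding downto_at_def by blast
    have "exec w (walk (down_body off)) (r0, m) (1 + t1 + t2) (r2, m)"
      unfolding walk_def
      by (rule exec_While_True[OF _ 1(1) 2(2)[unfolded walk_def]]) (use r0 seg(2) in simp)
    moreover have "1 + t1 + t2 \<le> (down_cost off + 1) * Suc (depth t ?x) + 1"
      using 1(6) 2(1) by simp
    ultimately show "\<exists>t' r'. t' \<le> (down_cost off + 1) * Suc (depth t ?x) + 1 \<and>
        exec w (walk (down_body off)) (r0, m) t' (r', m) \<and> word_state w (r', m) \<and> r' 0 = kk \<and> r' 1 = aa"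
      using 2 by blast
  qed
  moreover have "upto_root off' (T + (up_cost off' + 1) * Suc (depth t ?x)) kk aa v"
    if T: "upto_root off' T i' a v" for T v
  proof -
    \<comment> \<open>One iteration leads from the child to this node; the induction hypothesis then
      extends the walk down to the leaf. The loop test passes because the address \<open>a\<close>
      of the parent is positive.\<close>
    have "upto_root off' (T + (up_cost off' + 1)) k' a1 v"
      unfolding upto_root_def
    proof (intro allI impI)
      fix r0 assume r0: "word_state w (r0, m) \<and> r0 0 = k' \<and> r0 1 = a1 \<and> r0 3 = m (a1 + 2)"
      obtain t1 r1 where 1: "exec w (up_body off') (r0, m) t1 (r1, m)"
        "r1 0 = i'" "r1 1 = a" "r1 3 = m (a + 2)" "word_state w (r1, m)" "t1 \<le> up_cost off'"
        by (rule up_step[of r0 k' a1 a off' c' st i' \<beta>])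
          (use r0 off(3,4) seg stL aw a1w rec1 rk' occ(2)[of i'] P len Fork.prems(7) in \<open>auto simp: \<beta>_def\<close>)
      then obtain t2 r2 where 2: "t2 \<le> T"
        "exec w (walk (up_body off')) (r1, m) t2 (r2, m)" "word_state w (r2, m)" "r2 0 = v"
        using T unfolding upto_root_def by blast
      have "exec w (walk (up_body off')) (r0, m) (1 + t1 + t2) (r2, m)"
        unfolding walk_def
        by (rule exec_While_True[OF _ 1(1) 2(2)[unfolded walk_def]]) (use r0 rec1 Fork.prems(2) in simp)
      moreover have "1 + t1 + t2 \<le> T + (up_cost off' + 1)" using 1(6) 2(1) by simp
      ultimately show "\<exists>t' r'. t' \<le> T + (up_cost off' + 1) \<and>
          exec w (walk (up_body off')) (r0, m) t' (r', m) \<and> word_state w (r', m) \<and> r' 0 = v"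
        using 2 by blast
    qed
    from up[OF this] show ?thesis by (simp add: algebra_simps)
  qed
  ultimately show ?case unfolding d using aa by blast
qed

lemma exec_query:
  assumes off: "\<And>r. eval w r m off = c" "regs off = {}" "\<And>r. eval w r m off' = c'" "regs off' = {}"
  assumes "segment m a (records 0 side 0 a t L)" "0 < a" "a + 4 * nodes t \<le> 2 ^ w" "m 2 = a"
    and "mset L = mset L'" "set L \<subseteq> symbols t" "i < length L" "i' < length L'" "L ! i = L' ! i'"
    and "length (filter (\<lambda>y. y = L ! i) (take i L)) = length (filter (\<lambda>y. y = L ! i) (take i' L'))"
    and "\<And>j. j < length (tree_bits t L) \<Longrightarrow> X (c + j) = tree_bits t L ! j"
    and "\<And>j. j < length (tree_bits t L') \<Longrightarrow> X (c' + j) = tree_bits t L' ! j"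
    and "c + length (tree_bits t L) \<le> M" "c' + length (tree_bits t L) \<le> M"
    and r: "word_state w (r, m)" "r 0 = i + 1" and i': "i' + 1 < 2 ^ w"
  shows "\<exists>t' r'. t' \<le> (down_cost off + up_cost off' + 2) * depth t (L ! i) + 23 \<and>
    exec w (query off off') (r, m) t' (r', m) \<and> r' 0 = i' + 1"
proof -
  let ?d = "depth t (L ! i)"
  have aw: "a + 4 \<le> 2 ^ w" using assms(7) nodes_pos[of t] by linarith
  have "upto_root off' 1 i' a i'"
    unfolding upto_root_def walk_def
  proof (intro allI impI)
    fix r assume "word_state w (r, m) \<and> r 0 = i' \<and> r 1 = a \<and> r 3 = m (a + 2)"
    then show "\<exists>t r'. t \<le> 1 \<and> exec w (While (Less (Imm 0) (Reg 3)) (up_body off')) (r, m) t (r', m) \<and>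
        word_state w (r', m) \<and> r' 0 = i'"
      using segment_records[OF assms(5)] by (intro exI[of _ 1] exI[of _ r] conjI exec_While_False) auto
  qed
  moreover have "\<exists>k b'. b' + 4 \<le> 2 ^ w \<and> downto_at off ((down_cost off + 1) * ?d + 1) i a k b' \<and>
    (\<forall>T v. upto_root off' T i' a v \<longrightarrow> upto_root off' (T + (up_cost off' + 1) * ?d) k b' v)"
    by (rule walk_through_tree[OF off assms(5-7) assms(9-14)]) (use assms(15-18) in auto)
  ultimately obtain k b' where b': "b' + 4 \<le> 2 ^ w"
    and down: "downto_at off ((down_cost off + 1) * ?d + 1) i a k b'"
    and up: "upto_root off' (1 + (up_cost off' + 1) * ?d) k b' i'"
    by blast
  have "r 0 < 2 ^ w" using r(1) by (simp add: word_state_def)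
  then have iw: "i + 1 < 2 ^ w" by (simp add: r(2))
  have w0: "w \<noteq> 0" using small(1) pos(1) by linarith
  let ?e1 = "sub_e (V 0) (N 1)" and ?e2 = "Mem (N 2)" and ?e3 = "Mem (add_e (V 1) (N 1))"
  let ?e5 = "Mem (add_e (V 1) (N 2))" and ?e7 = "add_e (V 0) (N 1)"
  obtain t1 r1 where 1: "exec w (assign 0 ?e1) (r, m) t1 (r1, m)" "r1 0 = eval w r m ?e1"
    "word_state w (r1, m)" "t1 \<le> cost ?e1 + 1"
    by (rule exec_assign[OF r(1), of ?e1 0]) auto
  have "eval w r m ?e1 = i + 1 - 1" by (intro eval_sub eval_N) (use r iw w0 in auto)
  then have r1: "r1 0 = i" using 1(2) by simp
  obtain t2 r2 where 2: "exec w (assign 1 ?e2) (r1, m) t2 (r2, m)" "r2 1 = eval w r1 m ?e2"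
    "\<And>k. k < 8 \<Longrightarrow> k \<noteq> 1 \<Longrightarrow> r2 k = r1 k" "word_state w (r2, m)" "t2 \<le> cost ?e2 + 1"
    by (rule exec_assign[OF 1(3), of ?e2 1]) auto
  have r2: "r2 0 = i" "r2 1 = a" using 2(2,3) r1 assms(8) small(5) by auto
  obtain t3 r3 where 3: "exec w (assign 3 ?e3) (r2, m) t3 (r3, m)" "r3 3 = eval w r2 m ?e3"
    "\<And>k. k < 8 \<Longrightarrow> k \<noteq> 3 \<Longrightarrow> r3 k = r2 k" "word_state w (r3, m)" "t3 \<le> cost ?e3 + 1"
    by (rule exec_assign[OF 2(4), of ?e3 3]) auto
  have r3: "r3 0 = i" "r3 1 = a" "r3 3 = m (a + 1)"
    using 3(2) 3(3)[of 0] 3(3)[of 1] r2 aw w0 by auto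
  obtain t4 r4 where 4: "t4 \<le> (down_cost off + 1) * ?d + 1"
    "exec w (walk (down_body off)) (r3, m) t4 (r4, m)" "word_state w (r4, m)" "r4 0 = k" "r4 1 = b'"
    using down 3(4) r3 unfolding downto_at_def by blast
  obtain t5 r5 where 5: "exec w (assign 3 ?e5) (r4, m) t5 (r5, m)" "r5 3 = eval w r4 m ?e5"
    "\<And>k. k < 8 \<Longrightarrow> k \<noteq> 3 \<Longrightarrow> r5 k = r4 k" "word_state w (r5, m)" "t5 \<le> cost ?e5 + 1"
    by (rule exec_assign[OF 4(3), of ?e5 3]) auto
  have r5: "r5 0 = k" "r5 1 = b'" "r5 3 = m (b' + 2)"
    using 5(2) 5(3)[of 0] 5(3)[of 1] 4 b' small(5) by auto
  obtain t6 r6 where 6: "t6 \<le> 1 + (up_cost off' + 1) * ?d"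
    "exec w (walk (up_body off')) (r5, m) t6 (r6, m)" "word_state w (r6, m)" "r6 0 = i'"
    using up 5(4) r5 unfolding upto_root_def by blast
  obtain t7 r7 where 7: "exec w (assign 0 ?e7) (r6, m) t7 (r7, m)" "r7 0 = eval w r6 m ?e7"
    "word_state w (r7, m)" "t7 \<le> cost ?e7 + 1"
    by (rule exec_assign[OF 6(3), of ?e7 0]) auto
  have r7: "r7 0 = i' + 1" using 7(2) 6(4) i' w0 by simp
  have ex: "exec w (query off off') (r, m) (t1 + (t2 + (t3 + (t4 + (t5 + (t6 + t7)))))) (r7, m)"
    unfolding query_def
    by (rule exec_Seq[OF 1(1) exec_Seq[OF 2(1) exec_Seq[OF 3(1) exec_Seq[OF 4(2)
      exec_Seq[OF 5(1) exec_Seq[OF 6(2) 7(1)]]]]]])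
  \<comment> \<open>The five assignments take at most 21 steps, the final tests of the two loops 2
    more.\<close>
  have "t1 + (t2 + (t3 + (t4 + (t5 + (t6 + t7))))) \<le> (down_cost off + up_cost off' + 2) * ?d + 23"
    using 1(4) 2(5) 3(5) 4(1) 5(5) 6(1) 7(4) by (simp add: algebra_simps)
  then show ?thesis using ex r7 by blast
qed

end

section \<open>Codes of logarithmic depth\<close>

text \<open>Take a smallest subset \<open>Q\<close> of sum at least 1/2, and in it an element
  \<open>q\<close> of maximal length. Without \<open>q\<close> the sum is below 1/2, and both
  numbers are multiples of \<open>(1 / 2) ^ len q\<close>, so adding this amount back cannot
  overshoot 1/2.\<close>

lemma kraft_half_subset:
  fixes len :: "'a \<Rightarrow> nat"
  assumes "finite P" "\<And>x. x \<in> P \<Longrightarrow> 1 \<le> len x" "1 / 2 \<le> (\<Sum>x\<in>P. (1 / 2 :: real) ^ len x)"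
  shows "\<exists>Q\<subseteq>P. (\<Sum>x\<in>Q. (1 / 2 :: real) ^ len x) = 1 / 2"
proof -
  let ?S = "\<lambda>Q. \<Sum>x\<in>Q. (1 / 2 :: real) ^ len x"
  define Q where "Q = (ARG_MIN card Q. Q \<subseteq> P \<and> 1 / 2 \<le> ?S Q)"
  have Q: "Q \<subseteq> P" "1 / 2 \<le> ?S Q" and minQ: "\<And>R. R \<subseteq> P \<Longrightarrow> 1 / 2 \<le> ?S R \<Longrightarrow> card Q \<le> card R"
    using arg_min_nat_lemma[of "\<lambda>Q. Q \<subseteq> P \<and> 1 / 2 \<le> ?S Q" P card] assms(3) by (auto simp: Q_def)
  have fin: "finite Q" using Q(1) assms(1) by (rule finite_subset)
  have "Q \<noteq> {}" using Q(2) by auto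
  then have "Max (len ` Q) \<in> len ` Q" using fin by (intro Max_in) auto
  then obtain q where q: "q \<in> Q" "\<And>x. x \<in> Q \<Longrightarrow> len x \<le> len q"
    using fin by (auto simp: eq_commute[of "Max _"] intro!: that)
  have "\<not> 1 / 2 \<le> ?S (Q - {q})"
  proof
    assume "1 / 2 \<le> ?S (Q - {q})"
    then have "card Q \<le> card (Q - {q})" using Q(1) by (intro minQ) auto
    moreover have "card (Q - {q}) < card Q" by (rule card_Diff1_less[OF fin q(1)])
    ultimately show False by simp
  qed
  then have lt: "?S (Q - {q}) < 1 / 2" by simp
  \<comment> \<open>The sum without \<open>q\<close>, counted in units of
    \<open>(1 / 2) ^ len q\<close>.\<close>
  define N :: nat where "N = (\<Sum>x\<in>Q - {q}. 2 ^ (len q - len x))"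
  have "real N = (\<Sum>x\<in>Q - {q}. 2 ^ len q * (1 / 2) ^ len x)"
    unfolding N_def of_nat_sum
  proof (intro sum.cong refl)
    fix x assume "x \<in> Q - {q}"
    then show "real (2 ^ (len q - len x)) = 2 ^ len q * (1 / 2) ^ len x"
      using q(2)[of x] power_diff[of "2::real" "len x" "len q"] by (simp add: power_one_over)
  qed
  then have N: "real N = 2 ^ len q * ?S (Q - {q})" by (simp add: sum_distrib_left)
  have lq: "1 \<le> len q" using assms(2) q(1) Q(1) by auto
  have "real N < 2 ^ len q * (1 / 2)" unfolding N using lt by simp
  also have "\<dots> = real (2 ^ (len q - 1))" using lq by (cases "len q") auto
  finally have "N < 2 ^ (len q - 1)" by (simp only: of_nat_less_iff)
  then have "N + 1 \<le> 2 ^ (len q - 1)" by simp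
  then have "real (N + 1) \<le> real (2 ^ (len q - 1))" by (simp only: of_nat_le_iff)
  also have "\<dots> = 2 ^ len q * (1 / 2)" using lq by (cases "len q") auto
  finally have "2 ^ len q * ?S (Q - {q}) + 1 \<le> 2 ^ len q * (1 / 2)" using N by simp
  then have "?S (Q - {q}) + (1 / 2) ^ len q \<le> 1 / 2"
    by (simp add: field_simps)
  moreover have "?S Q = (1 / 2) ^ len q + ?S (Q - {q})" by (rule sum.remove[OF fin q(1)])
  ultimately have "?S Q = 1 / 2" using Q(2) by linarith
  then show ?thesis using Q(1) by blast
qed

text \<open>The symbols are split into two nonempty parts of Kraft sum at most 1/2, and each part is
  coded with all lengths reduced by 1. The exact number of nodes later bounds the size of the
  records.\<close>

lemma kraft_code:
  fixes len :: "'a \<Rightarrow> nat"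
  assumes "finite P" "P \<noteq> {}" "(\<Sum>x\<in>P. (1 / 2 :: real) ^ len x) \<le> 1"
  shows "\<exists>t. symbols t = P \<and> nodes t + 1 = 2 * card P \<and> (\<forall>x\<in>P. depth t x \<le> len x)"
  using assms
proof (induction "card P" arbitrary: P len rule: less_induct)
  case less
  let ?S = "\<lambda>Q. \<Sum>x\<in>Q. (1 / 2 :: real) ^ len x"
  show ?case
  proof (cases "\<exists>x. P = {x}")
    case True
    then obtain x where "P = {x}" by blast
    then show ?thesis by (intro exI[of _ "Sym x"]) simp
  next
    case False
    \<comment> \<open>A codeword of length 0 would use up the whole sum by itself.\<close>
    have len: "1 \<le> len x" if "x \<in> P" for x
    proof (rule ccontr)
      assume "\<not> 1 \<le> len x"
      have "P - {x} \<noteq> {}" using False that by blast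
      then have "0 < ?S (P - {x})" using less.prems(1) by (intro sum_pos) auto
      moreover have "?S P = (1 / 2) ^ len x + ?S (P - {x})"
        by (rule sum.remove[OF less.prems(1) that])
      moreover have "(1 / 2 :: real) ^ len x = 1" using \<open>\<not> 1 \<le> len x\<close> by (simp add: not_le)
      ultimately show False using less.prems(3) by linarith
    qed
    have "\<exists>Q\<subseteq>P. Q \<noteq> {} \<and> P - Q \<noteq> {} \<and> ?S Q \<le> 1 / 2 \<and> ?S (P - Q) \<le> 1 / 2"
    \<comment> \<open>With a total of at most 1/2 any single symbol can be split off; otherwise one
      part is chosen to have sum exactly 1/2.\<close>
    proof (cases "?S P \<le> 1 / 2")
      case True
      obtain x where x: "x \<in> P" using less.prems(2) by blast
      have s: "?S P = (1 / 2) ^ len x + ?S (P - {x})" by (rule sum.remove[OF less.prems(1) x])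
      have "(1 / 2 :: real) ^ len x \<ge> 0" "?S (P - {x}) \<ge> 0" by (auto intro: sum_nonneg)
      then have "(1 / 2) ^ len x \<le> (1/2::real)" "?S (P - {x}) \<le> 1 / 2" using s True by linarith+
      moreover have "P - {x} \<noteq> {}" using x False by blast
      ultimately show ?thesis using x by (intro exI[of _ "{x}"]) simp
    next
      case gt: False
      then have "1 / 2 \<le> ?S P" by simp
      from kraft_half_subset[of P len, OF less.prems(1) len this]
      obtain Q where Q: "Q \<subseteq> P" "?S Q = 1 / 2" by blast
      have "?S P = ?S (P - Q) + ?S Q" by (rule sum.subset_diff[OF Q(1) less.prems(1)])
      then have "?S (P - Q) \<noteq> 0" "?S (P - Q) \<le> 1 / 2" using Q(2) gt less.prems(3) by linarith+
      moreover from this(1) have "P - Q \<noteq> {}" by (intro notI) simp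
      moreover have "Q \<noteq> {}" using Q(2) by auto
      ultimately show ?thesis using Q by (intro exI[of _ Q]) simp
    qed
    then obtain Q where Q: "Q \<subseteq> P" "Q \<noteq> {}" "P - Q \<noteq> {}" "?S Q \<le> 1 / 2" "?S (P - Q) \<le> 1 / 2"
      by blast
    have IH: "\<exists>t. symbols t = R \<and> nodes t + 1 = 2 * card R \<and> (\<forall>x\<in>R. depth t x \<le> len x - 1)"
      if "R \<subset> P" "R \<noteq> {}" "?S R \<le> 1 / 2" for R
    proof (rule less.hyps)
      show "card R < card P" using that less.prems(1) by (simp add: psubset_card_mono)
      show "finite R" using that less.prems(1) by (meson finite_subset psubset_imp_subset)
      have "(\<Sum>x\<in>R. (1 / 2 :: real) ^ (len x - 1)) = (\<Sum>x\<in>R. 2 * (1 / 2) ^ len x)"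
      proof (intro sum.cong refl)
        fix x assume "x \<in> R"
        then have "1 \<le> len x" using len that(1) by auto
        then show "(1 / 2 :: real) ^ (len x - 1) = 2 * (1 / 2) ^ len x"
          by (cases "len x") auto
      qed
      also have "\<dots> = 2 * ?S R" by (simp add: sum_distrib_left)
      finally show "(\<Sum>x\<in>R. (1 / 2 :: real) ^ (len x - 1)) \<le> 1" using that(3) by simp
    qed (rule that)
    obtain l where l: "symbols l = Q" "nodes l + 1 = 2 * card Q" "\<forall>x\<in>Q. depth l x \<le> len x - 1"
      using IH[of Q] Q by blast
    obtain r where r: "symbols r = P - Q" "nodes r + 1 = 2 * card (P - Q)"
        "\<forall>x\<in>P - Q. depth r x \<le> len x - 1"
      using IH[of "P - Q"] Q by blast
    have "card P = card Q + card (P - Q)"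
      using card_Un_disjoint[of Q "P - Q"] Q(1) less.prems(1) finite_subset[OF Q(1)]
      by (simp add: Un_absorb1)
    moreover have "depth (Fork l r) x \<le> len x" if "x \<in> P" for x
    proof (cases "x \<in> P - Q")
      case True
      then have "depth r x \<le> len x - 1" using r(3) by blast
      then show ?thesis using len[OF that] True r(1) by simp
    next
      case False
      then have "depth l x \<le> len x - 1" using l(3) that by blast
      moreover have "x \<notin> symbols r" using False r(1) by simp
      ultimately show ?thesis using len[OF that] by simp
    qed
    moreover have "symbols (Fork l r) = P" using l(1) r(1) Q(1) by auto
    moreover have "nodes (Fork l r) + 1 = 2 * (card Q + card (P - Q))" using l(2) r(2) by simp
    ultimately show ?thesis by (metis (no_types))
  qed
qed

text \<open>The chord of a convex function over the unit interval lies above its graph. This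
  converts excess codeword length into missing Kraft sum.\<close>

lemma half_powr_le:
  fixes x :: real
  assumes "0 \<le> x" "x \<le> 1"
  shows "(1 / 2) powr x \<le> 1 - x / 2"
proof -
  have "exp ((1 - x) *\<^sub>R 0 + x *\<^sub>R (- ln 2)) \<le> (1 - x) * exp 0 + x * exp (- ln 2 :: real)"
    using assms by (intro convex_onD[OF exp_convex]) auto
  then show ?thesis by (simp add: powr_def exp_minus ln_div field_simps)
qed

text \<open>
  The lengths are those of the Shannon code, cut off at \<open>L = 2 lg \<sigma> + O(1)\<close>.  If this violates
  Kraft's inequality, the code has hardly any redundancy, and it suffices to extend a single
  codeword, of a symbol of probability at most \<open>1 / 2\<close>.
\<close>

lemma code_lengths:
  fixes p :: "'a \<Rightarrow> real"
  assumes "finite P" "2 \<le> card P" "\<And>x. x \<in> P \<Longrightarrow> 0 < p x" "(\<Sum>x\<in>P. p x) = 1"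
  shows "\<exists>len :: 'a \<Rightarrow> nat. (\<Sum>x\<in>P. (1 / 2 :: real) ^ len x) \<le> 1 \<and>
    (\<Sum>x\<in>P. p x * real (len x)) \<le> 1 + (\<Sum>x\<in>P. p x * log 2 (1 / p x)) \<and>
    (\<forall>x\<in>P. real (len x) \<le> 2 * log 2 (real (card P)) + 6)"
proof -
  define \<sigma> where "\<sigma> = card P"
  have \<sigma>: "2 \<le> \<sigma>" "1 \<le> log 2 (real \<sigma>)" using assms(2) by (auto simp: \<sigma>_def)
  \<comment> \<open>Chosen so that the codewords that are cut off, at most \<sigma> in number,
    contribute at most \<open>\<eta> \<le> 1 / (8 * \<sigma>)\<close> to the Kraft sum.\<close>
  define L :: nat where "L = 2 * nat \<lceil>log 2 (real \<sigma>)\<rceil> + 3"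
  define sh where "sh = (\<lambda>x. nat \<lceil>log 2 (1 / p x)\<rceil>)"
  define len where "len = (\<lambda>x. min (sh x) L)"
  define G where "G = {x \<in> P. sh x \<le> L}"
  let ?K = "\<lambda>A. \<Sum>x\<in>A. (1 / 2 :: real) ^ len x"
  define \<eta> where "\<eta> = real \<sigma> * (1 / 2) ^ L"
  have fG: "finite G" "G \<subseteq> P" using assms(1) by (auto simp: G_def)
  have p1: "p x + p y \<le> 1" if "x \<in> P" "y \<in> P" "x \<noteq> y" for x y
  proof -
    have "(\<Sum>x\<in>{x, y}. p x) \<le> (\<Sum>x\<in>P. p x)"
      using assms(1) that by (intro sum_mono2) (auto intro: less_imp_le assms(3))
    then show ?thesis using that assms(4) by simp
  qed
  have plt: "p x < 1" if "x \<in> P" for x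
  proof -
    have "\<exists>y\<in>P. y \<noteq> x"
    proof (rule ccontr)
      assume "\<not> (\<exists>y\<in>P. y \<noteq> x)"
      then have "P \<subseteq> {x}" by blast
      then have "card P \<le> 1" using card_mono[of "{x}" P] by simp
      then show False using assms(2) by simp
    qed
    then show ?thesis using p1[OF that] assms(3) by force
  qed
  have logp: "0 < log 2 (1 / p x)" if "x \<in> P" for x using plt[OF that] assms(3)[OF that] by simp
  have shr: "real (sh x) < log 2 (1 / p x) + 1" "log 2 (1 / p x) \<le> real (sh x)" "1 \<le> sh x" if "x \<in> P" for x
  proof -
    have "0 < \<lceil>log 2 (1 / p x)\<rceil>" using logp[OF that] by simp
    then have "real (sh x) = of_int \<lceil>log 2 (1 / p x)\<rceil>" "1 \<le> sh x" unfolding sh_def by linarith+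
    then show "real (sh x) < log 2 (1 / p x) + 1" "log 2 (1 / p x) \<le> real (sh x)" "1 \<le> sh x"
      by linarith+
  qed
  have half: "(1 / 2 :: real) ^ sh x = p x * (1 / 2) powr (real (sh x) - log 2 (1 / p x))" if "x \<in> P" for x
  proof -
    have "(1 / 2) powr (log 2 (1 / p x)) = p x"
      using assms(3)[OF that] by (simp add: powr_divide)
    then show ?thesis using assms(3)[OF that]
      by (simp add: powr_diff powr_realpow[symmetric])
  qed
  have half_le: "(1 / 2 :: real) ^ sh x \<le> p x" if "x \<in> P" for x
    unfolding half[OF that] using shr[OF that] assms(3)[OF that]
    by (intro mult_left_le) (auto simp: powr_le1)
  have Lr: "2 * log 2 (real \<sigma>) + 3 \<le> real L" "real L < 2 * log 2 (real \<sigma>) + 5"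
  proof -
    have "0 \<le> \<lceil>log 2 (real \<sigma>)\<rceil>" using \<sigma> by linarith
    then show "2 * log 2 (real \<sigma>) + 3 \<le> real L" "real L < 2 * log 2 (real \<sigma>) + 5"
      unfolding L_def using \<sigma> by (simp_all) linarith+
  qed
  have "(2::real) powr (2 * log 2 (real \<sigma>) + 3) \<le> 2 powr real L" using Lr by simp
  moreover have "(2::real) powr (2 * log 2 (real \<sigma>) + 3) = real \<sigma> ^ 2 * 8"
  proof -
    have "(2::real) powr log 2 (real \<sigma>) = real \<sigma>" "(2::real) powr 3 = 8" using \<sigma> by simp_all
    then show ?thesis by (simp only: mult_2 powr_add power2_eq_square)
  qed
  ultimately have L8: "8 * real \<sigma> ^ 2 \<le> 2 ^ L" by (simp add: powr_realpow mult.commute)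
  have \<eta>8: "\<eta> \<le> 1 / (8 * real \<sigma>)"
    using L8 \<sigma> by (simp add: \<eta>_def field_simps power2_eq_square)
  have \<eta>16: "\<eta> \<le> 1 / 16" 
  proof -
    have "1 / (8 * real \<sigma>) \<le> 1 / 16" using \<sigma> by (simp add: field_simps)
    then show ?thesis using \<eta>8 by linarith
  qed
  show ?thesis
  proof (cases "?K P \<le> 1")
    case True
    have "(\<Sum>x\<in>P. p x * real (len x)) \<le> (\<Sum>x\<in>P. p x * (1 + log 2 (1 / p x)))"
    proof (intro sum_mono mult_left_mono)
      fix x assume "x \<in> P"
      then show "real (len x) \<le> 1 + log 2 (1 / p x)" "0 \<le> p x"
        using shr[of x] assms(3)[of x] by (auto simp: len_def min_def)
    qed
    also have "\<dots> = 1 + (\<Sum>x\<in>P. p x * log 2 (1 / p x))"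
      by (simp add: distrib_left sum.distrib assms(4))
    finally show ?thesis
      using True Lr by (intro exI[of _ len]) (auto simp: len_def \<sigma>_def)
  next
    case False
    have KG: "?K G = (\<Sum>x\<in>G. (1 / 2) ^ sh x)" by (rule sum.cong) (auto simp: G_def len_def)
    have "?K (P - G) \<le> (\<Sum>x\<in>P - G. (1 / 2) ^ L)" by (rule sum_mono) (auto simp: G_def len_def)
    also have "\<dots> = real (card (P - G)) * (1 / 2) ^ L" by simp
    also have "\<dots> \<le> \<eta>" unfolding \<eta>_def \<sigma>_def
      using assms(1) by (intro mult_right_mono) (auto intro: card_mono)
    finally have KPG: "?K (P - G) \<le> \<eta>" .
    have KP: "?K P = ?K (P - G) + ?K G" by (rule sum.subset_diff[OF fG(2) assms(1)])
    have KG1: "1 - \<eta> < ?K G" using False KP KPG by linarith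
    have pG: "(\<Sum>x\<in>G. p x) \<le> 1"
      unfolding assms(4)[symmetric] using assms fG by (intro sum_mono2) (auto intro: less_imp_le)
    have KG2: "?K G \<le> 1"
    proof -
      have "?K G \<le> (\<Sum>x\<in>G. p x)" unfolding KG using half_le fG by (intro sum_mono) auto
      then show ?thesis using pG by linarith
    qed
    \<comment> \<open>\<open>x0\<close> is a symbol of maximal probability, so every other symbol
      has probability at most 1/2.\<close>
    have "P \<noteq> {}" using assms(2) by auto
    then have "Max (p ` P) \<in> p ` P" using assms(1) by (intro Max_in) auto
    then obtain x0 where x0: "x0 \<in> P" "\<And>x. x \<in> P \<Longrightarrow> p x \<le> p x0"
      using assms(1) by (auto simp: eq_commute[of "Max _"] intro!: that)
    have "(1 / 2 :: real) ^ sh x0 \<le> (1 / 2) ^ 1" using shr(3)[OF x0(1)] by (intro power_decreasing) auto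
    then have "?K G - 1 / 2 \<le> ?K (G - {x0})"
      unfolding sum_diff1[OF fG(1)] by (auto simp: G_def len_def)
    then have K0: "1 / 4 \<le> ?K (G - {x0})" using KG1 \<eta>16 by linarith
    \<comment> \<open>The sum over \<open>G - {x0}\<close> is at least 1/4, so one of its at most
      \<sigma> terms reaches \<open>1 / (4 * \<sigma>)\<close>. Lengthening that codeword by 1 frees
      half of it, which covers the excess \<open>\<eta>\<close>.\<close>
    have "\<exists>y\<in>G - {x0}. 1 / (4 * real \<sigma>) \<le> (1 / 2) ^ len y"
    proof (rule ccontr)
      assume "\<not> ?thesis"
      then have *: "\<And>y. y \<in> G - {x0} \<Longrightarrow> (1 / 2) ^ len y < 1 / (4 * real \<sigma>)" by force
      have ne: "G - {x0} \<noteq> {}" using K0 by (metis sum.empty not_one_le_zero divide_le_0_1_iff zero_less_numeral not_less)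
      have "?K (G - {x0}) < (\<Sum>y\<in>G - {x0}. 1 / (4 * real \<sigma>))"
        using * fG ne by (intro sum_strict_mono) auto
      also have "\<dots> = real (card (G - {x0})) * (1 / (4 * real \<sigma>))" by simp
      also have "\<dots> \<le> real \<sigma> * (1 / (4 * real \<sigma>))"
        unfolding \<sigma>_def using fG assms(1) by (intro mult_right_mono) (auto intro!: card_mono)
      also have "\<dots> = 1 / 4" using \<sigma> by simp
      finally show False using K0 by simp
    qed
    then obtain y where y: "y \<in> G" "y \<noteq> x0" "1 / (4 * real \<sigma>) \<le> (1 / 2) ^ len y" by blast
    have yP: "y \<in> P" using y(1) fG by auto
    have py: "p y \<le> 1 / 2" using p1[OF yP x0(1) y(2)] x0(2)[OF yP] by simp
    define len' where "len' = len(y := len y + 1)"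
    have "(\<Sum>x\<in>P. (1 / 2 :: real) ^ len' x) = (1 / 2) ^ (len y + 1) + ?K (P - {y})"
      unfolding sum.remove[OF assms(1) yP] len'_def by (auto intro!: sum.cong)
    also have "\<dots> = ?K P - (1 / 2) ^ len y / 2"
      unfolding sum.remove[OF assms(1) yP, of "\<lambda>x. (1 / 2) ^ len x"] by simp
    also have "\<dots> \<le> 1 + \<eta> - 1 / (8 * real \<sigma>)" using KP KPG KG2 y(3) by simp
    finally have kraft: "(\<Sum>x\<in>P. (1 / 2 :: real) ^ len' x) \<le> 1" using \<eta>8 by linarith
    \<comment> \<open>As the Kraft sum over \<open>G\<close> exceeds \<open>1 - \<eta>\<close>, the
      expected excess over the ideal lengths \<open>log 2 (1 / p x)\<close> is at most
      \<open>2 * \<eta>\<close>, hence at most 1/8. Symbols outside \<open>G\<close> have codewords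
      below their ideal length. Together with at most 1/2 for lengthening the codeword of
      \<open>y\<close> this stays below 1.\<close>
    have "?K G \<le> (\<Sum>x\<in>G. p x * (1 - (real (len x) - log 2 (1 / p x)) / 2))"
    proof (intro sum_mono)
      fix x assume x: "x \<in> G"
      then have xP: "x \<in> P" and "len x = sh x" by (auto simp: G_def len_def)
      then show "(1 / 2) ^ len x \<le> p x * (1 - (real (len x) - log 2 (1 / p x)) / 2)"
        using half[OF xP] shr[OF xP] assms(3)[OF xP] by (simp add: half_powr_le)
    qed
    also have "\<dots> = (\<Sum>x\<in>G. p x) - (\<Sum>x\<in>G. p x * (real (len x) - log 2 (1 / p x))) / 2"
      unfolding sum_divide_distrib sum_subtractf[symmetric]
      by (intro sum.cong refl) (simp add: right_diff_distrib)
    finally have red: "(\<Sum>x\<in>G. p x * (real (len x) - log 2 (1 / p x))) \<le> 2 * \<eta>"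
      using KG1 pG by linarith
    have "(\<Sum>x\<in>P. p x * (real (len x) - log 2 (1 / p x))) \<le> (\<Sum>x\<in>G. p x * (real (len x) - log 2 (1 / p x)))"
    proof -
      have "(\<Sum>x\<in>P - G. p x * (real (len x) - log 2 (1 / p x))) \<le> 0"
      proof (intro sum_nonpos mult_nonneg_nonpos)
        fix x assume x: "x \<in> P - G"
        then have xP: "x \<in> P" "len x = L" "L + 1 \<le> sh x" by (auto simp: G_def len_def)
        then have "real L + 1 \<le> real (sh x)" by (metis of_nat_le_iff of_nat_add of_nat_1)
        then show "real (len x) - log 2 (1 / p x) \<le> 0" using shr[OF xP(1)] xP by linarith
        show "0 \<le> p x" using assms(3)[OF xP(1)] by simp
      qed
      then show ?thesis
        using sum.subset_diff[OF fG(2) assms(1), of "\<lambda>x. p x * (real (len x) - log 2 (1 / p x))"]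
        by linarith
    qed
    then have "(\<Sum>x\<in>P. p x * (real (len x) - log 2 (1 / p x))) \<le> 1 / 8" using red \<eta>16 by linarith
    then have c1: "(\<Sum>x\<in>P. p x * real (len x)) \<le> (\<Sum>x\<in>P. p x * log 2 (1 / p x)) + 1 / 8"
      by (simp add: right_diff_distrib sum_subtractf)
    have "(\<Sum>x\<in>P. p x * real (len' x)) = p y * real (len y + 1) + (\<Sum>x\<in>P - {y}. p x * real (len x))"
      unfolding sum.remove[OF assms(1) yP] len'_def by (auto intro!: sum.cong)
    also have "\<dots> = p y + (\<Sum>x\<in>P. p x * real (len x))"
      unfolding sum.remove[OF assms(1) yP, of "\<lambda>x. p x * real (len x)"] by (simp add: distrib_left)
    finally have "(\<Sum>x\<in>P. p x * real (len' x)) \<le> 1 + (\<Sum>x\<in>P. p x * log 2 (1 / p x))"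
      using c1 py by linarith
    moreover have "real (len' x) \<le> 2 * log 2 (real (card P)) + 6" for x
    proof -
      have "len' x \<le> L + 1" by (auto simp: len'_def len_def)
      then have "real (len' x) \<le> real L + 1" by (metis of_nat_le_iff of_nat_add of_nat_1)
      then show ?thesis using Lr by (simp add: \<sigma>_def)
    qed
    ultimately show ?thesis using kraft by blast
  qed
qed

lemma entropy_code:
  fixes wt :: "'a \<Rightarrow> nat"
  assumes "finite P" "2 \<le> card P" "\<And>x. x \<in> P \<Longrightarrow> 0 < wt x" "(\<Sum>x\<in>P. wt x) = n"
  shows "\<exists>t. symbols t = P \<and> nodes t + 1 = 2 * card P \<and>
    real (\<Sum>x\<in>P. wt x * depth t x) \<le> real n * (1 + (\<Sum>x\<in>P. real (wt x) / real n * log 2 (real n / real (wt x)))) \<and>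
    (\<forall>x\<in>P. real (depth t x) \<le> 2 * log 2 (real (card P)) + 6)"
proof -
  have ne: "P \<noteq> {}" using assms(2) by auto
  have n: "0 < n" unfolding assms(4)[symmetric] using assms ne by (intro sum_pos) auto
  define p where "p = (\<lambda>x. real (wt x) / real n)"
  have "(\<Sum>x\<in>P. p x) = 1"
    using n by (simp add: p_def sum_divide_distrib[symmetric] of_nat_sum[symmetric] assms(4) del: of_nat_sum)
  then obtain len where len: "(\<Sum>x\<in>P. (1 / 2 :: real) ^ len x) \<le> 1"
    "(\<Sum>x\<in>P. p x * real (len x)) \<le> 1 + (\<Sum>x\<in>P. p x * log 2 (1 / p x))"
    "\<forall>x\<in>P. real (len x) \<le> 2 * log 2 (real (card P)) + 6"
    using code_lengths[OF assms(1,2), of p] assms(3) n by (auto simp: p_def)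
  obtain t where t: "symbols t = P" "nodes t + 1 = 2 * card P" "\<forall>x\<in>P. depth t x \<le> len x"
    using kraft_code[OF assms(1) ne len(1)] by blast
  have "real (\<Sum>x\<in>P. wt x * depth t x) \<le> (\<Sum>x\<in>P. real n * (p x * real (len x)))"
    unfolding of_nat_sum
  proof (intro sum_mono)
    fix x assume "x \<in> P"
    then have "wt x * depth t x \<le> wt x * len x" using t(3) by simp
    then have "real (wt x * depth t x) \<le> real (wt x * len x)" by (simp only: of_nat_le_iff)
    then show "real (wt x * depth t x) \<le> real n * (p x * real (len x))" using n by (simp add: p_def)
  qed
  also have "\<dots> \<le> real n * (1 + (\<Sum>x\<in>P. p x * log 2 (1 / p x)))"
    unfolding sum_distrib_left[symmetric] using len(2) by (intro mult_left_mono) auto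
  finally have "real (\<Sum>x\<in>P. wt x * depth t x) \<le> real n * (1 + (\<Sum>x\<in>P. p x * log 2 (1 / p x)))" .
  then show ?thesis using t len(3) unfolding p_def by (intro exI[of _ t]) force
qed

section \<open>Memory layout\<close>

lemma concat_nth:
  assumes "j < length xss" "a < length (xss ! j)"
  shows "concat xss ! (sum_list (map length (take j xss)) + a) = xss ! j ! a"
    and "sum_list (map length (take j xss)) + length (xss ! j) \<le> length (concat xss)"
proof -
  have "xss = take j xss @ xss ! j # drop (Suc j) xss" using assms(1) by (rule id_take_nth_drop)
  then have *: "concat xss = concat (take j xss) @ xss ! j @ concat (drop (Suc j) xss)"
    by (metis concat.simps(2) concat_append)
  have len: "length (concat (take j xss)) = sum_list (map length (take j xss))"
    by (rule length_concat)
  show "concat xss ! (sum_list (map length (take j xss)) + a) = xss ! j ! a"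
    unfolding * len[symmetric] using assms(2) by (simp add: nth_append)
  show "sum_list (map length (take j xss)) + length (xss ! j) \<le> length (concat xss)"
    unfolding * len[symmetric] by simp
qed

lemma records_le:
  "x \<in> set (records par side st a t L) \<Longrightarrow>
     x \<le> Max {par, side, 1, st + length (tree_bits t L), a + 4 * nodes t}"
proof (induction par side st a t L rule: records.induct)
  case (2 par side st a l r L)
  let ?L0 = "filter (\<lambda>x. x \<notin> symbols r) L" and ?L1 = "filter (\<lambda>x. x \<in> symbols r) L"
  have n: "1 \<le> nodes l" "1 \<le> nodes r" by (rule nodes_pos)+
  from 2(3) consider "x \<in> {st, a + 4 + 4 * nodes l, par, side}"
    | "x \<in> set (records a 0 (st + length L) (a + 4) l ?L0)"
    | "x \<in> set (records a 1 (st + length L + length (tree_bits l ?L0)) (a + 4 + 4 * nodes l) r ?L1)"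
    by auto
  then show ?case
  proof cases
    case 1
    then show ?thesis using n by auto
  next
    case c: 2
    from 2(1)[OF c] show ?thesis using n by simp
  next
    case c: 3
    from 2(2)[OF c] show ?thesis using n by simp
  qed
qed auto

context bitvector_index
begin

definition all_arrays :: "nat list list" where
  "all_arrays = blocks # arrays 0 @ arrays 1"

text \<open>Word 0 is the tag of the format, word 2 the address of the root, and word 3 the position
  where the second tree begins in the bit vector. These 11 words and the 17 array addresses put the
  root at address 28, so address 0 is free to mean that there is no node.\<close>

definition layout :: "'a code \<Rightarrow> 'a list \<Rightarrow> nat list" where
  "layout t L = [2, 0, 28, length (tree_bits t L), b, f, K, k, q, w div b, w div f]
     @ map (\<lambda>j. 28 + 4 * nodes t + sum_list (map length (take j all_arrays))) [0..<17]
     @ records 0 0 0 28 t L @ concat all_arrays"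

lemma length_all_arrays: "length all_arrays = 17"
  by (simp add: all_arrays_def length_arrays)

lemma all_arrays_nth: "\<beta> < 2 \<Longrightarrow> i < 8 \<Longrightarrow> all_arrays ! (1 + 8 * \<beta> + i) = arrays \<beta> ! i"
  by (cases "\<beta> = 0") (auto simp: all_arrays_def nth_append length_arrays less_2_cases_iff)

lemma length_layout: "length (layout t L) = 28 + 4 * nodes t + length (concat all_arrays)"
  by (simp add: layout_def length_records)

lemma arrays_less:
  assumes "0 < b" "0 < f" "f < w" "2 * b \<le> w" "0 < q" "b < 2 ^ w"
    and M: "2 * M + k * K < 2 ^ w" "x \<in> set (concat all_arrays)"
  shows "x < 2 ^ w"
proof -
  have pk: "y < 2 ^ w" if y: "y \<in> set (packed w d len g)" "0 < d" for y d len g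
  proof -
    obtain i where "y = (\<Sum>j<w div d. (g (i * (w div d) + j) mod 2 ^ d) * (2 ^ d) ^ j)"
      using y(1) by (auto simp: packed_def)
    also have "\<dots> < (2 ^ d) ^ (w div d)" by (rule sum_digits_less) simp
    also have "\<dots> = 2 ^ (d * (w div d))" by (simp add: power_mult)
    also have "\<dots> \<le> 2 ^ w" by (rule power_increasing) auto
    finally show ?thesis .
  qed
  have rs: "rank_super \<beta> v < 2 ^ w" if "v < M div b div q + 1" for \<beta> v
  proof -
    have "v * q \<le> M div b div q * q" using that by simp
    also have "\<dots> \<le> M div b" by simp
    finally have "v * q * b \<le> M div b * b" by (rule mult_le_mono1)
    also have "\<dots> \<le> M" by simp
    finally have "v * q * b \<le> M" .
    then show ?thesis using rk_le[of "occ \<beta>" "v * q * b"] M(1) by (simp add: rank_super_def)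
  qed
  have rt: "rank_table \<beta> v < 2 ^ w" for \<beta> v
    using rk_le[of "\<lambda>j. bit (v div b) j = (\<beta> = 1)" "v mod b"] assms(6) mod_less_divisor[OF assms(1), of v]
    unfolding rank_table_def by linarith
  have ss: "sel_super \<beta> v < 2 ^ w" if "v < M div (k * K) + 2" for \<beta> v
  proof -
    have "v * (k * K) \<le> (M div (k * K) + 1) * (k * K)" using that by (intro mult_le_mono1) simp
    also have "\<dots> = M div (k * K) * (k * K) + k * K" by simp
    also have "\<dots> \<le> M + k * K" by simp
    finally show ?thesis using sel_le[of M "occ \<beta>" "v * (k * K)"] M(1) by (simp add: sel_super_def)
  qed
  have st: "sel_table \<beta> v < 2 ^ w" for \<beta> v
    using nth_offset_cases[of b "\<lambda>j. bit (v div K) j = (\<beta> = 1)" "v mod K"] assms(6)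
    unfolding sel_table_def by linarith
  have "y < 2 ^ w" if "y \<in> set (concat (arrays \<beta>))" for y \<beta>
    using that assms unfolding arrays_def
    by (auto simp: rs rt ss st pk simp del: upt_Suc)
  then show ?thesis using M(2) pk[of x b] assms(1) by (auto simp: all_arrays_def blocks_def)
qed

lemma layout_less:
  assumes "0 < b" "0 < f" "f < w" "2 * b \<le> w" "0 < q" "0 < K" "K \<le> b" "0 < k" "q * b \<le> 2 ^ f"
    and M: "2 * M + k * K < 2 ^ w" "28 < (2::nat) ^ w" "length (tree_bits t L) \<le> M"
    and len: "length (layout t L) < 2 ^ w" and x: "x \<in> set (layout t L)"
  shows "x < 2 ^ w"
proof -
  have ww: "w < 2 ^ w" by (rule less_exp)
  have bw: "b < 2 ^ w" using assms(4) ww by linarith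
  have "(2::nat) ^ f < 2 ^ w" using assms(3) by simp
  moreover have "q * 1 \<le> q * b" using assms(1) by (intro mult_le_mono) auto
  ultimately have qw: "q < 2 ^ w" using assms(9) by linarith
  have "k * 1 \<le> k * K" using assms(6) by (intro mult_le_mono) auto
  then have kw: "k < 2 ^ w" using M(1) by linarith
  have dv: "w div b < 2 ^ w" "w div f < 2 ^ w" using ww by (auto intro: le_less_trans[OF div_le_dividend])
  have base: "28 + 4 * nodes t + sum_list (map length (take j all_arrays)) < 2 ^ w" if "j < 17" for j
  proof -
    have "length (concat (take j all_arrays)) \<le> length (concat (take j all_arrays @ drop j all_arrays))"
      unfolding concat_append by simp
    then have "sum_list (map length (take j all_arrays)) \<le> length (concat all_arrays)"
      by (simp add: length_concat)
    then show ?thesis using len unfolding length_layout by linarith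
  qed
  have rec: "y < 2 ^ w" if "y \<in> set (records 0 0 0 28 t L)" for y
    using records_le[OF that] M len unfolding length_layout by simp
  from x consider "x \<in> {2, 0, 28, length (tree_bits t L), b, f, K, k, q, w div b, w div f}"
    | j where "j < 17" "x = 28 + 4 * nodes t + sum_list (map length (take j all_arrays))"
    | "x \<in> set (records 0 0 0 28 t L)" | "x \<in> set (concat all_arrays)"
    unfolding layout_def by auto
  then show ?thesis
  proof cases
    case 1
    then show ?thesis using M ww less_trans[OF assms(3) ww] bw qw kw dv assms(3,7) by auto
  qed (use base rec arrays_less[OF assms(1-5) bw M(1)] in auto)
qed

lemma layout_memory:
  assumes pos: "0 < b" "0 < f" "0 < K" "0 < k" "0 < q"
    and small: "2 * b \<le> w" "K \<le> b" "f < w" "q * b \<le> 2 ^ f" "(28::nat) < 2 ^ w" "3 * M + 2 * (k * K) + 2 ^ f < 2 ^ w"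
    and len: "length (layout t L) \<le> 2 ^ w" and stored: "stored (layout t L) (r, m)"
  shows "bitvector_memory w M b f K k q X m" "segment m 28 (records 0 0 0 28 t L)"
    "28 + 4 * nodes t \<le> 2 ^ w" "m 0 = 2" "m 2 = 28" "m 3 = length (tree_bits t L)"
proof -
  have m: "m a = layout t L ! a" if "a < length (layout t L)" for a
    using stored that by (simp add: stored_def)
  let ?h = "[2, 0, 28, length (tree_bits t L), b, f, K, k, q, w div b, w div f]"
  let ?base = "\<lambda>j. 28 + 4 * nodes t + sum_list (map length (take j all_arrays))"
  define h where "h = ?h"
  have lh: "length h = 11" by (simp add: h_def)
  have lay: "layout t L = h @ map ?base [0..<17] @ records 0 0 0 28 t L @ concat all_arrays"
    by (simp add: layout_def h_def)
  have hd: "m a = ?h ! a" if "a < 11" for a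
    using m[of a] that unfolding length_layout lay h_def[symmetric] by (simp add: nth_append lh)
  have mb: "m (11 + j) = ?base j" if "j < 17" for j
    using m[of "11 + j"] that unfolding length_layout lay by (simp add: nth_append lh)
  have ma: "m (?base j + a) = all_arrays ! j ! a" "?base j + length (all_arrays ! j) \<le> 2 ^ w"
    if "j < 17" "a < length (all_arrays ! j)" for j a
  proof -
    have j: "j < length all_arrays" using that by (simp add: length_all_arrays)
    note c = concat_nth[OF j that(2)]
    have "?base j + a < length (layout t L)" using c(2) that(2) unfolding length_layout by linarith
    then have "m (?base j + a) = layout t L ! (?base j + a)" by (rule m)
    also have "\<dots> = concat all_arrays ! (sum_list (map length (take j all_arrays)) + a)"
      by (simp add: lay nth_append lh length_records)
    finally show "m (?base j + a) = all_arrays ! j ! a" using c(1) by simp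
    show "?base j + length (all_arrays ! j) \<le> 2 ^ w"
      using c(2) len unfolding length_layout by linarith
  qed
  have le: "?base j + length (all_arrays ! j) \<le> 2 ^ w" if "j < 17" for j
  proof (cases "all_arrays ! j = []")
    case True
    have "length (concat (take j all_arrays)) \<le> length (concat (take j all_arrays @ drop j all_arrays))"
      unfolding concat_append by simp
    then show ?thesis using len True by (simp add: length_concat length_layout)
  next
    case False
    then show ?thesis using ma(2)[OF that, of 0] by simp
  qed
  show "segment m 28 (records 0 0 0 28 t L)"
    unfolding segment_def
  proof (intro allI impI)
    fix i assume "i < length (records 0 0 0 28 t L)"
    then show "m (28 + i) = records 0 0 0 28 t L ! i"
      using m[of "28 + i"] unfolding length_layout lay by (simp add: nth_append lh length_records)
  qed
  show "28 + 4 * nodes t \<le> 2 ^ w" using len unfolding length_layout by linarith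
  show "m 0 = 2" "m 2 = 28" "m 3 = length (tree_bits t L)"
    using hd[of 0] hd[of 2] hd[of 3] by simp_all
  have base\<beta>: "m (12 + 8 * \<beta> + i) = ?base (1 + 8 * \<beta> + i)" if "\<beta> < 2" "i < 8" for \<beta> i
    using mb[of "1 + 8 * \<beta> + i"] that by (simp add: ac_simps)
  have lt: "1 + 8 * \<beta> + i < 17" if "\<beta> < 2" "i < 8" for \<beta> i :: nat using that by linarith
  show "bitvector_memory w M b f K k q X m"
  proof
    show "m 4 = b" "m 5 = f" "m 6 = K" "m 7 = k" "m 8 = q" "m 9 = w div b" "m 10 = w div f"
      using hd[of 4] hd[of 5] hd[of 6] hd[of 7] hd[of 8] hd[of 9] hd[of 10] by simp_all
    show "m (m 11 + a) = blocks ! a" if "a < length blocks" for a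
      using ma(1)[of 0 a] mb[of 0] that by (simp add: all_arrays_def)
    show "m 11 + length blocks \<le> 2 ^ w"
      using le[of 0] mb[of 0] by (simp add: all_arrays_def)
    show "m (m (12 + 8 * \<beta> + i) + a) = arrays \<beta> ! i ! a"
      if "\<beta> < 2" "i < 8" "a < length (arrays \<beta> ! i)" for \<beta> i a
      unfolding base\<beta>[OF that(1,2)] using ma(1)[OF lt[OF that(1,2)]] that(3)
      by (simp only: all_arrays_nth[OF that(1,2)])
    show "m (12 + 8 * \<beta> + i) + length (arrays \<beta> ! i) \<le> 2 ^ w" if "\<beta> < 2" "i < 8" for \<beta> i
      unfolding base\<beta>[OF that] using le[OF lt[OF that]] by (simp only: all_arrays_nth[OF that])
  qed (fact pos small)+
qed

end

section \<open>Permutations covered by upsequences\<close>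

text \<open>\<open>\<sigma>\<close> restricts to a bijection from the members of the class before
  \<open>i\<close> to those before \<open>i'\<close>. The last hypothesis is the monotonicity that
  an upsequence provides.\<close>

lemma class_rank_eq:
  assumes "i < n" "i' < n" "\<sigma> permutes {..<n}" "\<sigma> i = i'" "\<And>j. j < n \<Longrightarrow> c' (\<sigma> j) = c j"
    and "\<And>j. j < n \<Longrightarrow> c j = c i \<Longrightarrow> \<sigma> j < i' \<longleftrightarrow> j < i"
  shows "length (filter (\<lambda>y. y = c i) (take i (map c [0..<n]))) =
    length (filter (\<lambda>y. y = c i) (take i' (map c' [0..<n])))"
proof -
  have 1: "length (filter (\<lambda>y. y = c i) (take i (map c [0..<n]))) = card {j. j < i \<and> c j = c i}"
    unfolding length_filter_conv_card using assms(1) by (intro arg_cong[of _ _ card]) auto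
  have 2: "length (filter (\<lambda>y. y = c i) (take i' (map c' [0..<n]))) = card {j. j < i' \<and> c' j = c i}"
    unfolding length_filter_conv_card using assms(2) by (intro arg_cong[of _ _ card]) auto
  have "bij_betw \<sigma> {j. j < i \<and> c j = c i} {j. j < i' \<and> c' j = c i}"
    unfolding bij_betw_def
  proof
    show "inj_on \<sigma> {j. j < i \<and> c j = c i}" using permutes_inj[OF assms(3)] by (meson inj_on_subset subset_UNIV)
    show "\<sigma> ` {j. j < i \<and> c j = c i} = {j. j < i' \<and> c' j = c i}"
    proof (intro set_eqI iffI)
      fix y assume "y \<in> \<sigma> ` {j. j < i \<and> c j = c i}"
      then show "y \<in> {j. j < i' \<and> c' j = c i}" using assms by auto
    next
      fix y assume y: "y \<in> {j. j < i' \<and> c' j = c i}"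
      then have "y \<in> \<sigma> ` {..<n}" using assms(2) permutes_image[OF assms(3)] by auto
      then obtain j where "j < n" "y = \<sigma> j" by auto
      then show "y \<in> \<sigma> ` {j. j < i \<and> c j = c i}" using y assms(5,6) by auto
    qed
  qed
  then show ?thesis unfolding 1 2 by (rule bij_betw_same_card)
qed

definition block_of :: "nat set set \<Rightarrow> nat \<Rightarrow> nat set" where
  "block_of P i = (THE B. B \<in> P \<and> i \<in> B)"

text \<open>The permutation on indices from 0; being the identity from \<open>n\<close> on makes it
  satisfy \<open>permutes\<close>.\<close>

definition shifted :: "(nat \<Rightarrow> nat) \<Rightarrow> nat \<Rightarrow> nat \<Rightarrow> nat" where
  "shifted \<pi> n i = (if i < n then \<pi> (i + 1) - 1 else i)"

lemma shifted_bounds: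
  assumes "\<pi> permutes {1..n}" "i < n"
  shows "shifted \<pi> n i < n" "shifted \<pi> n i + 1 = \<pi> (i + 1)"
  using permutes_in_image[OF assms(1), of "i + 1"] assms(2) by (auto simp: shifted_def)

lemma shifted_inv:
  assumes "\<pi> permutes {1..n}" "i < n"
  shows "shifted \<pi> n (shifted (inv \<pi>) n i) = i" "shifted (inv \<pi>) n (shifted \<pi> n i) = i"
proof -
  note inv = permutes_inv[OF assms(1)]
  show "shifted \<pi> n (shifted (inv \<pi>) n i) = i"
    using shifted_bounds[OF inv assms(2)] permutes_inverses[OF assms(1)] assms(2)
    by (subst shifted_def) simp
  show "shifted (inv \<pi>) n (shifted \<pi> n i) = i"
    using shifted_bounds[OF assms] permutes_inverses[OF assms(1)] assms(2)
    by (subst shifted_def) simp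
qed

lemma shifted_permutes:
  assumes "\<pi> permutes {1..n}"
  shows "shifted \<pi> n permutes {..<n}"
proof (rule bij_imp_permutes)
  show "bij_betw (shifted \<pi> n) {..<n} {..<n}"
    using shifted_bounds[OF assms] shifted_bounds[OF permutes_inv[OF assms]] shifted_inv[OF assms]
    by (intro bij_betw_byWitness[where f' = "shifted (inv \<pi>) n"]) auto
qed (simp add: shifted_def)

locale covered_permutation =
  fixes n :: nat and \<pi> :: "nat \<Rightarrow> nat" and P :: "nat set set"
  assumes n: "1 \<le> n" and perm: "\<pi> permutes {1..n}" and ups: "shuffled_upsequences n \<pi> P"
begin

lemma partition: "partition_on {1..n} P"
  using ups by (simp add: shuffled_upsequences_def)

lemma finite_P: "finite P"
  by (rule finite_elements[OF _ partition]) simp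

lemma block_of_eq: "B \<in> P \<Longrightarrow> i \<in> B \<Longrightarrow> block_of P i = B"
  unfolding block_of_def using partition_onD2[OF partition]
  by (intro the_equality) (auto simp: disjoint_def)

lemma block_of_mem:
  assumes "i \<in> {1..n}"
  shows "block_of P i \<in> P" "i \<in> block_of P i"
proof -
  obtain B where "B \<in> P" "i \<in> B" using assms partition_onD1[OF partition] by blast
  then show "block_of P i \<in> P" "i \<in> block_of P i" using block_of_eq by auto
qed

lemma block_of_eq_iff: "i \<in> {1..n} \<Longrightarrow> B \<in> P \<Longrightarrow> block_of P i = B \<longleftrightarrow> i \<in> B"
  using block_of_mem block_of_eq by blast

lemma block_props:
  assumes "B \<in> P"
  shows "B \<subseteq> {1..n}" "finite B" "0 < card B"
proof -
  show "B \<subseteq> {1..n}" using assms partition_onD1[OF partition] by auto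
  then show "finite B" by (rule finite_subset) simp
  moreover have "B \<noteq> {}" using assms partition_onD3[OF partition] by auto
  ultimately show "0 < card B" by (simp add: card_gt_0_iff)
qed

lemma sum_block: "(\<Sum>i=1..n. g (block_of P i)) = (\<Sum>B\<in>P. of_nat (card B) * g B)"
  for g :: "nat set \<Rightarrow> 'b :: comm_semiring_1"
proof -
  have "(\<Sum>i=1..n. g (block_of P i)) = (\<Sum>B\<in>P. \<Sum>i\<in>{i \<in> {1..n}. block_of P i = B}. g (block_of P i))"
    by (rule sum.group[symmetric]) (auto simp: finite_P block_of_mem)
  also have "\<dots> = (\<Sum>B\<in>P. of_nat (card B) * g B)"
  proof (intro sum.cong refl)
    fix B assume B: "B \<in> P"
    have "{i \<in> {1..n}. block_of P i = B} = {i \<in> {1..n}. i \<in> B}"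
      by (rule Collect_cong, rule conj_cong[OF refl], rule block_of_eq_iff[OF _ B])
    also have "\<dots> = B" using block_props(1)[OF B] by blast
    finally have "{i \<in> {1..n}. block_of P i = B} = B" .
    then have "(\<Sum>i\<in>{i \<in> {1..n}. block_of P i = B}. g (block_of P i)) = (\<Sum>i\<in>B. g B)"
      by (intro sum.cong) auto
    then show "(\<Sum>i\<in>{i \<in> {1..n}. block_of P i = B}. g (block_of P i)) = of_nat (card B) * g B"
      by simp
  qed
  finally show ?thesis .
qed

lemma sum_card: "(\<Sum>B\<in>P. card B) = n"
  using sum_block[of "\<lambda>_. 1 :: nat"] by simp

definition pos_seq :: "nat set list" where
  "pos_seq = map (\<lambda>i. block_of P (i + 1)) [0..<n]"

definition val_seq :: "nat set list" where
  "val_seq = map (\<lambda>i. block_of P (inv \<pi> (i + 1))) [0..<n]"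

text \<open>The value sequence is the position sequence rearranged by the inverse permutation. This
  lets the two trees share all node records.\<close>

lemma mset_seqs: "mset pos_seq = mset val_seq"
proof -
  let ?c = "\<lambda>i. block_of P (i + 1)"
  have "image_mset (shifted (inv \<pi>) n) (mset_set {..<n}) = mset_set {..<n}"
    using shifted_permutes[OF permutes_inv[OF perm]]
    by (simp add: image_mset_mset_set permutes_inj_on permutes_image)
  then have "image_mset ?c (mset_set {..<n}) = image_mset ?c (image_mset (shifted (inv \<pi>) n) (mset_set {..<n}))"
    by simp
  also have "\<dots> = image_mset (\<lambda>i. ?c (shifted (inv \<pi>) n i)) (mset_set {..<n})"
    by (simp add: multiset.map_comp comp_def)
  also have "\<dots> = image_mset (\<lambda>i. block_of P (inv \<pi> (i + 1))) (mset_set {..<n})"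
    by (rule image_mset_cong) (use shifted_bounds[OF permutes_inv[OF perm]] in auto)
  finally show ?thesis by (simp add: pos_seq_def val_seq_def lessThan_atLeast0)
qed

lemma length_seqs: "length pos_seq = n" "length val_seq = n"
  by (simp_all add: pos_seq_def val_seq_def)

lemma pos_seq_subset: "set pos_seq \<subseteq> P"
  by (auto simp: pos_seq_def block_of_mem)

lemma upsequence_order:
  assumes "i \<in> {1..n}" "j \<in> {1..n}" "block_of P j = block_of P i"
  shows "\<pi> j < \<pi> i \<longleftrightarrow> j < i"
proof -
  have "strict_mono_on (block_of P i) \<pi>"
    using ups block_of_mem[OF assms(1)] by (simp add: shuffled_upsequences_def)
  moreover have "i \<in> block_of P i" "j \<in> block_of P i"
    using block_of_mem(2)[OF assms(1)] block_of_mem(2)[OF assms(2)] assms(3) by simp_all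
  ultimately show ?thesis by (simp add: strict_mono_on_less)
qed

lemma forward_index:
  assumes "i < n" "i' + 1 = \<pi> (i + 1)"
  shows "i' < n" "pos_seq ! i = val_seq ! i'"
    "length (filter (\<lambda>y. y = pos_seq ! i) (take i pos_seq)) =
     length (filter (\<lambda>y. y = pos_seq ! i) (take i' val_seq))"
proof -
  have i': "shifted \<pi> n i = i'" using shifted_bounds(2)[OF perm assms(1)] assms(2) by simp
  then show lt: "i' < n" using shifted_bounds(1)[OF perm assms(1)] by simp
  show "pos_seq ! i = val_seq ! i'"
    using assms lt by (simp add: pos_seq_def val_seq_def permutes_inverses[OF perm])
  show "length (filter (\<lambda>y. y = pos_seq ! i) (take i pos_seq)) =
     length (filter (\<lambda>y. y = pos_seq ! i) (take i' val_seq))"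
  proof -
    let ?c = "\<lambda>i. block_of P (i + 1)"
    have "length (filter (\<lambda>y. y = ?c i) (take i (map ?c [0..<n]))) =
      length (filter (\<lambda>y. y = ?c i) (take i' (map (\<lambda>i. block_of P (inv \<pi> (i + 1))) [0..<n])))"
    proof (rule class_rank_eq[OF assms(1) lt shifted_permutes[OF perm] i'])
    fix j assume j: "j < n"
    note b = shifted_bounds[OF perm j]
    show "block_of P (inv \<pi> (shifted \<pi> n j + 1)) = block_of P (j + 1)"
      unfolding b by (simp add: permutes_inverses[OF perm])
    assume "block_of P (j + 1) = block_of P (i + 1)"
    then have "\<pi> (j + 1) < \<pi> (i + 1) \<longleftrightarrow> j + 1 < i + 1"
      using j assms(1) by (intro upsequence_order) auto
    then show "shifted \<pi> n j < i' \<longleftrightarrow> j < i" using b(2) assms(2) by linarith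
    qed
    then show ?thesis using assms(1) by (simp add: pos_seq_def val_seq_def)
  qed
qed

lemma backward_index:
  assumes "i < n" "i' + 1 = inv \<pi> (i + 1)"
  shows "i' < n" "val_seq ! i = pos_seq ! i'"
    "length (filter (\<lambda>y. y = val_seq ! i) (take i val_seq)) =
     length (filter (\<lambda>y. y = val_seq ! i) (take i' pos_seq))"
proof -
  have i': "i' = shifted (inv \<pi>) n i"
    using shifted_bounds(2)[OF permutes_inv[OF perm] assms(1)] assms(2) by simp
  then show lt: "i' < n" using shifted_bounds(1)[OF permutes_inv[OF perm] assms(1)] by simp
  have "i + 1 = \<pi> (i' + 1)" using assms(2) by (simp add: permutes_inverses[OF perm])
  from forward_index[OF lt this]
  show "val_seq ! i = pos_seq ! i'"
    "length (filter (\<lambda>y. y = val_seq ! i) (take i val_seq)) =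
     length (filter (\<lambda>y. y = val_seq ! i) (take i' pos_seq))" by simp_all
qed

lemma entropy_eq:
  assumes "mset S = image_mset card (mset_set P)"
  shows "seq_entropy S = (\<Sum>B\<in>P. real (card B) / real n * log 2 (real n / real (card B)))"
proof -
  have "sum_list S = (\<Sum>B\<in>P. card B)"
    unfolding sum_mset_sum_list[symmetric] assms sum_unfold_sum_mset ..
  then have sl: "sum_list S = n" by (simp add: sum_card)
  have "(\<Sum>x\<leftarrow>S. g x) = (\<Sum>B\<in>P. g (card B))" for g :: "nat \<Rightarrow> real"
    unfolding sum_unfold_sum_mset sum_mset_sum_list[symmetric] mset_map assms
    by (simp add: multiset.map_comp comp_def)
  then show ?thesis unfolding seq_entropy_def sl by simp
qed

lemma entropy_nonneg:
  assumes "mset S = image_mset card (mset_set P)"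
  shows "0 \<le> seq_entropy S"
  unfolding entropy_eq[OF assms]
proof (intro sum_nonneg mult_nonneg_nonneg)
  fix B assume B: "B \<in> P"
  have "card B \<le> card {1..n}" using block_props[OF B] by (intro card_mono) auto
  then show "0 \<le> log 2 (real n / real (card B))" using block_props(3)[OF B] n by (simp add: zero_le_log_cancel_iff)
qed auto

text \<open>A permutation that increases on all of \<open>{1..n}\<close> satisfies
  \<open>j \<le> \<pi> j\<close>; since the values and the indices have the same sum, no inequality
  can be strict.\<close>

lemma singleton_identity:
  assumes "card P = 1" "i \<in> {1..n}"
  shows "\<pi> i = i"
proof -
  obtain B where PB: "P = {B}" using assms(1) by (metis card_1_singletonE)
  then have B: "B = {1..n}" using partition_onD1[OF partition] by simp
  have mono: "strict_mono_on {1..n} \<pi>" using ups PB B by (simp add: shuffled_upsequences_def)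
  have in': "\<pi> j \<in> {1..n} \<longleftrightarrow> j \<in> {1..n}" for j by (rule permutes_in_image[OF perm])
  have ge: "j \<le> \<pi> j" if "j \<in> {1..n}" for j
    using that
  proof (induction j)
    case (Suc j)
    show ?case
    proof (cases "j = 0")
      case False
      then have "j \<le> \<pi> j" using Suc by auto
      also have "\<pi> j < \<pi> (Suc j)" using mono Suc.prems False by (auto simp: strict_mono_on_def)
      finally show ?thesis by simp
    next
      case True
      then show ?thesis using in'[of "Suc j"] Suc.prems by auto
    qed
  qed simp
  have sums: "(\<Sum>j=1..n. \<pi> j) = (\<Sum>j=1..n. j)"
    using sum.permute[OF perm, of "\<lambda>x. x"] by (simp add: comp_def)
  show ?thesis
  proof (rule ccontr)
    assume "\<pi> i \<noteq> i"
    then have "i < \<pi> i" using ge[OF assms(2)] by simp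
    then have "(\<Sum>j=1..n. j) < (\<Sum>j=1..n. \<pi> j)"
      using ge assms(2) by (intro sum_strict_mono_ex1) blast+
    then show False using sums by simp
  qed
qed

end

text \<open>One command must serve every \<open>n\<close>, so the format is recognised at run time:
  tag 0 for the identity, 1 for explicit tables, 2 for wavelet trees.\<close>

definition dispatch :: "exp \<Rightarrow> com \<Rightarrow> com" where
  "dispatch e c = Seq (assign 4 (Mem (N 0)))
     (If (Equal (Reg 4) (Imm 0)) Skip (If (Equal (Reg 4) (Imm 1)) (assign 0 e) c))"

lemma exec_dispatch:
  assumes ws: "word_state w (r, m)" and e: "regs e \<subseteq> {..<8}" and w: "1 \<le> w"
  shows "m 0 = 0 \<Longrightarrow> \<exists>t r'. t \<le> 5 \<and> exec w (dispatch e c) (r, m) t (r', m) \<and> r' 0 = r 0" (is "_ \<Longrightarrow> ?identity")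
    and "m 0 = 1 \<Longrightarrow> 4 \<notin> regs e \<Longrightarrow>
      \<exists>t r'. t \<le> 6 + cost e \<and> exec w (dispatch e c) (r, m) t (r', m) \<and> r' 0 = eval w r m e"
      (is "_ \<Longrightarrow> _ \<Longrightarrow> ?table")
    and "m 0 = 2 \<Longrightarrow> (\<And>r'. word_state w (r', m) \<Longrightarrow> r' 0 = r 0 \<Longrightarrow>
        \<exists>t r''. t \<le> T \<and> exec w c (r', m) t (r'', m) \<and> r'' 0 = v) \<Longrightarrow>
      \<exists>t r'. t \<le> T + 5 \<and> exec w (dispatch e c) (r, m) t (r', m) \<and> r' 0 = v" (is "_ \<Longrightarrow> PROP _ \<Longrightarrow> ?main")
proof -
  obtain t1 r1 where 1: "exec w (assign 4 (Mem (N 0))) (r, m) t1 (r1, m)" "r1 4 = eval w r m (Mem (N 0))"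
    "\<And>k. k < 8 \<Longrightarrow> k \<noteq> 4 \<Longrightarrow> r1 k = r k" "word_state w (r1, m)" "t1 \<le> cost (Mem (N 0)) + 1"
    by (rule exec_assign[OF ws, of "Mem (N 0)" 4]) auto
  have r1: "r1 4 = m 0" "r1 0 = r 0" "t1 \<le> 3" using 1(2,5) 1(3)[of 0] by auto
  have w1: "1 mod 2 ^ w = (1::nat)" using w by (intro mod_less one_less_power) auto
  show ?identity if "m 0 = 0"
  proof -
    have "exec w (dispatch e c) (r, m) (t1 + (1 + 1)) (r1, m)"
      unfolding dispatch_def
      by (rule exec_Seq[OF 1(1) exec_If_True[OF _ exec_Skip]]) (use r1 that in simp)
    then show ?thesis using r1 by (intro exI[of _ "t1 + (1 + 1)"] exI[of _ r1]) simp
  qed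
  show ?table if m: "m 0 = 1" and e4: "4 \<notin> regs e"
  proof -
    obtain t2 r2 where 2: "exec w (assign 0 e) (r1, m) t2 (r2, m)" "r2 0 = eval w r1 m e"
      "t2 \<le> cost e + 1"
      by (rule exec_assign[OF 1(4) e, of 0])
    have ev: "eval w r1 m e = eval w r m e"
      by (rule eval_cong) (use 1(3) e e4 in force)
    have "exec w (dispatch e c) (r, m) (t1 + (1 + (1 + t2))) (r2, m)"
      unfolding dispatch_def
      by (rule exec_Seq[OF 1(1) exec_If_False[OF _ exec_If_True[OF _ 2(1)]]]) (use r1 m w1 in simp_all)
    then show ?thesis using r1 2 ev by (intro exI[of _ "t1 + (1 + (1 + t2))"] exI[of _ r2]) simp
  qed
  show ?main if m: "m 0 = 2" and c: "\<And>r'. word_state w (r', m) \<Longrightarrow> r' 0 = r 0 \<Longrightarrow>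
        \<exists>t r''. t \<le> T \<and> exec w c (r', m) t (r'', m) \<and> r'' 0 = v"
  proof -
    obtain t2 r2 where 2: "t2 \<le> T" "exec w c (r1, m) t2 (r2, m)" "r2 0 = v"
      using c[OF 1(4) r1(2)] by blast
    have "exec w (dispatch e c) (r, m) (t1 + (1 + (1 + t2))) (r2, m)"
      unfolding dispatch_def
      by (rule exec_Seq[OF 1(1) exec_If_False[OF _ exec_If_False[OF _ 2(2)]]]) (use r1 m w1 in simp_all)
    then show ?thesis using r1 2 by (intro exI[of _ "t1 + (1 + (1 + t2))"] exI[of _ r2]) simp
  qed
qed

lemma records_cong:
  "mset L = mset L' \<Longrightarrow> records par side st a t L = records par side st a t L'"
proof (induction par side st a t L arbitrary: L' rule: records.induct)
  case (2 par side st a l r L)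
  let ?P = "\<lambda>x. x \<in> symbols r"
  have m: "mset (filter ?P L) = mset (filter ?P L')"
    "mset (filter (\<lambda>x. \<not> ?P x) L) = mset (filter (\<lambda>x. \<not> ?P x) L')"
    using 2(3) by (simp_all add: mset_filter)
  have "length L = length L'" using 2(3) by (metis size_mset)
  then show ?case
    using 2(1)[OF m(2)] 2(2)[OF m(1)] length_tree_bits_cong[OF m(2), of l] by simp
qed simp

text \<open>The two bit strings in a row, continued by \<open>False\<close> because the last block
  and the spare one reach past the end.\<close>

definition wavelet_bit :: "'a code \<Rightarrow> 'a list \<Rightarrow> 'a list \<Rightarrow> nat \<Rightarrow> bool" where
  "wavelet_bit t L L' p \<longleftrightarrow>
     p < length (tree_bits t L @ tree_bits t L') \<and> (tree_bits t L @ tree_bits t L') ! p"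

lemma answers_dispatch:
  assumes "\<And>r m. word_state w (r, m) \<Longrightarrow> stored D (r, m) \<Longrightarrow> r 0 = i \<Longrightarrow> m 0 = 2"
    and "\<And>r m. word_state w (r, m) \<Longrightarrow> stored D (r, m) \<Longrightarrow> r 0 = i \<Longrightarrow>
      \<exists>t r'. t \<le> T \<and> exec w c (r, m) t (r', m) \<and> r' 0 = v"
    and "regs e \<subseteq> {..<8}" "1 \<le> w"
  shows "answers w (dispatch e c) D i v (T + 5)"
  unfolding answers_def
proof (intro allI impI)
  fix s assume s: "word_state w s \<and> stored D s \<and> fst s 0 = i"
  obtain r m where rm: "s = (r, m)" by (cases s)
  have stored_irrel: "stored D (r', m)" for r' using s rm by (simp add: stored_def)
  have "\<exists>t r'. t \<le> T + 5 \<and> exec w (dispatch e c) (r, m) t (r', m) \<and> r' 0 = v"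
  proof (rule exec_dispatch(3)[OF _ assms(3,4)])
    show "word_state w (r, m)" "m 0 = 2" using s rm assms(1) by auto
    show "\<exists>t r''. t \<le> T \<and> exec w c (r', m) t (r'', m) \<and> r'' 0 = v"
      if "word_state w (r', m)" "r' 0 = r 0" for r'
      by (rule assms(2)) (use s rm that stored_irrel in auto)
  qed
  then obtain t r' where "t \<le> T + 5" "exec w (dispatch e c) (r, m) t (r', m)" "r' 0 = v" by blast
  then show "\<exists>t s'. t \<le> T + 5 \<and> exec w (dispatch e c) s t s' \<and> fst s' 0 = v \<and> stored D s'"
    using rm stored_irrel by (intro exI[of _ t] exI[of _ "(r', m)"]) simp
qed

text \<open>Down the tree of the positions and up the tree of the values, which begins at the offset
  kept in word 3. The inverse swaps the two offsets.\<close>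

definition forward_query :: com where
  "forward_query = query (N 0) (Mem (N 3))"

definition backward_query :: com where
  "backward_query = query (Mem (N 3)) (N 0)"

definition forward_cost :: nat where
  "forward_cost = down_cost (N 0) + up_cost (Mem (N 3)) + 2"

definition backward_cost :: nat where
  "backward_cost = down_cost (Mem (N 3)) + up_cost (N 0) + 2"

context covered_permutation
begin

definition main_layout :: "nat \<Rightarrow> nat \<Rightarrow> nat \<Rightarrow> nat \<Rightarrow> nat \<Rightarrow> nat \<Rightarrow> nat set code \<Rightarrow> nat list" where
  "main_layout w b f K k q t = bitvector_index.layout w (2 * length (tree_bits t pos_seq)) b f K k q
     (wavelet_bit t pos_seq val_seq) t pos_seq"

text \<open>An inverse query starts from a value, which belongs to the upsequence of its preimage;
  hence the depth is taken at \<open>inv \<pi> i\<close>. The constant 28 consists of the 23 steps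
  besides the loop iterations and of 5 steps for reading and testing the tag.\<close>

lemma answers_main:
  assumes pos: "0 < b" "0 < f" "0 < K" "0 < k" "0 < q"
    and small: "2 * b \<le> w" "K \<le> b" "f < w" "q * b \<le> 2 ^ f" "(28::nat) < 2 ^ w"
      "3 * (2 * length (tree_bits t pos_seq)) + 2 * (k * K) + 2 ^ f < 2 ^ w"
    and t: "P \<subseteq> symbols t" and nw: "n < 2 ^ w"
    and len: "length (main_layout w b f K k q t) \<le> 2 ^ w" and i: "i \<in> {1..n}"
    and e: "regs e \<subseteq> {..<8}"
  shows "answers w (dispatch e forward_query) (main_layout w b f K k q t) i (\<pi> i)
      (forward_cost * depth t (block_of P i) + 28)"
    and "answers w (dispatch e backward_query) (main_layout w b f K k q t) i (inv \<pi> i)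
      (backward_cost * depth t (block_of P (inv \<pi> i)) + 28)"
proof -
  define c where "c = length (tree_bits t pos_seq)"
  define X where "X = wavelet_bit t pos_seq val_seq"
  have c': "length (tree_bits t val_seq) = c"
    unfolding c_def by (rule length_tree_bits_cong[OF mset_seqs[symmetric]])
  have X1: "X (0 + 0 + j) = tree_bits t pos_seq ! j" if "j < length (tree_bits t pos_seq)" for j
    using that c' by (simp add: X_def wavelet_bit_def nth_append c_def)
  have X2: "X (c + 0 + j) = tree_bits t val_seq ! j" if "j < length (tree_bits t val_seq)" for j
    using that c' by (simp add: X_def wavelet_bit_def nth_append c_def)
  have sub: "set pos_seq \<subseteq> symbols t" "set val_seq \<subseteq> symbols t"
    using pos_seq_subset t mset_eq_setD[OF mset_seqs] by auto
  have w1: "1 \<le> w" using small(3) by simp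
  define i0 where "i0 = i - 1"
  have i0: "i0 < n" "i = i0 + 1" using i by (auto simp: i0_def)
  have \<pi>i: "\<pi> i \<in> {1..n}" "inv \<pi> i \<in> {1..n}"
    using permutes_in_image[OF perm] permutes_in_image[OF permutes_inv[OF perm]] i by blast+
  define v where "v = \<pi> i - 1"
  have v: "v + 1 = \<pi> (i0 + 1)" "v + 1 < 2 ^ w" using \<pi>i(1) i0(2) nw by (auto simp: v_def)
  define u where "u = inv \<pi> i - 1"
  have u: "u + 1 = inv \<pi> (i0 + 1)" "u + 1 < 2 ^ w" using \<pi>i(2) i0(2) nw by (auto simp: u_def)
  note F = forward_index[OF i0(1) v(1)]
  note B = backward_index[OF i0(1) u(1)]
  have run: "(\<exists>t' r'. t' \<le> forward_cost * depth t (block_of P i) + 23 \<and>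
        exec w forward_query (r, m) t' (r', m) \<and> r' 0 = \<pi> i)"
     "(\<exists>t' r'. t' \<le> backward_cost * depth t (block_of P (inv \<pi> i)) + 23 \<and>
        exec w backward_query (r, m) t' (r', m) \<and> r' 0 = inv \<pi> i)"
     "m 0 = 2"
    if ws: "word_state w (r, m)" and st: "stored (main_layout w b f K k q t) (r, m)" and r0: "r 0 = i" for r m
  proof -
    note st' = st[unfolded main_layout_def, folded X_def c_def]
    note small' = small[folded c_def]
    note len' = len[unfolded main_layout_def, folded X_def c_def]
    note lm = bitvector_index.layout_memory[OF pos small' len' st']
    interpret bitvector_memory w "2 * c" b f K k q X m by (rule lm(1))
    have e0: "eval w r m (N 0) = 0" for r by simp
    have e3: "eval w r m (Mem (N 3)) = c" for r
      using lm(6) small(5) by (simp add: c_def)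
    have regs0: "regs (N 0) = {}" "regs (Mem (N 3)) = {}" by simp_all
    have p28: "(0::nat) < 28" by simp
    have r0': "r 0 = i0 + 1" using r0 i0 by simp
    have di: "pos_seq ! i0 = block_of P i" "val_seq ! i0 = block_of P (inv \<pi> i)"
      using i0 by (simp_all add: pos_seq_def val_seq_def)
    have "\<exists>t' r'. t' \<le> forward_cost * depth t (pos_seq ! i0) + 23 \<and>
        exec w (query (N 0) (Mem (N 3))) (r, m) t' (r', m) \<and> r' 0 = v + 1"
      unfolding forward_cost_def
      by (rule exec_query[OF e0 regs0(1) e3 regs0(2) lm(2) p28 lm(3,5) mset_seqs sub(1) _ _ F(2,3) _ _ _ _ ws r0' v(2)])
        (use i0 F X1 X2 c' in \<open>auto simp: length_seqs c_def\<close>)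
    then show "(\<exists>t' r'. t' \<le> forward_cost * depth t (block_of P i) + 23 \<and>
        exec w forward_query (r, m) t' (r', m) \<and> r' 0 = \<pi> i)"
      using v(1) i0(2) unfolding di forward_query_def by simp
    note rc = lm(2)[unfolded records_cong[OF mset_seqs]]
    have "\<exists>t' r'. t' \<le> backward_cost * depth t (val_seq ! i0) + 23 \<and>
        exec w (query (Mem (N 3)) (N 0)) (r, m) t' (r', m) \<and> r' 0 = u + 1"
      unfolding backward_cost_def
      by (rule exec_query[OF e3 regs0(2) e0 regs0(1) rc p28 lm(3,5) mset_seqs[symmetric] sub(2) _ _ B(2,3) _ _ _ _ ws r0' u(2)])
        (use i0 B X1 X2 c' in \<open>auto simp: length_seqs c_def\<close>)
    then show "(\<exists>t' r'. t' \<le> backward_cost * depth t (block_of P (inv \<pi> i)) + 23 \<and>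
        exec w backward_query (r, m) t' (r', m) \<and> r' 0 = inv \<pi> i)"
      using u(1) i0(2) unfolding di backward_query_def by simp
    show "m 0 = 2" by (rule lm(4))
  qed
  show "answers w (dispatch e forward_query) (main_layout w b f K k q t) i (\<pi> i)
      (forward_cost * depth t (block_of P i) + 28)"
  proof -
    have "answers w (dispatch e forward_query) (main_layout w b f K k q t) i (\<pi> i)
        (forward_cost * depth t (block_of P i) + 23 + 5)"
      by (rule answers_dispatch[OF _ _ e w1]; rule run)
    then show ?thesis unfolding add.assoc by (simp only: arith_simps)
  qed
  show "answers w (dispatch e backward_query) (main_layout w b f K k q t) i (inv \<pi> i)
      (backward_cost * depth t (block_of P (inv \<pi> i)) + 28)"
  proof -
    have "answers w (dispatch e backward_query) (main_layout w b f K k q t) i (inv \<pi> i)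
        (backward_cost * depth t (block_of P (inv \<pi> i)) + 23 + 5)"
      by (rule answers_dispatch[OF _ _ e w1]; rule run)
    then show ?thesis unfolding add.assoc by (simp only: arith_simps)
  qed
qed

end

text \<open>The two header words place \<open>\<pi> i\<close> at address \<open>i + 1\<close> and
  \<open>inv \<pi> i\<close> at \<open>i + 1 + n\<close>.\<close>

definition table_layout :: "nat \<Rightarrow> (nat \<Rightarrow> nat) \<Rightarrow> nat list" where
  "table_layout n \<pi> = [1, n] @ map (\<lambda>i. \<pi> (i + 1)) [0..<n] @ map (\<lambda>i. inv \<pi> (i + 1)) [0..<n]"

definition forward_table_e :: exp where
  "forward_table_e = Mem (add_e (V 0) (N 1))"

definition backward_table_e :: exp where
  "backward_table_e = Mem (add_e (add_e (V 0) (N 1)) (Mem (N 1)))"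

lemma regs_table_e: "regs forward_table_e \<subseteq> {..<8}" "regs backward_table_e \<subseteq> {..<8}"
  by (auto simp: forward_table_e_def backward_table_e_def)

lemma answers_identity:
  assumes "regs e \<subseteq> {..<8}" "1 \<le> w"
  shows "answers w (dispatch e c) [0] i i 5"
  unfolding answers_def
proof (intro allI impI)
  fix s assume s: "word_state w s \<and> stored [0] s \<and> fst s 0 = i"
  obtain r m where rm: "s = (r, m)" by (cases s)
  have "m 0 = 0" using s by (simp add: rm stored_def)
  then obtain t r' where "t \<le> 5" "exec w (dispatch e c) (r, m) t (r', m)" "r' 0 = r 0"
    using exec_dispatch(1)[of w r m e c] s rm assms by blast
  then show "\<exists>t s'. t \<le> 5 \<and> exec w (dispatch e c) s t s' \<and> fst s' 0 = i \<and> stored [0] s'"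
    using s rm by (intro exI[of _ t] exI[of _ "(r', m)"]) (simp add: stored_def)
qed

lemma answers_table:
  assumes "i \<in> {1..n}" "2 * n + 2 \<le> 2 ^ w"
  shows "answers w (dispatch forward_table_e c) (table_layout n \<pi>) i (\<pi> i) (6 + cost forward_table_e)"
    and "answers w (dispatch backward_table_e c) (table_layout n \<pi>) i (inv \<pi> i) (6 + cost backward_table_e)"
proof -
  let ?D = "table_layout n \<pi>"
  have len: "length ?D = 2 * n + 2" by (simp add: table_layout_def)
  have w: "1 \<le> w"
    using assms by (cases w) auto
  have D: "?D ! 0 = 1" "?D ! 1 = n" "?D ! (i + 1) = \<pi> i" "?D ! (i + 1 + n) = inv \<pi> i"
    using assms(1) by (cases i; simp add: table_layout_def nth_append)+
  have gen: "answers w (dispatch e c) ?D i v (6 + cost e)"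
    if e: "regs e \<subseteq> {..<8}" "4 \<notin> regs e"
      and ev: "\<And>r m. r 0 = i \<Longrightarrow> (\<And>a. a < 2 * n + 2 \<Longrightarrow> m a = ?D ! a) \<Longrightarrow> eval w r m e = v" for e v
    unfolding answers_def
  proof (intro allI impI)
    fix s assume s: "word_state w s \<and> stored ?D s \<and> fst s 0 = i"
    obtain r m where rm: "s = (r, m)" by (cases s)
    have m: "m a = ?D ! a" if "a < 2 * n + 2" for a
      using s that by (simp add: rm stored_def len)
    have "m 0 = 1" using m[of 0] D by simp
    then obtain t r' where "t \<le> 6 + cost e" "exec w (dispatch e c) (r, m) t (r', m)" "r' 0 = eval w r m e"
      using exec_dispatch(2)[of w r m e c] s rm e w by blast
    moreover have "eval w r m e = v" by (rule ev) (use s rm m in auto)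
    ultimately show "\<exists>t s'. t \<le> 6 + cost e \<and> exec w (dispatch e c) s t s' \<and> fst s' 0 = v \<and> stored ?D s'"
      using s rm by (intro exI[of _ t] exI[of _ "(r', m)"]) (simp add: stored_def)
  qed
  have w1: "1 mod 2 ^ w = (1::nat)" using w by (intro mod_less one_less_power) auto
  show "answers w (dispatch forward_table_e c) ?D i (\<pi> i) (6 + cost forward_table_e)"
  proof (rule gen)
    fix r m :: "nat \<Rightarrow> nat" assume "r 0 = i" and m: "\<And>a. a < 2 * n + 2 \<Longrightarrow> m a = ?D ! a"
    moreover have "m (i + 1) = \<pi> i" using m[of "i + 1"] D assms(1) by simp
    ultimately show "eval w r m forward_table_e = \<pi> i"
      using assms w1 by (simp add: forward_table_e_def)
  qed (auto simp: forward_table_e_def)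
  show "answers w (dispatch backward_table_e c) ?D i (inv \<pi> i) (6 + cost backward_table_e)"
  proof (rule gen)
    fix r m :: "nat \<Rightarrow> nat" assume r: "r 0 = i" and m: "\<And>a. a < 2 * n + 2 \<Longrightarrow> m a = ?D ! a"
    have 1: "m 1 = n" "m (i + 1 + n) = inv \<pi> i" using m[of 1] m[of "i + 1 + n"] D assms(1) by simp_all
    have "eval w r m (add_e (add_e (V 0) (N 1)) (Mem (N 1))) = i + 1 + n"
      by (intro eval_add) (use r 1 w1 assms in auto)
    then show "eval w r m backward_table_e = inv \<pi> i" using 1 by (simp add: backward_table_e_def)
  qed (auto simp: backward_table_e_def)
qed

text \<open>The first bound, whose factor tends to 1 with \<open>d / w\<close>, is meant for the
  blocks, which hold the bits themselves; the cruder second one suffices for the directory. The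
  factor comes from \<open>w - d \<le> d * (w div d)\<close> and
  \<open>w * w \<le> (w - d) * (w + 2 * d)\<close>.\<close>

lemma length_packed_le:
  assumes "0 < d" "2 * d \<le> w"
  shows "real w * real (length (packed w d len g)) \<le> real d * real len * (1 + 2 * real d / real w) + real w"
    and "real w * real (length (packed w d len g)) \<le> 2 * real d * real len + real w"
proof -
  have w: "0 < w" "2 * real d \<le> real w" using assms by linarith+
  have p: "0 < w div d" using assms by (simp add: div_greater_zero_iff)
  have "w < (w div d + 1) * d" using assms(1) by (metis add.commute dividend_less_div_times mult_Suc plus_1_eq_Suc)
  then have "real w < real ((w div d + 1) * d)" by (simp only: of_nat_less_iff)
  then have lt: "real w - real d \<le> real d * real (w div d)" by (simp add: algebra_simps)
  have "real w * real w \<le> (real w - real d) * (real w + 2 * real d)"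
    using mult_right_mono[OF w(2), of "real d"] by (simp add: algebra_simps)
  also have "\<dots> \<le> real d * real (w div d) * (real w + 2 * real d)" by (rule mult_right_mono[OF lt]) simp
  finally have key: "real w / real (w div d) \<le> real d * (1 + 2 * real d / real w)"
    using w(1) p by (simp add: field_simps)
  have "real w * real (length (packed w d len g)) = real w * real (len div (w div d)) + real w"
    by (simp add: length_packed algebra_simps)
  also have "real w * real (len div (w div d)) \<le> real w * (real len / real (w div d))"
    by (intro mult_left_mono of_nat_div_le_of_nat) auto
  also have "\<dots> = real len * (real w / real (w div d))" by simp
  also have "\<dots> \<le> real len * (real d * (1 + 2 * real d / real w))" by (intro mult_left_mono key) auto
  finally show 1: "real w * real (length (packed w d len g)) \<le> real d * real len * (1 + 2 * real d / real w) + real w"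
    by (simp add: ac_simps)
  have "1 + 2 * real d / real w \<le> 2" using w by (simp add: field_simps)
  then have "real d * real len * (1 + 2 * real d / real w) \<le> real d * real len * 2"
    by (intro mult_left_mono) auto
  then show "real w * real (length (packed w d len g)) \<le> 2 * real d * real len + real w"
    using 1 by linarith
qed

context bitvector_index
begin

text \<open>Extra space per bit of the vector: the rounding of the blocks and then, twice for zeros
  and ones, the six arrays that grow with \<open>M\<close>, in the order of \<open>arrays\<close>.
  The two lookup tables are independent of \<open>M\<close> and appear among the additive
  terms.\<close>

definition overhead :: real where
  "overhead = 2 * real b / real w + 2 * (real w / (real b * real q) + 2 * real f / real b
     + real w / (real k * real K) + 2 * real f / real K + real w * (real k * real K) / 2 ^ f
     + 2 * real f * real K / real b)"

lemma length_arrays_le: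
  assumes "0 < b" "0 < f" "2 * f \<le> w" "0 < K" "0 < k" "0 < q"
  shows "real w * real (length (concat (arrays \<beta>))) \<le>
    real M * (real w / (real b * real q) + 2 * real f / real b
     + real w / (real k * real K) + 2 * real f / real K + real w * (real k * real K) / 2 ^ f
     + 2 * real f * real K / real b)
    + real w * (2 ^ b * (real b + real K) + real k * real K + real K) + 8 * real w"
proof -
  have fw: "2 * real f \<le> real w" using assms(3) by linarith
  let ?W = "real w" and ?M = "real M"
  have 1: "?W * real (M div b div q + 1) \<le> ?M * (?W / (real b * real q)) + ?W"
  proof -
    have "M div b div q = M div (b * q)" by (simp add: div_mult2_eq)
    then have "real (M div b div q) \<le> ?M / (real b * real q)" using of_nat_div_le_of_nat[of M "b * q"] by simp
    then have "?W * real (M div b div q) \<le> ?W * (?M / (real b * real q))" by (intro mult_left_mono) auto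
    then show ?thesis by (simp add: algebra_simps)
  qed
  have Mb: "real (M div b) \<le> ?M / real b" by (rule of_nat_div_le_of_nat)
  have 2: "?W * real (length (packed w f (M div b + 1) g)) \<le> ?M * (2 * real f / real b) + 2 * ?W" for g
  proof -
    have "2 * real f * real (M div b) \<le> 2 * real f * (?M / real b)" using Mb by (intro mult_left_mono) auto
    then show ?thesis
      using length_packed_le(2)[OF assms(2,3), of "M div b + 1" g] fw by (simp add: algebra_simps)
  qed
  have 4: "?W * real (M div (k * K) + 2) \<le> ?M * (?W / (real k * real K)) + 2 * ?W"
  proof -
    have "real (M div (k * K)) \<le> ?M / (real k * real K)" using of_nat_div_le_of_nat[of M "k * K"] by simp
    then have "?W * real (M div (k * K)) \<le> ?W * (?M / (real k * real K))" by (intro mult_left_mono) auto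
    then show ?thesis by (simp add: algebra_simps)
  qed
  have 5: "?W * real (length (packed w f (M div K + 1) g)) \<le> ?M * (2 * real f / real K) + 2 * ?W" for g
  proof -
    have "real (M div K) \<le> ?M / real K" by (rule of_nat_div_le_of_nat)
    then have "2 * real f * real (M div K) \<le> 2 * real f * (?M / real K)" by (intro mult_left_mono) auto
    then show ?thesis
      using length_packed_le(2)[OF assms(2,3), of "M div K + 1" g] fw by (simp add: algebra_simps)
  qed
  have 6: "?W * real ((M div 2 ^ f + 1) * (k * K)) \<le>
      ?M * (?W * (real k * real K) / 2 ^ f) + ?W * (real k * real K)"
  proof -
    have "real (M div 2 ^ f) \<le> ?M / 2 ^ f" using of_nat_div_le_of_nat[of M "2 ^ f"] by simp
    then have "?W * (real k * real K) * real (M div 2 ^ f) \<le> ?W * (real k * real K) * (?M / 2 ^ f)"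
      by (intro mult_left_mono) auto
    then show ?thesis by (simp add: algebra_simps)
  qed
  have 7: "?W * real (length (packed w f ((M div b + 1) * K) g)) \<le>
      ?M * (2 * real f * real K / real b) + ?W * real K + ?W" for g
  proof -
    have "2 * real f * real K * real (M div b) \<le> 2 * real f * real K * (?M / real b)"
      using Mb by (intro mult_left_mono) auto
    moreover have "2 * real f * real K \<le> ?W * real K" using fw by (intro mult_right_mono) auto
    ultimately show ?thesis
      using length_packed_le(2)[OF assms(2,3), of "(M div b + 1) * K" g] by (simp add: algebra_simps)
  qed
  have len: "length (concat (arrays \<beta>)) = (M div b div q + 1)
      + length (packed w f (M div b + 1) (rank_block \<beta>)) + 2 ^ b * b + (M div (k * K) + 2)
      + length (packed w f (M div K + 1) (sel_group \<beta>)) + (M div 2 ^ f + 1) * (k * K)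
      + length (packed w f ((M div b + 1) * K) (sel_sparse \<beta>)) + 2 ^ b * K"
    by (simp add: arrays_def)
  have tab: "?W * real (2 ^ b * b) + ?W * real (2 ^ b * K) = ?W * (2 ^ b * (real b + real K))"
    by (simp add: algebra_simps)
  show ?thesis
    unfolding len of_nat_add[of _ "2 ^ b * K"] of_nat_add[of _ "length _"] of_nat_add[of _ "(M div 2 ^ f + 1) * (k * K)"]
      of_nat_add[of _ "M div (k * K) + 2"] of_nat_add[of _ "2 ^ b * b"]
    using 1 2[of "rank_block \<beta>"] 4 5[of "sel_group \<beta>"] 6 7[of "sel_sparse \<beta>"] tab
    unfolding distrib_left by linarith
qed

lemma length_layout_le:
  assumes "0 < b" "2 * b \<le> w" "0 < f" "2 * f \<le> w" "0 < K" "0 < k" "0 < q"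
  shows "real (length (layout t L) * w) \<le> real M * (1 + overhead)
    + 2 * real w * (2 ^ b * (real b + real K) + real k * real K + real K)
    + real w * (47 + 4 * real (nodes t))"
proof -
  have bw: "2 * real b \<le> real w" "0 < real w" using assms by linarith+
  have "real (M div b) * real b \<le> real M" using div_times_less_eq_dividend[of M b]
    by (metis of_nat_le_iff of_nat_mult)
  then have "real b * real (M div b + 2) \<le> real M + 2 * real b" by (simp add: algebra_simps)
  then have "real b * real (M div b + 2) * (1 + 2 * real b / real w) \<le> (real M + 2 * real b) * (1 + 2 * real b / real w)"
    by (intro mult_right_mono) auto
  also have "\<dots> = real M + real M * (2 * real b / real w) + 2 * real b * (1 + 2 * real b / real w)"
    by (simp only: distrib_left distrib_right mult_1_right add.assoc)
  also have "2 * real b * (1 + 2 * real b / real w) \<le> 2 * real b * 2"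
    using bw by (intro mult_left_mono) (auto simp: field_simps)
  finally have "real w * real (length blocks) \<le> real M + real M * (2 * real b / real w) + 3 * real w"
    using length_packed_le(1)[OF assms(1,2), of "M div b + 2" block_array] bw
    unfolding blocks_def by linarith
  moreover define D where "D = real w / (real b * real q) + 2 * real f / real b
     + real w / (real k * real K) + 2 * real f / real K + real w * (real k * real K) / 2 ^ f
     + 2 * real f * real K / real b"
  moreover define E where "E = real w * (2 ^ b * (real b + real K) + real k * real K + real K)"
  moreover note length_arrays_le[OF assms(1,3,4,5,6,7), of 0, folded D_def E_def]
    length_arrays_le[OF assms(1,3,4,5,6,7), of 1, folded D_def E_def]
  moreover have "real (length (layout t L) * w) = real w * 28 + real w * (4 * real (nodes t))
      + real w * real (length blocks) + real w * real (length (concat (arrays 0)))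
      + real w * real (length (concat (arrays 1)))"
    by (simp add: length_layout all_arrays_def algebra_simps)
  moreover have "real M * (1 + overhead) = real M + real M * (2 * real b / real w) + 2 * (real M * D)"
  proof -
    have "overhead = 2 * real b / real w + 2 * D" by (simp add: overhead_def D_def)
    then show ?thesis by (simp add: ring_distribs)
  qed
  moreover have "2 * real w * (2 ^ b * (real b + real K) + real k * real K + real K) = 2 * E"
    by (simp add: E_def)
  \<comment> \<open>The 47 words are 28 for the header, 3 from rounding the blocks, and 8 from the
    arrays for each of the two bit values.\<close>
  ultimately show ?thesis unfolding distrib_left[of "real w" 47] by linarith
qed

end

section \<open>Choice of the parameters\<close>

text \<open>For \<open>n \<ge> 2\<close> and \<open>g = loglog n\<close>, the number
  \<open>2 ^ g\<close> lies between lg n and 2 lg n. The parameters will be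
  \<open>b = g ^ 4\<close>, \<open>f = 8 * g\<close>, \<open>K = g ^ 2\<close> and
  \<open>k = q = (2 ^ g) ^ 2\<close>: then \<open>f / K\<close>, \<open>f * K / b\<close>,
  \<open>w / (k * K)\<close> and \<open>w * (k * K) / 2 ^ f\<close> tend to 0, while tables over all
  \<open>2 ^ b\<close> block contents take only a power of \<open>n\<close> with exponent
  o(1).\<close>

definition loglog :: "nat \<Rightarrow> nat" where
  "loglog n = nat \<lfloor>log 2 (log 2 (real n))\<rfloor> + 1"

text \<open>This is \<open>overhead\<close> at the chosen parameters with
  \<open>y = loglog n\<close>, where \<open>w\<close> is replaced by its upper bound
  \<open>c * 2 powr y\<close> in numerators and by its lower bound \<open>2 powr y / 2\<close> in
  the denominator.\<close>

definition relative_overhead :: "real \<Rightarrow> real \<Rightarrow> real" where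
  "relative_overhead c y = 4 * y ^ 4 / 2 powr y
     + 2 * (c * 2 powr y / (y ^ 4 * (2 powr y) ^ 2) + 16 * y / y ^ 4 + c * 2 powr y / ((2 powr y) ^ 2 * y ^ 2)
       + 16 * y / y ^ 2 + c * 2 powr y * ((2 powr y) ^ 2 * y ^ 2) / (2 powr y) ^ 8 + 16 * y * y ^ 2 / y ^ 4)"

text \<open>The lookup tables and the other terms without \<open>M\<close>, divided by the lower
  bound \<open>2 powr (2 powr y / 2)\<close> of \<open>n\<close>.\<close>

definition table_overhead :: "real \<Rightarrow> real \<Rightarrow> real" where
  "table_overhead c y = 2 * (c * 2 powr y) * (2 powr (y ^ 4) * (y ^ 4 + y ^ 2) + (2 powr y) ^ 2 * y ^ 2 + y ^ 2)
     / 2 powr (2 powr y / 2)"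

lemma relative_overhead_tendsto: "0 < c \<Longrightarrow> (relative_overhead c \<longlongrightarrow> 0) at_top"
  unfolding relative_overhead_def by real_asymp

lemma table_overhead_tendsto: "0 < c \<Longrightarrow> (table_overhead c \<longlongrightarrow> 0) at_top"
  unfolding table_overhead_def by real_asymp

lemma loglog_at_top: "filterlim (\<lambda>n. real (loglog n)) at_top sequentially"
proof (rule filterlim_at_top_mono)
  show "filterlim (\<lambda>n. log 2 (log 2 (real n))) at_top sequentially" by real_asymp
  show "eventually (\<lambda>n. log 2 (log 2 (real n)) \<le> real (loglog n)) sequentially"
    by (intro always_eventually allI) (unfold loglog_def, linarith)
qed

lemma log_bounds:
  assumes "2 \<le> n"
  shows "2 powr real (loglog n) / 2 \<le> log 2 (real n)" "log 2 (real n) \<le> 2 powr real (loglog n)"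
    "2 powr (2 powr real (loglog n) / 2) \<le> real n"
proof -
  have x: "1 \<le> log 2 (real n)" using assms by simp
  define y where "y = log 2 (log 2 (real n))"
  have y: "0 \<le> y" using x by (simp add: y_def)
  then have g: "real (loglog n) = of_int \<lfloor>y\<rfloor> + 1" by (simp add: loglog_def y_def)
  have e: "2 powr y = log 2 (real n)" using x by (simp add: y_def)
  have "2 powr real (loglog n) / 2 = 2 powr (of_int \<lfloor>y\<rfloor>)" by (simp add: g powr_add)
  also have "\<dots> \<le> 2 powr y" by simp
  finally show 1: "2 powr real (loglog n) / 2 \<le> log 2 (real n)" by (simp add: e)
  have "2 powr y \<le> 2 powr real (loglog n)" by (simp add: g) 
  then show "log 2 (real n) \<le> 2 powr real (loglog n)" by (simp add: e)
  have "2 powr (2 powr real (loglog n) / 2) \<le> 2 powr log 2 (real n)" using 1 by simp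
  then show "2 powr (2 powr real (loglog n) / 2) \<le> real n" using assms by simp
qed

text \<open>The demands on the parameters as a condition on \<open>y = loglog n\<close>, with
  \<open>2 powr (2 powr y / 2)\<close> standing in for \<open>n\<close>. The fourth conjunct yields
  \<open>2 * N \<le> n * n\<close> for the number \<open>N\<close> of bits of one tree; the fifth
  keeps header and node records within \<open>n * n\<close> bits.\<close>

definition large :: "real \<Rightarrow> real \<Rightarrow> bool" where
  "large c y \<longleftrightarrow> 2 \<le> y \<and> 2 * y ^ 4 \<le> 2 powr y / 2 \<and> y ^ 4 * (2 powr y) ^ 2 \<le> (2 powr y) ^ 8
     \<and> 4 * 2 powr y + 12 \<le> 2 powr (2 powr y / 2) \<and> 55 * (c * 2 powr y) \<le> 2 powr (2 powr y / 2)
     \<and> (2 powr y) ^ 2 * y ^ 2 \<le> 2 powr (2 powr y / 2) \<and> (2 powr y) ^ 8 \<le> 2 powr (2 powr y / 2)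
     \<and> relative_overhead c y \<le> 1 \<and> table_overhead c y \<le> 1"

lemma eventually_large: "0 < c \<Longrightarrow> eventually (large c) at_top"
proof -
  assume c: "0 < c"
  have "eventually (\<lambda>y::real. 2 \<le> y) at_top" by (rule eventually_ge_at_top)
  moreover have "eventually (\<lambda>y::real. 2 * y ^ 4 \<le> 2 powr y / 2) at_top" by real_asymp
  moreover have "eventually (\<lambda>y::real. y ^ 4 * (2 powr y) ^ 2 \<le> (2 powr y) ^ 8) at_top" by real_asymp
  moreover have "eventually (\<lambda>y::real. 4 * 2 powr y + 12 \<le> 2 powr (2 powr y / 2)) at_top" by real_asymp
  moreover have "eventually (\<lambda>y::real. 55 * (c * 2 powr y) \<le> 2 powr (2 powr y / 2)) at_top"
    using c by real_asymp
  moreover have "eventually (\<lambda>y::real. (2 powr y) ^ 2 * y ^ 2 \<le> 2 powr (2 powr y / 2)) at_top" by real_asymp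
  moreover have "eventually (\<lambda>y::real. (2 powr y) ^ 8 \<le> 2 powr (2 powr y / 2)) at_top" by real_asymp
  moreover have "eventually (\<lambda>y. relative_overhead c y < 1) at_top"
    using relative_overhead_tendsto[OF c] by (rule order_tendstoD) simp
  moreover have "eventually (\<lambda>y. table_overhead c y < 1) at_top"
    using table_overhead_tendsto[OF c] by (rule order_tendstoD) simp
  ultimately show ?thesis unfolding large_def by eventually_elim auto
qed

lemma overhead_le:
  assumes g: "2 \<le> g" and c: "real w \<le> c * 2 powr real g" "2 powr real g / 2 \<le> real w"
  shows "bitvector_index.overhead w (g ^ 4) (8 * g) (g ^ 2) ((2 ^ g) ^ 2) ((2 ^ g) ^ 2)
    \<le> relative_overhead c (real g)"
proof -
  let ?y = "real g" and ?G = "2 powr real g" and ?w = "real w"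
  have G: "real (2 ^ g) = ?G" by (simp add: powr_realpow)
  have pos: "0 < ?y" "0 < ?G" "0 \<le> ?w" using g by auto
  have f: "(2::real) ^ (8 * g) = ?G ^ 8" by (simp add: powr_realpow power_mult[symmetric] mult.commute)
  have 1: "2 * ?y ^ 4 / ?w \<le> 4 * ?y ^ 4 / ?G"
  proof -
    have w0: "0 < ?w" using c(2) pos(2) by linarith
    have "2 * ?y ^ 4 / ?w \<le> 2 * ?y ^ 4 / (?G / 2)"
      by (rule divide_left_mono[OF c(2)]) (use w0 in simp_all)
    then show ?thesis by simp
  qed
  have 2: "?w / (?y ^ 4 * ?G ^ 2) \<le> c * ?G / (?y ^ 4 * ?G ^ 2)" using c(1) by (intro divide_right_mono) auto
  have 3: "?w / (?G ^ 2 * ?y ^ 2) \<le> c * ?G / (?G ^ 2 * ?y ^ 2)" using c(1) by (intro divide_right_mono) auto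
  have 4: "?w * (?G ^ 2 * ?y ^ 2) / ?G ^ 8 \<le> c * ?G * (?G ^ 2 * ?y ^ 2) / ?G ^ 8"
    using c(1) by (intro divide_right_mono mult_right_mono) auto
  have k: "real ((2 ^ g) ^ 2) = ?G ^ 2" by (simp add: G[symmetric])
  have ov: "bitvector_index.overhead w (g ^ 4) (8 * g) (g ^ 2) ((2 ^ g) ^ 2) ((2 ^ g) ^ 2)
    = 2 * ?y ^ 4 / ?w + 2 * (?w / (?y ^ 4 * ?G ^ 2) + 16 * ?y / ?y ^ 4 + ?w / (?G ^ 2 * ?y ^ 2)
      + 16 * ?y / ?y ^ 2 + ?w * (?G ^ 2 * ?y ^ 2) / ?G ^ 8 + 16 * ?y * ?y ^ 2 / ?y ^ 4)"
    unfolding bitvector_index.overhead_def k f by simp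
  show ?thesis
    unfolding relative_overhead_def ov by (intro add_mono mult_left_mono 1 2 3 4 order_refl) simp
qed

context covered_permutation
begin

lemma card_P: "1 \<le> card P" "card P \<le> n"
proof -
  have "P \<noteq> {}" using block_of_mem(1)[of 1] n by auto
  then show "1 \<le> card P" using finite_P by (simp add: Suc_le_eq card_gt_0_iff)
  have "card P * 1 = (\<Sum>B\<in>P. 1)" by simp
  also have "\<dots> \<le> (\<Sum>B\<in>P. card B)" by (intro sum_mono) (use block_props(3) in \<open>auto simp: Suc_le_eq\<close>)
  finally show "card P \<le> n" by (simp add: sum_card)
qed

lemma sum_depth: "(\<Sum>i=1..n. depth t (block_of P i)) = length (tree_bits t pos_seq)"
proof -
  have "length (tree_bits t pos_seq) = (\<Sum>i<n. depth t (block_of P (i + 1)))"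
    by (simp add: length_tree_bits pos_seq_def comp_def interv_sum_list_conv_sum_set_nat lessThan_atLeast0)
  also have "\<dots> = (\<Sum>i=1..n. depth t (block_of P i))"
    by (rule sum.reindex_bij_witness[of _ "\<lambda>i. i - 1" "\<lambda>i. i + 1"]) auto
  finally show ?thesis ..
qed

lemma main_layout_bounds:
  assumes t: "symbols t = P" "nodes t + 1 = 2 * card P"
    and N: "real (length (tree_bits t pos_seq)) \<le> real n * (1 + H)"
    and d: "\<forall>B\<in>P. real (depth t B) \<le> 2 * log 2 (real (card P)) + 6"
    and \<sigma>: "2 \<le> card P" and g: "g = loglog n" and large: "large c (real g)"
    and w: "log 2 (real n) \<le> real w" "real w \<le> c * log 2 (real n)" "(n + 1) ^ 4 \<le> 2 ^ w"
    and c: "0 < c"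
  defines "D \<equiv> main_layout w (g ^ 4) (8 * g) (g ^ 2) ((2 ^ g) ^ 2) ((2 ^ g) ^ 2) t"
  shows "words w D"
    and "real (length D * w) \<le> 2 * real n * (1 + H)
      + (16 * relative_overhead c (real g) + table_overhead c (real g)) * (real n * log 2 (real (card P)))
      + 55 * c * (real (card P) * log 2 (real n))"
    and "i \<in> {1..n} \<Longrightarrow> regs e \<subseteq> {..<8} \<Longrightarrow> answers w (dispatch e forward_query) D i (\<pi> i)
      (forward_cost * depth t (block_of P i) + 28)"
    and "i \<in> {1..n} \<Longrightarrow> regs e \<subseteq> {..<8} \<Longrightarrow> answers w (dispatch e backward_query) D i (inv \<pi> i)
      (backward_cost * depth t (block_of P (inv \<pi> i)) + 28)"
proof -
  let ?y = "real g" and ?G = "2 powr real g" and ?w = "real w"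
  let ?\<sigma> = "card P" and ?b = "g ^ 4" and ?f = "8 * g" and ?K = "g ^ 2" and ?k = "(2 ^ g) ^ 2 :: nat"
  let ?N = "length (tree_bits t pos_seq)"
  have n2: "2 \<le> n" using card_P \<sigma> by linarith
  note lb = log_bounds[OF n2, folded g]
  have L: "2 \<le> ?y" "2 * ?y ^ 4 \<le> ?G / 2" "?y ^ 4 * ?G ^ 2 \<le> ?G ^ 8"
    "4 * ?G + 12 \<le> 2 powr (?G / 2)" "55 * (c * ?G) \<le> 2 powr (?G / 2)"
    "?G ^ 2 * ?y ^ 2 \<le> 2 powr (?G / 2)" "?G ^ 8 \<le> 2 powr (?G / 2)"
    "relative_overhead c ?y \<le> 1" "table_overhead c ?y \<le> 1"
    using large unfolding large_def by auto
  have G: "real (2 ^ g) = ?G" by (simp add: powr_realpow)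
  have f: "real (2 ^ ?f) = ?G ^ 8" by (simp add: powr_realpow power_mult[symmetric] mult.commute)
  have k: "real ?k = ?G ^ 2" by (simp add: G[symmetric])
  have g2: "2 \<le> g" using L(1) by simp
  have wG: "?w \<le> c * ?G" using w(2) lb(2) c by (meson mult_left_mono less_imp_le order_trans)
  have Gw: "?G / 2 \<le> ?w" using lb(1) w(1) by linarith
  have pos: "0 < ?b" "0 < ?f" "0 < ?K" "0 < ?k" using g2 by auto
  have bw: "2 * ?b \<le> w"
  proof -
    have "real (2 * ?b) \<le> ?w" using L(2) Gw by simp
    then show ?thesis by (simp only: of_nat_le_iff)
  qed
  have "2 ^ 3 \<le> g ^ 3" using g2 by (intro power_mono) auto
  then have "8 * g \<le> g ^ 3 * g" by (intro mult_right_mono) auto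
  then have fb: "?f \<le> ?b" by (simp add: eval_nat_numeral)
  have Kb: "?K \<le> ?b" using g2 by (intro power_increasing) auto
  have fw: "?f < w" "2 * ?f \<le> w" using fb bw pos by linarith+
  have qb: "?k * ?b \<le> 2 ^ ?f"
  proof -
    have "real (?k * ?b) \<le> real (2 ^ ?f)" using L(3) by (simp only: of_nat_mult k f) (simp add: mult.commute)
    then show ?thesis by (simp only: of_nat_le_iff)
  qed
  have kK: "?k * ?K \<le> n"
  proof -
    have "real (?k * ?K) \<le> real n" using L(6) lb(3) by (simp only: of_nat_mult k) simp
    then show ?thesis by (simp only: of_nat_le_iff)
  qed
  have fn: "2 ^ ?f \<le> n"
  proof -
    have "real (2 ^ ?f) \<le> real n" using L(7) lb(3) by (simp only: f)
    then show ?thesis by (simp only: of_nat_le_iff)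
  qed
  have l\<sigma>: "1 \<le> log 2 (real ?\<sigma>)" "log 2 (real ?\<sigma>) \<le> log 2 (real n)" using \<sigma> card_P by auto
  have "real ?N = (\<Sum>i=1..n. real (depth t (block_of P i)))" by (simp flip: sum_depth)
  also have "\<dots> \<le> (\<Sum>i=1..n. 2 * log 2 (real ?\<sigma>) + 6)" by (intro sum_mono d[rule_format] block_of_mem) auto
  also have "\<dots> = real n * (2 * log 2 (real ?\<sigma>) + 6)" by simp
  finally have N\<sigma>: "real ?N \<le> real n * (2 * log 2 (real ?\<sigma>) + 6)" .
  \<comment> \<open>With two or more upsequences lg \<sigma> is at least 1 and absorbs the additive
    6. From here on, overhead relative to the length of the bit vector counts as overhead relative
    to n lg \<sigma>.\<close>
  also have "\<dots> \<le> real n * (8 * log 2 (real ?\<sigma>))" using l\<sigma> by (intro mult_left_mono) auto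
  finally have N8: "real ?N \<le> 8 * (real n * log 2 (real ?\<sigma>))" by simp
  have "real n * (2 * log 2 (real ?\<sigma>) + 6) \<le> real n * (real n / 2)"
    using l\<sigma> lb L(4) by (intro mult_left_mono) auto
  then have "real (2 * ?N) \<le> real (n * n)" using N\<sigma> by simp
  then have Mn: "2 * ?N \<le> n * n" by (simp only: of_nat_le_iff)
  have n4: "(n + 1) ^ 4 = n * n * (n * n) + 4 * (n * n * n) + 6 * (n * n) + 4 * n + 1"
    by (simp add: eval_nat_numeral algebra_simps)
  \<comment> \<open>All sizes below are at most \<open>3 * (n * n) + 3 * n\<close>, which is less
    than \<open>(n + 1) ^ 4\<close>.\<close>
  have big: "3 * (n * n) + 3 * n < 2 ^ w" "(28::nat) < 2 ^ w"
  proof -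
    show "3 * (n * n) + 3 * n < 2 ^ w" using n4 w(3) by linarith
    have "(2 + 1) ^ 4 \<le> (n + 1) ^ 4" using n2 by (intro power_mono) auto
    then show "(28::nat) < 2 ^ w" using w(3) by simp
  qed
  have size: "3 * (2 * ?N) + 2 * (?k * ?K) + 2 ^ ?f < 2 ^ w" using big Mn kK fn by linarith
  have nw: "n < 2 ^ w" using big by linarith
  have "real (length D * w) \<le> real (2 * ?N) * (1 + bitvector_index.overhead w ?b ?f ?K ?k ?k)
    + 2 * ?w * (2 ^ ?b * (real ?b + real ?K) + real ?k * real ?K + real ?K)
    + ?w * (47 + 4 * real (nodes t))"
    unfolding D_def main_layout_def by (rule bitvector_index.length_layout_le[OF pos(1) bw pos(2) fw(2) pos(3,4,4)])
  also have "real (2 * ?N) * (1 + bitvector_index.overhead w ?b ?f ?K ?k ?k)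
      \<le> real (2 * ?N) * (1 + relative_overhead c ?y)"
    using overhead_le[OF g2 wG Gw] by (intro mult_left_mono) auto
  also have "2 * ?w * (2 ^ ?b * (real ?b + real ?K) + real ?k * real ?K + real ?K)
      \<le> table_overhead c ?y * real n"
  proof -
    define E where "E = 2 powr (?y ^ 4) * (?y ^ 4 + ?y ^ 2) + ?G ^ 2 * ?y ^ 2 + ?y ^ 2"
    have E0: "0 \<le> E" by (simp add: E_def)
    have "(2::real) ^ ?b = 2 powr (?y ^ 4)" by (simp flip: powr_realpow)
    then have "2 * ?w * (2 ^ ?b * (real ?b + real ?K) + real ?k * real ?K + real ?K) = 2 * ?w * E"
      unfolding E_def k by simp
    also have "\<dots> \<le> 2 * (c * ?G) * E" using wG E0 by (intro mult_right_mono) auto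
    also have "\<dots> = table_overhead c ?y * 2 powr (?G / 2)" by (simp add: table_overhead_def E_def)
    also have "\<dots> \<le> table_overhead c ?y * real n"
      using lb(3) c by (intro mult_left_mono) (auto simp: table_overhead_def)
    finally show ?thesis .
  qed
  also have "?w * (47 + 4 * real (nodes t)) \<le> 55 * (?w * real ?\<sigma>)"
  proof -
    \<comment> \<open>There are \<open>2 * \<sigma> - 1\<close> nodes, hence 8 words of records per
      upsequence at most; the 47 fixed words are charged to \<sigma> as well.\<close>
    have "4 * nodes t + 47 \<le> 55 * ?\<sigma>" using t(2) \<sigma> by linarith
    then have "47 + 4 * real (nodes t) \<le> 55 * real ?\<sigma>" by linarith
    then have "?w * (47 + 4 * real (nodes t)) \<le> ?w * (55 * real ?\<sigma>)" by (intro mult_left_mono) auto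
    then show ?thesis by simp
  qed
  finally have space: "real (length D * w) \<le> real (2 * ?N) + relative_overhead c ?y * real (2 * ?N)
      + table_overhead c ?y * real n + 55 * (?w * real ?\<sigma>)"
    by (simp add: algebra_simps)
  have ro0: "0 \<le> relative_overhead c ?y" using c by (simp add: relative_overhead_def)
  have to0: "0 \<le> table_overhead c ?y" using c by (simp add: table_overhead_def)
  have len: "length D < 2 ^ w"
  proof -
    have "relative_overhead c ?y * real (2 * ?N) \<le> 1 * real (2 * ?N)" using L(8) by (intro mult_right_mono) auto
    moreover have "table_overhead c ?y * real n \<le> 1 * real n" using L(9) by (intro mult_right_mono) auto
    moreover have "55 * (?w * real ?\<sigma>) \<le> real (n * n)"
    proof -
      have "55 * (?w * real ?\<sigma>) = (55 * ?w) * real ?\<sigma>" by simp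
      also have "\<dots> \<le> real n * real n"
        using wG L(5) lb(3) card_P by (intro mult_mono) auto
      finally show ?thesis by simp
    qed
    moreover have "real (2 * ?N) \<le> real (n * n)" using Mn by (simp only: of_nat_le_iff)
    ultimately have "real (length D * w) \<le> real (3 * (n * n) + 3 * n)" using space by simp
    then have "length D * w \<le> 3 * (n * n) + 3 * n" by (simp only: of_nat_le_iff)
    moreover have "length D * 1 \<le> length D * w" using fw by (intro mult_left_mono) auto
    ultimately show ?thesis using big by linarith
  qed
  have M: "2 * (2 * ?N) + ?k * ?K < 2 ^ w" using size by linarith
  show "words w D"
    unfolding words_def
  proof
    show "\<forall>x\<in>set D. x < 2 ^ w"
      unfolding D_def main_layout_def
      using bitvector_index.layout_less[OF pos(1,2) fw(1) bw pos(4) pos(3) Kb pos(4) qb M big(2) _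
          len[unfolded D_def main_layout_def]] by simp
    show "length D \<le> 2 ^ w" using len by simp
  qed
  show "real (length D * w) \<le> 2 * real n * (1 + H)
      + (16 * relative_overhead c ?y + table_overhead c ?y) * (real n * log 2 (real ?\<sigma>))
      + 55 * c * (real ?\<sigma> * log 2 (real n))"
  proof -
    have "relative_overhead c ?y * real (2 * ?N) \<le> relative_overhead c ?y * (16 * (real n * log 2 (real ?\<sigma>)))"
      using N8 ro0 by (intro mult_left_mono) auto
    moreover have "table_overhead c ?y * real n \<le> table_overhead c ?y * (real n * log 2 (real ?\<sigma>))"
      using l\<sigma> to0 mult_left_mono[OF l\<sigma>(1), of "real n"] by (intro mult_left_mono) auto
    moreover have "?w * real ?\<sigma> \<le> c * log 2 (real n) * real ?\<sigma>" using w(2) by (intro mult_right_mono) auto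
    moreover have "real (2 * ?N) \<le> 2 * real n * (1 + H)" using N by simp
    ultimately show ?thesis using space by (simp add: algebra_simps)
  qed
  show "answers w (dispatch e forward_query) D i (\<pi> i)
      (forward_cost * depth t (block_of P i) + 28)"
    if "i \<in> {1..n}" "regs e \<subseteq> {..<8}"
    unfolding D_def
    by (rule answers_main(1)[OF pos pos(4) bw Kb fw(1) qb big(2) size _ nw _ that])
      (use t len in \<open>auto simp: D_def\<close>)
  show "answers w (dispatch e backward_query) D i (inv \<pi> i)
      (backward_cost * depth t (block_of P (inv \<pi> i)) + 28)"
    if "i \<in> {1..n}" "regs e \<subseteq> {..<8}"
    unfolding D_def
    by (rule answers_main(2)[OF pos pos(4) bw Kb fw(1) qb big(2) size _ nw _ that])
      (use t len in \<open>auto simp: D_def\<close>)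
qed

end

section \<open>The encoding scheme\<close>

text \<open>The factor 7 comes from \<open>d i + 1 \<le> 2 * l + 7 \<le> 7 * (1 + l)\<close>. On
  average \<open>d i + 1\<close> is at most \<open>2 + H\<close>, so the same factor serves
  there.\<close>

lemma supportsI:
  fixes d :: "nat \<Rightarrow> nat" and q :: nat
  assumes n: "1 \<le> n"
    and T: "\<And>i. i \<in> {1..n} \<Longrightarrow> answers w c D i (f i) (T i)" "\<And>i. i \<in> {1..n} \<Longrightarrow> T i \<le> q * (d i + 1)"
    and d: "\<And>i. i \<in> {1..n} \<Longrightarrow> real (d i) \<le> 2 * l + 6" "real (\<Sum>i=1..n. d i) \<le> real n * (1 + H)"
    and "0 \<le> l" "0 \<le> H" "0 \<le> R" "7 * real q \<le> C"
  shows "supports w c D n f (C * (1 + l)) (C * (1 + H + R))"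
  unfolding supports_def
proof (intro exI[of _ T] conjI ballI)
  have Tq: "real (T i) \<le> real q * (real (d i) + 1)" if "i \<in> {1..n}" for i
  proof -
    have "real (T i) \<le> real (q * (d i + 1))" using T(2)[OF that] by (simp only: of_nat_le_iff)
    then show ?thesis by (simp add: distrib_left)
  qed
  show "real (T i) \<le> C * (1 + l)" if "i \<in> {1..n}" for i
  proof -
    have "real q * (real (d i) + 1) \<le> real q * (7 * (1 + l))"
      using d(1)[OF that] \<open>0 \<le> l\<close> by (intro mult_left_mono) auto
    also have "\<dots> = 7 * real q * (1 + l)" by simp
    also have "\<dots> \<le> C * (1 + l)"
      by (rule mult_right_mono) (use \<open>0 \<le> l\<close> \<open>7 * real q \<le> C\<close> in auto)
    finally show ?thesis using Tq[OF that] by linarith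
  qed
  have "measure_pmf.expectation (pmf_of_set {1..n}) (\<lambda>i. real (T i)) = (\<Sum>i=1..n. real (T i)) / real n"
    using n by (subst integral_pmf_of_set) auto
  also have "(\<Sum>i=1..n. real (T i)) \<le> (\<Sum>i=1..n. real q * (real (d i) + 1))"
    by (intro sum_mono Tq)
  also have "\<dots> = real q * (real (\<Sum>i=1..n. d i) + real n)"
    by (simp add: sum_distrib_left[symmetric] sum.distrib)
  also have "\<dots> \<le> real q * (real n * (1 + H) + real n)" using d(2) by (intro mult_left_mono) auto
  also have "\<dots> = real q * (2 + H) * real n" by (simp add: algebra_simps)
  finally have "measure_pmf.expectation (pmf_of_set {1..n}) (\<lambda>i. real (T i)) \<le> real q * (2 + H)"
    using n by (simp add: divide_right_mono)
  also have "\<dots> \<le> C * (1 + H + R)"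
  proof -
    have "real q * (2 + H) \<le> real q * (7 * (1 + H + R))"
      using \<open>0 \<le> H\<close> \<open>0 \<le> R\<close> by (intro mult_left_mono) auto
    also have "\<dots> = 7 * real q * (1 + H + R)" by simp
    also have "\<dots> \<le> C * (1 + H + R)"
      by (rule mult_right_mono) (use \<open>0 \<le> H\<close> \<open>0 \<le> R\<close> \<open>7 * real q \<le> C\<close> in auto)
    finally show ?thesis .
  qed
  finally show "measure_pmf.expectation (pmf_of_set {1..n}) (\<lambda>i. real (T i)) \<le> C * (1 + H + R)" .
qed (use T in auto)

definition good_code :: "nat set set \<Rightarrow> nat set code \<Rightarrow> bool" where
  "good_code P t \<longleftrightarrow> symbols t = P \<and> nodes t + 1 = 2 * card P \<and>
    real (\<Sum>B\<in>P. card B * depth t B) \<le> real (sum card P) * (1 + (\<Sum>B\<in>P. real (card B) / real (sum card P)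
      * log 2 (real (sum card P) / real (card B)))) \<and>
    (\<forall>B\<in>P. real (depth t B) \<le> 2 * log 2 (real (card P)) + 6)"

text \<open>The encoder receives the partition but not the list of lengths, so the code is chosen
  from \<open>P\<close> alone.\<close>

definition optimal_code :: "nat set set \<Rightarrow> nat set code" where
  "optimal_code P = (SOME t. good_code P t)"

context covered_permutation
begin

lemma optimal_code:
  assumes "2 \<le> card P" "mset S = image_mset card (mset_set P)"
  defines "t \<equiv> optimal_code P"
  shows "symbols t = P" "nodes t + 1 = 2 * card P"
    "real (length (tree_bits t pos_seq)) \<le> real n * (1 + seq_entropy S)"
    "\<forall>B\<in>P. real (depth t B) \<le> 2 * log 2 (real (card P)) + 6"
proof -
  have "good_code P t"
    unfolding t_def optimal_code_def
    by (rule someI_ex, unfold good_code_def, rule entropy_code[OF finite_P assms(1) _ refl])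
      (rule block_props(3))
  then show "symbols t = P" "nodes t + 1 = 2 * card P"
    "real (length (tree_bits t pos_seq)) \<le> real n * (1 + seq_entropy S)"
    "\<forall>B\<in>P. real (depth t B) \<le> 2 * log 2 (real (card P)) + 6"
    using sum_block[of "depth t"]
    unfolding good_code_def sum_card entropy_eq[OF assms(2)] sum_depth[symmetric] by auto
qed

end

text \<open>
  The identity needs no table at all; as long as \<open>n\<close> is small, the answers are stored explicitly,
  which is paid for by the \<open>o(n lg \<sigma>)\<close> term.
\<close>

definition encoding :: "real \<Rightarrow> (nat \<Rightarrow> nat) \<Rightarrow> nat \<Rightarrow> (nat \<Rightarrow> nat) \<Rightarrow> nat set set \<Rightarrow> nat list" where
  "encoding c w n \<pi> P =
    (if card P = 1 then [0]
     else if large c (real (loglog n)) then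
       (let g = loglog n in covered_permutation.main_layout n \<pi> P (w n) (g ^ 4) (8 * g) (g ^ 2)
         ((2 ^ g) ^ 2) ((2 ^ g) ^ 2) (optimal_code P))
     else table_layout n \<pi>)"

text \<open>For positive \<open>c\<close> the second case occurs for finitely many \<open>n\<close>
  only, so the large value there does not affect the limit. It pays for a table of
  \<open>2 * n + 2 \<le> 3 * n\<close> words.\<close>

definition space_error :: "real \<Rightarrow> (nat \<Rightarrow> nat) \<Rightarrow> nat \<Rightarrow> real" where
  "space_error c w n =
    (if large c (real (loglog n))
     then 16 * relative_overhead c (real (loglog n)) + table_overhead c (real (loglog n))
     else 3 * real (w n))"

lemma space_error_tendsto:
  assumes "0 < c"
  shows "space_error c w \<longlonglongrightarrow> 0"
proof -
  have "(\<lambda>n. relative_overhead c (real (loglog n))) \<longlonglongrightarrow> 0" "(\<lambda>n. table_overhead c (real (loglog n))) \<longlonglongrightarrow> 0"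
    using filterlim_compose[OF relative_overhead_tendsto[OF assms] loglog_at_top]
      filterlim_compose[OF table_overhead_tendsto[OF assms] loglog_at_top] by auto
  then have "(\<lambda>n. 16 * relative_overhead c (real (loglog n)) + table_overhead c (real (loglog n))) \<longlonglongrightarrow> 16 * 0 + 0"
    by (intro tendsto_intros)
  moreover have "eventually (\<lambda>n. large c (real (loglog n))) sequentially"
    using eventually_compose_filterlim[OF eventually_large[OF assms] loglog_at_top] .
  then have "eventually (\<lambda>n. 16 * relative_overhead c (real (loglog n)) + table_overhead c (real (loglog n))
      = space_error c w n) sequentially"
    by eventually_elim (simp add: space_error_def)
  ultimately show ?thesis using Lim_transform_eventually by fastforce
qed

text \<open>The asymptotic bound can fail for finitely many \<open>n\<close> only; adding their word
  lengths to the constant repairs it, since lg n is at least 1.\<close>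

lemma log_word_bound:
  fixes w :: "nat \<Rightarrow> nat"
  assumes "(\<lambda>n. real (w n)) \<in> O(\<lambda>n. log 2 (real n))"
  obtains c where "0 < c" "\<And>n. 2 \<le> n \<Longrightarrow> real (w n) \<le> c * log 2 (real n)"
proof -
  obtain c where c1: "0 < c"
    and ev: "eventually (\<lambda>n. norm (real (w n)) \<le> c * norm (log 2 (real n))) sequentially"
    using landau_o.bigE[OF assms] by blast
  then obtain n0 where "\<And>n. n0 \<le> n \<Longrightarrow> real (w n) \<le> c * \<bar>log 2 (real n)\<bar>"
    by (auto simp: eventually_sequentially)
  note c = c1 this
  define c' where "c' = c + (\<Sum>n<n0. real (w n))"
  have le: "c \<le> c'" by (simp add: c'_def sum_nonneg)
  have "real (w n) \<le> c' * log 2 (real n)" if n: "2 \<le> n" for n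
  proof -
    have l: "1 \<le> log 2 (real n)" using n by simp
    show ?thesis
    proof (cases "n0 \<le> n")
      case True
      then have "real (w n) \<le> c * log 2 (real n)" using c(2)[OF True] l by simp
      also have "\<dots> \<le> c' * log 2 (real n)" using le l by (intro mult_right_mono) auto
      finally show ?thesis .
    next
      case False
      then have "real (w n) \<le> (\<Sum>n<n0. real (w n))" by (intro member_le_sum) auto
      also have "\<dots> \<le> c' * 1" using c(1) by (simp add: c'_def)
      also have "\<dots> \<le> c' * log 2 (real n)" using le c(1) l by (intro mult_left_mono) auto
      finally show ?thesis .
    qed
  qed
  then show ?thesis using that[of c'] le c(1) by auto
qed

definition query_constant :: nat where
  "query_constant = forward_cost + backward_cost
     + cost forward_table_e + cost backward_table_e + 28"

lemma encoding_correct: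
  fixes w :: "nat \<Rightarrow> nat"
  assumes c: "0 < c" "\<And>n. 2 \<le> n \<Longrightarrow> real (w n) \<le> c * log 2 (real n)"
    and w: "\<And>n. 1 \<le> n \<Longrightarrow> 4 * log 2 (real n + 1) \<le> real (w n)"
    and n: "1 \<le> n" "\<pi> permutes {1..n}" "shuffled_upsequences n \<pi> P"
    and S: "mset S = image_mset card (mset_set P)"
  defines "D \<equiv> encoding c w n \<pi> P" and "C \<equiv> 7 * real query_constant + 55 * c"
    and "l \<equiv> log 2 (real (card P))" and "R \<equiv> log 2 (real (card P)) / log 2 (log 2 (real n))"
  shows "words (w n) D"
    and "2 \<le> n \<Longrightarrow> real (length D * w n) \<le> 2 * real n * (1 + seq_entropy S)
      + space_error c w n * (real n * l) + C * (real (card P) * log 2 (real n))" (is "_ \<Longrightarrow> ?space")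
    and "supports (w n) (dispatch forward_table_e forward_query) D n \<pi>
      (C * (1 + l)) (C * (1 + seq_entropy S + R))" (is ?forward)
    and "supports (w n) (dispatch backward_table_e backward_query) D n (inv \<pi>)
      (C * (1 + l)) (C * (1 + seq_entropy S + R))" (is ?backward)
proof -
  interpret covered_permutation n \<pi> P by unfold_locales (fact n)+
  let ?H = "seq_entropy S"
  let ?fwd = "dispatch forward_table_e forward_query" and ?bwd = "dispatch backward_table_e backward_query"
  have H: "0 \<le> ?H" by (rule entropy_nonneg[OF S])
  have l: "0 \<le> l" using card_P by (simp add: l_def)
  \<comment> \<open>For \<open>n \<le> 2\<close> the iterated logarithm is 0, by the default value
    of \<open>log\<close> at 0 when \<open>n = 1\<close>, and the quotient by 0 is 0.\<close>
  have R: "0 \<le> R"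
  proof (cases "2 \<le> n")
    case True
    then have "1 \<le> log 2 (real n)" by simp
    then have "0 \<le> log 2 (log 2 (real n))" by simp
    then show ?thesis using l by (simp add: R_def l_def)
  next
    case False
    then have "n = 1" using n(1) by simp
    then show ?thesis by (simp add: R_def log_def)
  qed
  have qC: "7 * real query_constant \<le> C" using c(1) by (simp add: C_def)
  have w4: "(n + 1) ^ 4 \<le> 2 ^ w n"
  proof -
    have "real ((n + 1) ^ 4) = 2 powr (4 * log 2 (real n + 1))"
    proof -
      have "2 powr (log 2 (real n + 1) * real 4) = (real n + 1) ^ 4"
        by (subst powr_powr[symmetric]) (simp add: powr_realpow)
      then show ?thesis by (simp add: mult.commute add.commute)
    qed
    also have "\<dots> \<le> 2 powr real (w n)" using w[OF n(1)] by simp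
    also have "\<dots> = real (2 ^ w n)" by (simp add: powr_realpow)
    finally show ?thesis by (simp only: of_nat_le_iff)
  qed
  have n4: "(n + 1) ^ 4 = n * n * (n * n) + 4 * (n * n * n) + 6 * (n * n) + 4 * n + 1"
    by (simp add: eval_nat_numeral algebra_simps)
  have w1: "1 \<le> w n"
  proof -
    have "1 \<le> log 2 (real n + 1)" using n(1) by simp
    then show ?thesis using w[OF n(1)] by linarith
  qed
  have wlog: "log 2 (real n) \<le> real (w n)"
  proof -
    have "log 2 (real n) \<le> log 2 (real n + 1)" "0 \<le> log 2 (real n + 1)" using n(1) by auto
    then show ?thesis using w[OF n(1)] by linarith
  qed
  consider "card P = 1" | "2 \<le> card P" "large c (real (loglog n))" | "2 \<le> card P" "\<not> large c (real (loglog n))"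
    using card_P(1) by linarith
  then have "words (w n) D \<and> (2 \<le> n \<longrightarrow> ?space) \<and> ?forward \<and> ?backward"
  proof cases
    case 1
    then have D: "D = [0]" by (simp add: D_def encoding_def)
    have l0: "l = 0" using 1 by (simp add: l_def)
    have "real (length D * w n) \<le> C * (real (card P) * log 2 (real n))" if "2 \<le> n"
    proof -
      have "0 \<le> log 2 (real n)" using that by simp
      then have "c * log 2 (real n) \<le> C * log 2 (real n)" using c(1) by (intro mult_right_mono) (auto simp: C_def)
      then show ?thesis using c(2)[OF that] 1 D by simp
    qed
    then have "2 \<le> n \<longrightarrow> ?space"
      using H l0 by (auto intro: add_increasing)
    moreover have ?forward
      by (rule supportsI[where T = "\<lambda>_. 5" and d = "\<lambda>_. 0", OF n(1) _ _ _ _ l H R qC])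
        (use answers_identity[OF regs_table_e(1) w1, of forward_query] singleton_identity[OF 1] l H D
          in \<open>auto simp: query_constant_def\<close>)
    moreover have "inv \<pi> i = i" if "i \<in> {1..n}" for i
      using singleton_identity[OF 1 that] permutes_inverses(2)[OF perm, of i] by simp
    then have ?backward
      by (intro supportsI[where T = "\<lambda>_. 5" and d = "\<lambda>_. 0", OF n(1) _ _ _ _ l H R qC])
        (use answers_identity[OF regs_table_e(2) w1, of backward_query] l H D
          in \<open>auto simp: query_constant_def\<close>)
    moreover have "words (w n) D" by (simp add: D words_def)
    ultimately show ?thesis by blast
  next
    case 2
    let ?t = "optimal_code P" and ?g = "loglog n"
    have n2: "2 \<le> n" using card_P 2 by linarith
    have D: "D = main_layout (w n) (?g ^ 4) (8 * ?g) (?g ^ 2) ((2 ^ ?g) ^ 2) ((2 ^ ?g) ^ 2) ?t"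
      using 2 by (simp add: D_def encoding_def Let_def)
    note t = optimal_code[OF 2(1) S]
    note main = main_layout_bounds[OF t 2(1) refl 2(2) wlog c(2)[OF n2] w4 c(1), folded D]
    have space: ?space
    proof -
      have "55 * c * (real (card P) * log 2 (real n)) \<le> C * (real (card P) * log 2 (real n))"
        using n2 by (intro mult_right_mono) (auto simp: C_def)
      then show ?thesis using main(2) 2(2) by (simp add: space_error_def l_def)
    qed
    have sd: "real (\<Sum>i=1..n. depth ?t (block_of P i)) \<le> real n * (1 + ?H)"
      using t(3) by (simp only: sum_depth)
    have ?forward
    proof (rule supportsI[where d = "\<lambda>i. depth ?t (block_of P i)", OF n(1) _ _ _ sd l H R qC])
      show "answers (w n) ?fwd D i (\<pi> i)
          (forward_cost * depth ?t (block_of P i) + 28)"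
        if "i \<in> {1..n}" for i
        by (rule main(3)[OF that regs_table_e(1)])
      show "forward_cost * depth ?t (block_of P i) + 28
          \<le> query_constant * (depth ?t (block_of P i) + 1)" for i
        unfolding distrib_left by (intro add_mono mult_right_mono) (auto simp: query_constant_def)
      show "real (depth ?t (block_of P i)) \<le> 2 * l + 6" if "i \<in> {1..n}" for i
        using t(4) block_of_mem(1)[OF that] by (simp add: l_def)
    qed
    moreover have ?backward
    proof (rule supportsI[where d = "\<lambda>i. depth ?t (block_of P (inv \<pi> i))", OF n(1) _ _ _ _ l H R qC])
      show "answers (w n) ?bwd D i (inv \<pi> i)
          (backward_cost * depth ?t (block_of P (inv \<pi> i)) + 28)"
        if "i \<in> {1..n}" for i
        by (rule main(4)[OF that regs_table_e(2)])
      show "backward_cost * depth ?t (block_of P (inv \<pi> i)) + 28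
          \<le> query_constant * (depth ?t (block_of P (inv \<pi> i)) + 1)" for i
        unfolding distrib_left by (intro add_mono mult_right_mono) (auto simp: query_constant_def)
      show "real (depth ?t (block_of P (inv \<pi> i))) \<le> 2 * l + 6" if "i \<in> {1..n}" for i
      proof -
        have "inv \<pi> i \<in> {1..n}" using permutes_in_image[OF permutes_inv[OF perm]] that by blast
        then show ?thesis using t(4) block_of_mem(1) by (simp add: l_def)
      qed
      \<comment> \<open>The preimages of all values are all positions in another order, so the
        average depth is that of the forward direction.\<close>
      have "(\<Sum>i=1..n. depth ?t (block_of P (inv \<pi> i))) = (\<Sum>i=1..n. depth ?t (block_of P i))"
        using sum.permute[OF permutes_inv[OF perm], of "\<lambda>i. depth ?t (block_of P i)"] by (simp add: comp_def)
      then show "real (\<Sum>i=1..n. depth ?t (block_of P (inv \<pi> i))) \<le> real n * (1 + ?H)" using sd by simp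
    qed
    ultimately show ?thesis using main(1) space by blast
  next
    case 3
    then have D: "D = table_layout n \<pi>" by (simp add: D_def encoding_def)
    have n2: "2 \<le> n" using card_P 3 by linarith
    have l1: "1 \<le> l" using 3 by (simp add: l_def)
    have len: "length D = 2 * n + 2" by (simp add: D table_layout_def)
    have n2w: "2 * n + 2 \<le> 2 ^ w n" using w4 n4 n(1) by linarith
    have "x < 2 ^ w n" if "x \<in> set D" for x
    proof -
      have "\<pi> i \<in> {1..n}" "inv \<pi> i \<in> {1..n}" if "i \<in> {1..n}" for i
        using permutes_in_image[OF perm] permutes_in_image[OF permutes_inv[OF perm]] that by blast+
      then have "x \<le> n" using that n2 unfolding D table_layout_def by fastforce
      then show ?thesis using n2w n(1) by linarith
    qed
    then have wd: "words (w n) D" unfolding words_def len using n2w by blast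
    have space: ?space
    proof -
      have "real (length D * w n) = (2 * real n + 2) * real (w n)" by (simp add: len algebra_simps)
      also have "\<dots> \<le> (3 * real n) * real (w n)" using n2 by (intro mult_right_mono) auto
      also have "\<dots> = 3 * real (w n) * (real n * 1)" by simp
      also have "\<dots> \<le> 3 * real (w n) * (real n * l)" using l1 by (intro mult_left_mono) auto
      also have "\<dots> = space_error c w n * (real n * l)" using 3 by (simp add: space_error_def)
      finally show ?thesis
        using H c(1) n2 by (intro add_increasing2 add_increasing) (auto simp: C_def)
    qed
    have ?forward
      by (rule supportsI[where T = "\<lambda>_. 6 + cost forward_table_e" and d = "\<lambda>_. 0", OF n(1) _ _ _ _ l H R qC])
        (use answers_table(1)[OF _ n2w] l H D in \<open>auto simp: query_constant_def\<close>)
    moreover have ?backward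
      by (rule supportsI[where T = "\<lambda>_. 6 + cost backward_table_e" and d = "\<lambda>_. 0", OF n(1) _ _ _ _ l H R qC])
        (use answers_table(2)[OF _ n2w] l H D in \<open>auto simp: query_constant_def\<close>)
    ultimately show ?thesis using wd space by blast
  qed
  then show "words (w n) D" "2 \<le> n \<Longrightarrow> ?space" ?forward ?backward by blast+
qed

theorem theorem3p11:
  shows "\<exists>c\<^sub>0::real. c\<^sub>0 \<ge> 1 \<and> (\<forall>w :: nat \<Rightarrow> nat.
    (\<lambda>n. real (w n)) \<in> \<Theta>(\<lambda>n. log 2 (real n)) \<and>
    (\<forall>n\<ge>1. c\<^sub>0 * log 2 (real n + 1) \<le> real (w n)) \<longrightarrow>
    (\<exists>(enc :: nat \<Rightarrow> (nat \<Rightarrow> nat) \<Rightarrow> nat set set \<Rightarrow> nat list) (fwd :: com) (bwd :: com)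
        (\<epsilon> :: nat \<Rightarrow> real) (C :: real).
      \<epsilon> \<longlonglongrightarrow> 0 \<and>
      (\<forall>n \<pi> P S \<sigma> D W A.
        n \<ge> 1 \<and> \<pi> permutes {1..n} \<and>
        shuffled_upsequences n \<pi> P \<and> card P = \<sigma> \<and> \<sigma> = min_upsequences n \<pi> \<and>
        mset S = image_mset card (mset_set P) \<and>
        D = enc n \<pi> P \<and>
        W = C * (1 + log 2 (real \<sigma>)) \<and>
        A = C * (1 + seq_entropy S + log 2 (real \<sigma>) / log 2 (log 2 (real n))) \<longrightarrow>
        words (w n) D \<and>
        (n \<ge> 2 \<longrightarrow> real (length D * w n) \<le>
           2 * real n * (1 + seq_entropy S) + \<epsilon> n * (real n * log 2 (real \<sigma>))
           + C * (real \<sigma> * log 2 (real n))) \<and>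
        supports (w n) fwd D n \<pi> W A \<and>
        supports (w n) bwd D n (inv \<pi>) W A)))"
  (is "\<exists>c\<^sub>0. _ \<and> (\<forall>w. _ c\<^sub>0 w \<longrightarrow> ?scheme w)")
\<comment> \<open>The factor 4 amounts to \<open>(n + 1) ^ 4 \<le> 2 ^ w n\<close>, which leaves
  room in a word for addresses and intermediate values of order \<open>n * n\<close>.\<close>
proof (intro exI[of _ "4 :: real"] conjI allI impI)
  fix w :: "nat \<Rightarrow> nat"
  assume w: "(\<lambda>n. real (w n)) \<in> \<Theta>(\<lambda>n. log 2 (real n)) \<and>
    (\<forall>n\<ge>1. 4 * log 2 (real n + 1) \<le> real (w n))"
  then obtain c where c: "0 < c" "\<And>n. 2 \<le> n \<Longrightarrow> real (w n) \<le> c * log 2 (real n)"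
    using log_word_bound[of w] by (auto simp: bigtheta_def)
  have w4: "\<And>n. 1 \<le> n \<Longrightarrow> 4 * log 2 (real n + 1) \<le> real (w n)" using w by blast
  note correct = encoding_correct[OF c w4]
  show "?scheme w"
    by (rule exI[of _ "encoding c w"], rule exI[of _ "dispatch forward_table_e forward_query"],
        rule exI[of _ "dispatch backward_table_e backward_query"],
        rule exI[of _ "space_error c w"], rule exI[of _ "7 * real query_constant + 55 * c"],
        intro conjI allI impI space_error_tendsto c(1); (elim conjE, hypsubst)?)
      (blast intro: correct)+
qed simp

end
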